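(* Let $v\in H^{-1}_{loc}(\mathbb{R})$ be a (complex-valued) $\pi$-periodic potential, let $bc$ be one of the boundary conditions $Per^+$, $Per^-$, $Dir$, let $L_{bc}$ be the Hill operator $-d^2/dx^2+v$ on $[0,\pi]$ with boundary conditions $bc$, and let $L^0_{bc}$ be the free operator (the case $v=0$). For all large enough $n$ ($n$ even if $bc=Per^+$, $n$ odd if $bc=Per^-$, $n$ arbitrary if $bc=Dir$) let $$P_n=\frac1{2\pi i}\int_{C_n}(\lambda-L_{bc})^{-1}d\lambda,\qquad P_n^0=\frac1{2\pi i}\int_{C_n}(\lambda-L^0_{bc})^{-1}d\lambda,\qquad C_n=\{\lambda:\ |\lambda-n^2|=n\}.$$ Then $$\|P_n-P_n^0\|_{L^1\to L^\infty}\to0\quad\text{as } n\to\infty.$$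
   Context: Every $\pi$-periodic $v\in H^{-1}_{loc}(\mathbb{R})$ can be written $v=v_0+Q'$ with $v_0$ constant and $Q\in L^2_{loc}(\mathbb{R})$ $\pi$-periodic with zero mean. On $[0,\pi]$ put $\ell(y)=-(y'-Qy)'-Qy'+v_0y$. The operators $L_{Per^+}$, $L_{Per^-}$, $L_{Dir}$ act in $L^2([0,\pi])$ by $y\mapsto\ell(y)$ on the domain of all $y\in H^1([0,\pi])$ such that $y'-Qy\in W^1_1([0,\pi])$ (absolutely continuous), $\ell(y)\in L^2([0,\pi])$, and respectively: $y(\pi)=\pm y(0)$, $(y'-Qy)(\pi)=\pm(y'-Qy)(0)$ for $Per^\pm$; $y(0)=y(\pi)=0$ for $Dir$. Their spectra are discrete, and for all large $n$ (of the relevant parity) the circle $C_n$ does not meet the spectrum and encloses exactly two eigenvalues of $L_{Per^\pm}$ (counted with algebraic multiplicity), respectively one eigenvalue of $L_{Dir}$, so $P_n$ is a well-defined Riesz projection. $\|T\|_{L^1\to L^\infty}$ denotes the norm of $T$ as an operator from $L^1([0,\pi])$ to $L^\infty([0,\pi])$ (for $T$ given on $L^2$: $\sup\{\|Tf\|_\infty:\ f\in L^2([0,\pi]),\ \|f\|_{L^1}\le1\}$). *)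

theory Defs
  imports
    "HOL-Analysis.Analysis"
    "HOL-Complex_Analysis.Contour_Integration"
    "HOL-Probability.Essential_Supremum"
begin

section \<open>The Hilbert space of square-integrable functions on the interval from 0 to pi\<close>

definition square_integrable_on :: "(real \<Rightarrow> complex) \<Rightarrow> real set \<Rightarrow> bool"
    (infix "square'_integrable'_on" 50)
  where "f square_integrable_on S \<longleftrightarrow>
    f \<in> borel_measurable (lebesgue_on S) \<and> integrable (lebesgue_on S) (\<lambda>x. (norm (f x))\<^sup>2)"

lemma square_integrable_mult_integrable:
  fixes h :: "complex \<Rightarrow> complex \<Rightarrow> 'b :: euclidean_space"
  assumes f: "f square_integrable_on S" and g: "g square_integrable_on S"
    and h: "(\<lambda>x. h (f x) (g x)) \<in> borel_measurable (lebesgue_on S)"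
    and le: "\<And>a b. norm (h a b) \<le> norm a * norm b"
  shows "integrable (lebesgue_on S) (\<lambda>x. h (f x) (g x))"
proof (rule Bochner_Integration.integrable_bound[OF _ h])
  show "integrable (lebesgue_on S) (\<lambda>x. (norm (f x))\<^sup>2 + (norm (g x))\<^sup>2)"
    using f g by (simp add: square_integrable_on_def)
  have "norm (h a b) \<le> norm ((norm a)\<^sup>2 + (norm b)\<^sup>2)" for a b
  proof -
    have "2 * (norm a * norm b) \<le> (norm a)\<^sup>2 + (norm b)\<^sup>2"
      using sum_squares_bound[of "norm a" "norm b"] by (simp add: mult.assoc)
    moreover have "0 \<le> norm a * norm b" by simp
    ultimately show ?thesis using le[of a b] by (simp only: real_norm_def)
  qed
  then show "AE x in lebesgue_on S. norm (h (f x) (g x)) \<le> norm ((norm (f x))\<^sup>2 + (norm (g x))\<^sup>2)"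
    by simp
qed

lemma square_integrable_add:
  assumes f: "f square_integrable_on S" and g: "g square_integrable_on S"
  shows "(\<lambda>x. f x + g x) square_integrable_on S"
proof -
  have [measurable]: "f \<in> borel_measurable (lebesgue_on S)" "g \<in> borel_measurable (lebesgue_on S)"
    using f g by (auto simp: square_integrable_on_def)
  have "integrable (lebesgue_on S) (\<lambda>x. (norm (f x + g x))\<^sup>2)"
  proof (rule Bochner_Integration.integrable_bound)
    show "integrable (lebesgue_on S) (\<lambda>x. 2 * (norm (f x))\<^sup>2 + 2 * (norm (g x))\<^sup>2)"
      using f g by (simp add: square_integrable_on_def)
    have "(norm (a + b))\<^sup>2 \<le> 2 * (norm a)\<^sup>2 + 2 * (norm b)\<^sup>2" for a b :: complex
    proof -
      have "(norm (a + b))\<^sup>2 \<le> (norm a + norm b)\<^sup>2"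
        by (intro power_mono norm_triangle_ineq) auto
      also have "\<dots> \<le> 2 * (norm a)\<^sup>2 + 2 * (norm b)\<^sup>2"
        using sum_squares_bound[of "norm a" "norm b"] by (simp add: power2_sum)
      finally show ?thesis .
    qed
    then show "AE x in lebesgue_on S. norm ((norm (f x + g x))\<^sup>2)
        \<le> norm (2 * (norm (f x))\<^sup>2 + 2 * (norm (g x))\<^sup>2)"
      by simp
  qed measurable
  then show ?thesis by (simp add: square_integrable_on_def)
qed

lemma square_integrable_mult:
  assumes "f square_integrable_on S"
  shows "(\<lambda>x. c * f x) square_integrable_on S"
  using assms by (auto simp: square_integrable_on_def norm_mult power_mult_distrib)

lemma square_integrable_uminus:
  "f square_integrable_on S \<Longrightarrow> (\<lambda>x. - f x) square_integrable_on S"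
  using square_integrable_mult[of f S "-1"] by simp

abbreviation lebesgue_0pi :: "real measure"
  where "lebesgue_0pi \<equiv> lebesgue_on {0..pi}"

definition l2_rel :: "(real \<Rightarrow> complex) \<Rightarrow> (real \<Rightarrow> complex) \<Rightarrow> bool"
  where "l2_rel f g \<longleftrightarrow> f square_integrable_on {0..pi} \<and> g square_integrable_on {0..pi} \<and>
    (AE x in lebesgue_0pi. f x = g x)"

quotient_type l2 = "real \<Rightarrow> complex" / partial: l2_rel
proof (rule part_equivpI)
  show "\<exists>f. l2_rel f f"
    by (rule exI[of _ "\<lambda>_. 0"]) (simp add: l2_rel_def square_integrable_on_def)
  show "symp l2_rel" by (auto simp: symp_def l2_rel_def)
  show "transp l2_rel" by (auto simp: transp_def l2_rel_def)
qed

lemma l2_relD: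
  assumes "l2_rel f g"
  shows "f \<in> borel_measurable lebesgue_0pi" "g \<in> borel_measurable lebesgue_0pi"
    "AE x in lebesgue_0pi. f x = g x"
  using assms by (auto simp: l2_rel_def square_integrable_on_def)

instantiation l2 :: real_inner
begin

lift_definition zero_l2 :: l2 is "\<lambda>_. 0"
  by (simp add: l2_rel_def square_integrable_on_def)

lift_definition plus_l2 :: "l2 \<Rightarrow> l2 \<Rightarrow> l2" is "\<lambda>f g x. f x + g x"
  by (auto simp: l2_rel_def square_integrable_add)

lift_definition uminus_l2 :: "l2 \<Rightarrow> l2" is "\<lambda>f x. - f x"
  by (auto simp: l2_rel_def square_integrable_uminus)

definition minus_l2 :: "l2 \<Rightarrow> l2 \<Rightarrow> l2" where "minus_l2 f g = f + (- g)"

lift_definition scaleR_l2 :: "real \<Rightarrow> l2 \<Rightarrow> l2" is "\<lambda>r f x. of_real r * f x"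
  by (auto simp: l2_rel_def square_integrable_mult)

lift_definition inner_l2 :: "l2 \<Rightarrow> l2 \<Rightarrow> real" is "\<lambda>f g. LINT x|lebesgue_0pi. f x \<bullet> g x"
proof -
  fix f f' g g' assume f: "l2_rel f f'" and g: "l2_rel g g'"
  note [measurable] = l2_relD(1,2)[OF f] l2_relD(1,2)[OF g]
  show "(LINT x|lebesgue_0pi. f x \<bullet> g x) = (LINT x|lebesgue_0pi. f' x \<bullet> g' x)"
    by (rule integral_cong_AE) (use l2_relD(3)[OF f] l2_relD(3)[OF g] in auto)
qed

lift_definition norm_l2 :: "l2 \<Rightarrow> real" is "\<lambda>f. sqrt (LINT x|lebesgue_0pi. (norm (f x))\<^sup>2)"
proof -
  fix f g assume fg: "l2_rel f g"
  note [measurable] = l2_relD(1,2)[OF fg]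
  have "(LINT x|lebesgue_0pi. (norm (f x))\<^sup>2) = (LINT x|lebesgue_0pi. (norm (g x))\<^sup>2)"
    by (rule integral_cong_AE) (use l2_relD(3)[OF fg] in auto)
  then show "sqrt (LINT x|lebesgue_0pi. (norm (f x))\<^sup>2) = sqrt (LINT x|lebesgue_0pi. (norm (g x))\<^sup>2)"
    by simp
qed

definition sgn_l2 :: "l2 \<Rightarrow> l2" where "sgn_l2 f = inverse (norm f) *\<^sub>R f"

definition dist_l2 :: "l2 \<Rightarrow> l2 \<Rightarrow> real" where "dist_l2 f g = norm (f - g)"

definition uniformity_l2 :: "(l2 \<times> l2) filter"
  where "uniformity_l2 = (INF e\<in>{0 <..}. principal {(x, y). dist x y < e})"

definition open_l2 :: "l2 set \<Rightarrow> bool"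
  where "open_l2 U = (\<forall>x\<in>U. \<forall>\<^sub>F (x', y) in uniformity. x' = x \<longrightarrow> y \<in> U)"

instance
proof
  fix a b c :: l2 and r s :: real
  have eq: "l2_rel f g" if "l2_rel f f" "l2_rel g g" "\<And>x. f x = g x" for f g
    using that by (auto simp: l2_rel_def)
  have "norm a = sqrt (inner a a)"
    by transfer (simp add: power2_norm_eq_inner)
  then show "norm a = sqrt (inner a a)" .
  show "a + b + c = a + (b + c)"
    by transfer (auto simp: l2_rel_def square_integrable_add add.assoc)
  show "a + b = b + a"
    by transfer (auto simp: l2_rel_def square_integrable_add add.commute)
  show "0 + a = a"
    by transfer (auto simp: l2_rel_def)
  show "- a + a = 0"
    by transfer (auto simp: l2_rel_def square_integrable_on_def)
  show "a - b = a + - b"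
    by (rule minus_l2_def)
  show "r *\<^sub>R (a + b) = r *\<^sub>R a + r *\<^sub>R b"
    by transfer (auto simp: l2_rel_def square_integrable_add square_integrable_mult distrib_left)
  show "(r + s) *\<^sub>R a = r *\<^sub>R a + s *\<^sub>R a"
    by transfer (auto simp: l2_rel_def distrib_right
      intro!: square_integrable_add square_integrable_mult
        square_integrable_mult[where c = "of_real r + of_real s", simplified distrib_right])
  show "r *\<^sub>R s *\<^sub>R a = (r * s) *\<^sub>R a"
    by transfer (auto simp: l2_rel_def mult.assoc intro!: square_integrable_mult)
  show "1 *\<^sub>R a = a"
    by transfer (auto simp: l2_rel_def)
  show "sgn a = inverse (norm a) *\<^sub>R a"
    by (rule sgn_l2_def)
  show "dist a b = norm (a - b)"
    by (rule dist_l2_def)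
  show "(uniformity :: (l2 \<times> l2) filter) = (INF e\<in>{0 <..}. principal {(x, y). dist x y < e})"
    by (rule uniformity_l2_def)
  show "open U = (\<forall>x\<in>U. \<forall>\<^sub>F (x', y) in uniformity. x' = x \<longrightarrow> y \<in> U)" for U :: "l2 set"
    by (rule open_l2_def)
  show "inner a b = inner b a"
    by transfer (simp add: inner_commute)
  have int: "integrable lebesgue_0pi (\<lambda>x. f x \<bullet> g x)" if f: "l2_rel f f" and g: "l2_rel g g" for f g
  proof -
    note [measurable] = l2_relD(1)[OF f] l2_relD(1)[OF g]
    show ?thesis
      by (rule square_integrable_mult_integrable)
        (use f g in \<open>auto simp: l2_rel_def Cauchy_Schwarz_ineq2\<close>)
  qed
  show "inner (a + b) c = inner a c + inner b c"
    by transfer (simp add: inner_add_left int)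
  show "inner (r *\<^sub>R a) b = r * inner a b"
    by transfer (simp add: scaleR_conv_of_real[symmetric])
  show "0 \<le> inner a a"
    by transfer simp
  show "inner a a = 0 \<longleftrightarrow> a = 0"
  proof (transfer, goal_cases)
    case (1 f)
    have "(LINT x|lebesgue_0pi. f x \<bullet> f x) = 0 \<longleftrightarrow> (AE x in lebesgue_0pi. f x \<bullet> f x = 0)"
      by (rule integral_nonneg_eq_0_iff_AE) (use int[OF 1 1] in auto)
    then show ?case using 1 by (auto simp: l2_rel_def square_integrable_on_def)
  qed
qed

end

lift_definition scaleC_l2 :: "complex \<Rightarrow> l2 \<Rightarrow> l2" (infixr "*\<^sub>C" 75) is "\<lambda>c f x. c * f x"
  by (auto simp: l2_rel_def square_integrable_mult)

lemma bounded_linear_scaleC_l2: "bounded_linear (\<lambda>f. c *\<^sub>C f)"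
proof (rule bounded_linear_intro)
  fix f g :: l2 and r :: real
  show "c *\<^sub>C (f + g) = c *\<^sub>C f + c *\<^sub>C g"
    by transfer (auto simp: l2_rel_def square_integrable_add square_integrable_mult distrib_left)
  show "c *\<^sub>C (r *\<^sub>R f) = r *\<^sub>R (c *\<^sub>C f)"
    by transfer (auto simp: l2_rel_def mult.left_commute intro!: square_integrable_mult)
  show "norm (c *\<^sub>C f) \<le> norm f * norm c"
    by transfer (simp add: norm_mult power_mult_distrib real_sqrt_mult)
qed

definition scaleC_blinfun :: "complex \<Rightarrow> (l2 \<Rightarrow>\<^sub>L l2) \<Rightarrow> (l2 \<Rightarrow>\<^sub>L l2)" (infixr "*\<^sub>B" 75)
  where "c *\<^sub>B T = Blinfun (\<lambda>f. c *\<^sub>C blinfun_apply T f)"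

lemma scaleC_blinfun_apply [simp]: "blinfun_apply (c *\<^sub>B T) f = c *\<^sub>C blinfun_apply T f"
  unfolding scaleC_blinfun_def
  by (subst bounded_linear_Blinfun_apply)
    (auto intro: bounded_linear_compose[OF bounded_linear_scaleC_l2] blinfun.bounded_linear_right)

lift_definition l1_norm :: "l2 \<Rightarrow> real" is "\<lambda>f. LINT x|lebesgue_0pi. norm (f x)"
proof -
  fix f g assume fg: "l2_rel f g"
  note [measurable] = l2_relD(1,2)[OF fg]
  show "(LINT x|lebesgue_0pi. norm (f x)) = (LINT x|lebesgue_0pi. norm (g x))"
    by (rule integral_cong_AE) (use l2_relD(3)[OF fg] in auto)
qed

lift_definition linf_norm :: "l2 \<Rightarrow> ennreal" is "\<lambda>f. esssup lebesgue_0pi (\<lambda>x. ennreal (norm (f x)))"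
proof -
  fix f g assume fg: "l2_rel f g"
  note [measurable] = l2_relD(1,2)[OF fg]
  show "esssup lebesgue_0pi (\<lambda>x. ennreal (norm (f x))) = esssup lebesgue_0pi (\<lambda>x. ennreal (norm (g x)))"
    by (rule esssup_AE_cong) (use l2_relD(3)[OF fg] in auto)
qed

definition norm_L1_Linf :: "(l2 \<Rightarrow>\<^sub>L l2) \<Rightarrow> ennreal"
  where "norm_L1_Linf T = (SUP f\<in>{f. l1_norm f \<le> 1}. linf_norm (blinfun_apply T f))"

section \<open>Periodic distributions of order minus one\<close>

text \<open>A distribution on the real line is a functional \<open>v\<close> on functions; only its values on
  test functions are ever used.\<close>

definition test_function :: "(real \<Rightarrow> complex) \<Rightarrow> bool"
  where "test_function \<phi> \<longleftrightarrow>
    (\<exists>D :: nat \<Rightarrow> real \<Rightarrow> complex. D 0 = \<phi> \<and>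
      (\<forall>k x. (D k has_vector_derivative D (Suc k) x) (at x))) \<and>
    (\<exists>a b. \<forall>x. x \<notin> {a..b} \<longrightarrow> \<phi> x = 0)"

abbreviation derivative :: "(real \<Rightarrow> complex) \<Rightarrow> real \<Rightarrow> complex"
  where "derivative \<phi> x \<equiv> vector_derivative \<phi> (at x)"

definition h1_norm :: "(real \<Rightarrow> complex) \<Rightarrow> real"
  where "h1_norm \<phi> =
    sqrt ((LINT x|lebesgue. (norm (\<phi> x))\<^sup>2) + (LINT x|lebesgue. (norm (derivative \<phi> x))\<^sup>2))"

text \<open>On every bounded interval, \<open>v\<close> belongs to the dual of the closure in \<open>H\<^sup>1\<close> of the test
  functions supported there.\<close>

definition in_Hminus1_loc :: "((real \<Rightarrow> complex) \<Rightarrow> complex) \<Rightarrow> bool"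
  where "in_Hminus1_loc v \<longleftrightarrow>
    (\<forall>\<phi> \<psi> \<alpha> \<beta>. test_function \<phi> \<longrightarrow> test_function \<psi> \<longrightarrow>
      v (\<lambda>x. \<alpha> * \<phi> x + \<beta> * \<psi> x) = \<alpha> * v \<phi> + \<beta> * v \<psi>) \<and>
    (\<forall>a b. \<exists>C. \<forall>\<phi>. test_function \<phi> \<longrightarrow> (\<forall>x. x \<notin> {a..b} \<longrightarrow> \<phi> x = 0) \<longrightarrow>
      norm (v \<phi>) \<le> C * h1_norm \<phi>)"

definition periodic_distribution :: "real \<Rightarrow> ((real \<Rightarrow> complex) \<Rightarrow> complex) \<Rightarrow> bool"
  where "periodic_distribution p v \<longleftrightarrow>
    (\<forall>\<phi>. test_function \<phi> \<longrightarrow> v (\<lambda>x. \<phi> (x - p)) = v \<phi>)"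

text \<open>The decomposition \<open>v = v0 + Q'\<close> in the sense of distributions. Every \<open>pi\<close>-periodic \<open>v\<close> in
  \<open>H\<^sup>-\<^sup>1\<close> (locally) has one; \<open>v0\<close> is unique, and \<open>Q\<close> is unique up to a null set.\<close>

definition potential_decomposition ::
    "((real \<Rightarrow> complex) \<Rightarrow> complex) \<Rightarrow> complex \<Rightarrow> (real \<Rightarrow> complex) \<Rightarrow> bool"
  where "potential_decomposition v v0 Q \<longleftrightarrow>
    (\<forall>a b. Q square_integrable_on {a..b}) \<and>
    (AE x in lebesgue. Q (x + pi) = Q x) \<and>
    (LINT x|lebesgue_0pi. Q x) = 0 \<and>
    (\<forall>\<phi>. test_function \<phi> \<longrightarrow>
      v \<phi> = v0 * (LINT x|lebesgue. \<phi> x) - (LINT x|lebesgue. Q x * derivative \<phi> x))"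

section \<open>Hill operators and their Riesz projections\<close>

text \<open>\<open>y\<close> is absolutely continuous on the interval from 0 to pi, with (Lebesgue) derivative \<open>y'\<close>;
  that is, \<open>y\<close> is the continuous representative of a function in \<open>W\<^sup>1\<^sub>1\<close> with weak derivative \<open>y'\<close>.\<close>

definition has_ac_derivative :: "(real \<Rightarrow> complex) \<Rightarrow> (real \<Rightarrow> complex) \<Rightarrow> bool"
  where "has_ac_derivative y y' \<longleftrightarrow> integrable lebesgue_0pi y' \<and>
    (\<forall>x\<in>{0..pi}. y x = y 0 + (LINT t|lebesgue_on {0..x}. y' t))"

datatype boundary_condition = Per_plus | Per_minus | Dir

fun satisfies_bc :: "boundary_condition \<Rightarrow> (real \<Rightarrow> complex) \<Rightarrow> (real \<Rightarrow> complex) \<Rightarrow> bool"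
  where
    "satisfies_bc Per_plus y q \<longleftrightarrow> y pi = y 0 \<and> q pi = q 0"
  | "satisfies_bc Per_minus y q \<longleftrightarrow> y pi = - y 0 \<and> q pi = - q 0"
  | "satisfies_bc Dir y q \<longleftrightarrow> y 0 = 0 \<and> y pi = 0"

fun admissible :: "boundary_condition \<Rightarrow> nat \<Rightarrow> bool"
  where
    "admissible Per_plus n \<longleftrightarrow> even n"
  | "admissible Per_minus n \<longleftrightarrow> odd n"
  | "admissible Dir n \<longleftrightarrow> True"

text \<open>The graph of the operator. Here \<open>q\<close> is the absolutely continuous representative of the
  quasi-derivative \<open>y' - Q y\<close>, and \<open>l = - q' - Q y' + v0 y\<close>.\<close>

definition hill_operator ::
    "boundary_condition \<Rightarrow> complex \<Rightarrow> (real \<Rightarrow> complex) \<Rightarrow> (l2 \<times> l2) set"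
  where "hill_operator bc v0 Q = {(abs_l2 y, abs_l2 l) | y l. \<exists>y' q q'.
    has_ac_derivative y y' \<and> y' square_integrable_on {0..pi} \<and>
    has_ac_derivative q q' \<and> (AE x in lebesgue_0pi. q x = y' x - Q x * y x) \<and>
    l = (\<lambda>x. - q' x - Q x * y' x + v0 * y x) \<and> l square_integrable_on {0..pi} \<and>
    satisfies_bc bc y q}"

text \<open>The inverse of \<open>z - A\<close> as an everywhere defined bounded operator, for \<open>z\<close> in the resolvent
  set of the operator with graph \<open>A\<close> (unspecified otherwise).\<close>

definition resolvent :: "(l2 \<times> l2) set \<Rightarrow> complex \<Rightarrow> l2 \<Rightarrow>\<^sub>L l2"
  where "resolvent A z = (THE R. \<forall>f u. blinfun_apply R f = u \<longleftrightarrow>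
    (\<exists>w. (u, w) \<in> A \<and> z *\<^sub>C u - w = f))"

text \<open>The operator-valued analogue of \<open>contour_integral\<close>.\<close>

definition operator_contour_integral ::
    "(real \<Rightarrow> complex) \<Rightarrow> (complex \<Rightarrow> l2 \<Rightarrow>\<^sub>L l2) \<Rightarrow> l2 \<Rightarrow>\<^sub>L l2"
  where "operator_contour_integral \<gamma> F =
    integral {0..1} (\<lambda>t. vector_derivative \<gamma> (at t within {0..1}) *\<^sub>B F (\<gamma> t))"

definition riesz_projection :: "(l2 \<times> l2) set \<Rightarrow> nat \<Rightarrow> l2 \<Rightarrow>\<^sub>L l2"
  where "riesz_projection A n = (1 / (2 * of_real pi * \<i>)) *\<^sub>B
    operator_contour_integral (circlepath ((of_nat n)\<^sup>2) (real n)) (resolvent A)"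

end

theory Submission
  imports Defs
begin

text \<open>
  Write \<open>z = - \<kappa>\<^sup>2\<close> with \<open>\<kappa> = \<i> (n + \<mu>)\<close>; on the circle \<open>C\<^sub>n\<close> one has \<open>1/3 \<le> \<bar>\<mu>\<bar> \<le> 2/3\<close>. Variation of
  constants, \<open>y = a exp (\<kappa> x) + b exp (- \<kappa> x)\<close> and \<open>y' - Q y = \<kappa> (a exp (\<kappa> x) - b exp (- \<kappa> x))\<close>, turns
  \<open>(z - L) y = f\<close> into a first order system \<open>X' = B X + h\<close> for \<open>X = (a, b)\<close>, and the boundary condition into
  \<open>X = S (B X + h)\<close>, where \<open>S \<phi> = M (\<integral>\<phi>) + (\<integral> from 0 to x of \<phi>)\<close> and the matrix \<open>M\<close> stays bounded because \<open>\<mu>\<close>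
  keeps away from the resonances. The \<open>L\<^sup>1\<close> norm of \<open>B\<close> is not small, but by the Riemann-Lebesgue lemma
  its primitives are uniformly small, and an integration by parts makes \<open>S B S\<close> small from \<open>L\<^sup>1\<close> to \<open>L\<^sup>\<infinity>\<close>. Hence
  \<open>X\<close> exists, is unique, and differs from its free counterpart \<open>S h\<close> by \<open>o(1)\<close> times the \<open>L\<^sup>1\<close> norm of \<open>h\<close>, which
  is \<open>O(1/n)\<close> times that of \<open>f\<close>. So the resolvents differ by \<open>o(1/n)\<close> on a contour of length \<open>2 pi n\<close>.
\<close>

section \<open>Absolutely continuous functions\<close>

text \<open>\<open>Q\<close> is merely square integrable, so its derivative must never appear; the
  pair y, y' - Q y involves only \<open>Q\<close> and \<open>v0 - Q\<^sup>2\<close>, both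
  integrable. The structural fact is a cancellation: \<open>Q\<close> drops out of the diagonal of
  B. It drives a only through b and b only through a, hence always with a factor exp(2 \<kappa> x)
  or exp(-2 \<kappa> x), while \<open>v0 - Q\<^sup>2\<close> carries 1/(2 \<kappa>). So each entry
  of B is an oscillating part plus an O(1/n) part in L^1. The obstacle is that \<bar>exp(2 \<kappa>
  x)\<bar> is bounded below on the strip: in absolute value B stays of the order of
  \<open>Q\<close>, and smallness shows only after the integral equation is inserted into itself
  once. Riemann-Lebesgue is applied to the fixed function \<open>Q\<close>, never to f, and f enters
  through its L^1 norm alone; this makes the error uniform over the unit ball of L^1. That the
  circle avoids the spectrum is a by-product: solutions come from a fixed point, uniqueness from the
  a priori bound. The range of \<mu> comes from \<mu> (2 n + \<mu>) = z - n^2, whose modulus is n on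
  the circle.\<close>

lemma integrable_lebesgue_on_Icc_subset:
  fixes f :: "real \<Rightarrow> 'b::euclidean_space"
  assumes "integrable (lebesgue_on {a..b}) f" "{c..d} \<subseteq> {a..b}"
  shows "integrable (lebesgue_on {c..d}) f"
proof -
  have "set_integrable lebesgue {a..b} f"
    using assms(1) by (simp add: integrable_restrict_space set_integrable_def)
  then have "set_integrable lebesgue {c..d} f"
    by (rule set_integrable_subset) (use assms(2) in auto)
  then show ?thesis
    by (simp add: integrable_restrict_space set_integrable_def)
qed

lemma integral_lebesgue_on_Icc_restrict:
  fixes f :: "real \<Rightarrow> complex"
  assumes "c \<le> b"
  shows "(LINT t|lebesgue_on {a..b}. (if t \<le> c then f t else 0)) = (LINT t|lebesgue_on {a..c}. f t)"
proof -
  have "indicat_real {a..b} x *\<^sub>R (if x \<le> c then f x else 0) = indicat_real {a..c} x *\<^sub>R f x" for x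
    using assms by (auto simp: indicator_def)
  then show ?thesis
    by (simp add: integral_restrict_space)
qed

text \<open>The point \<open>c\<close> is a null set. The strict form is needed because a square is
  later cut into the triangles t <= s and s < t, which must not overlap.\<close>

lemma integral_lebesgue_on_Icc_restrict_less:
  fixes f :: "real \<Rightarrow> complex"
  assumes "c \<le> b" and f: "integrable (lebesgue_on {a..b}) f"
  shows "(LINT t|lebesgue_on {a..b}. (if t < c then f t else 0)) = (LINT t|lebesgue_on {a..c}. f t)"
proof -
  have [measurable]: "f \<in> borel_measurable (lebesgue_on {a..b})"
    using f by simp
  have m: "(\<lambda>t. t) \<in> borel_measurable (lebesgue_on {a..b})"
    by (intro continuous_imp_measurable_on_sets_lebesgue continuous_on_id) auto
  have "negligible {c}" by simp
  then have "AE t in lebesgue. t \<notin> {c}"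
    by (intro AE_not_in) (simp add: negligible_iff_null_sets)
  then have "AE t in lebesgue_on {a..b}. t \<noteq> c"
    by (auto simp: AE_restrict_space_iff elim: eventually_mono)
  then have "(LINT t|lebesgue_on {a..b}. (if t < c then f t else 0)) =
      (LINT t|lebesgue_on {a..b}. (if t \<le> c then f t else 0))"
    by (intro integral_cong_AE) (use m in \<open>auto intro!: measurable_If\<close>)
  then show ?thesis
    using integral_lebesgue_on_Icc_restrict[OF assms(1)] by simp
qed

section \<open>Fubini on the square and the product rule for absolutely continuous functions\<close>

lemma sigma_finite_lebesgue_on_Icc: "sigma_finite_measure (lebesgue_on {a..b::real})"
proof -
  have "finite_measure (lebesgue_on {a..b})"
    by (rule finite_measureI) (simp add: emeasure_restrict_space emeasure_lborel_Icc_eq)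
  then show ?thesis
    by (simp add: finite_measure_def)
qed

lemma integrable_pair_mult:
  fixes f g :: "'a \<Rightarrow> complex"
  assumes M: "sigma_finite_measure M" and f: "integrable M f" and g: "integrable M g"
  shows "integrable (M \<Otimes>\<^sub>M M) (\<lambda>(s, t). f s * g t)"
proof -
  interpret pair_sigma_finite M M
    using M by (simp add: pair_sigma_finite_def)
  have [measurable]: "f \<in> borel_measurable M" "g \<in> borel_measurable M"
    using f g by auto
  show ?thesis
    by (rule Fubini_integrable) (use f g in \<open>auto simp: norm_mult\<close>)
qed

text \<open>Fubini for u(s) v(t) on the square, cut along the diagonal. This is integration by parts
  for primitives of integrable functions; it yields both the product rule and the oscillation
  estimate.\<close>

lemma integral_product_indefinite:
  fixes u v :: "real \<Rightarrow> complex"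
  assumes u: "integrable (lebesgue_on {0..x}) u" and v: "integrable (lebesgue_on {0..x}) v"
  shows "(LINT t|lebesgue_on {0..x}. u t) * (LINT t|lebesgue_on {0..x}. v t) =
    (LINT s|lebesgue_on {0..x}. u s * (LINT t|lebesgue_on {0..s}. v t)) +
    (LINT t|lebesgue_on {0..x}. (LINT s|lebesgue_on {0..t}. u s) * v t)"
proof -
  let ?M = "lebesgue_on {0..x}"
  interpret pair_sigma_finite ?M ?M
    by (simp add: pair_sigma_finite_def sigma_finite_lebesgue_on_Icc)
  note uv = integrable_pair_mult[OF sigma_finite_lebesgue_on_Icc u v]
  have m[measurable]: "(\<lambda>t. t) \<in> borel_measurable ?M"
    by (intro continuous_imp_measurable_on_sets_lebesgue continuous_on_id) auto
  have [measurable]: "u \<in> borel_measurable ?M" "v \<in> borel_measurable ?M"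
    using u v by auto
  have i1: "integrable (?M \<Otimes>\<^sub>M ?M) (\<lambda>(s, t). if t \<le> s then u s * v t else 0)"
    by (rule Bochner_Integration.integrable_bound[OF uv]) (measurable, auto)
  have i2: "integrable (?M \<Otimes>\<^sub>M ?M) (\<lambda>(s, t). if s < t then u s * v t else 0)"
    by (rule Bochner_Integration.integrable_bound[OF uv]) (measurable, auto)
  have "(LINT t|?M. u t) * (LINT t|?M. v t) = (LINT s|?M. (LINT t|?M. u s * v t))"
    by simp
  also have "\<dots> = integral\<^sup>L (?M \<Otimes>\<^sub>M ?M) (\<lambda>(s, t). u s * v t)"
    using integral_fst'[OF uv] by simp
  also have "\<dots> = integral\<^sup>L (?M \<Otimes>\<^sub>M ?M) (\<lambda>z. (case z of (s, t) \<Rightarrow> if t \<le> s then u s * v t else 0) +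
      (case z of (s, t) \<Rightarrow> if s < t then u s * v t else 0))"
    by (rule Bochner_Integration.integral_cong) auto
  also have "\<dots> = integral\<^sup>L (?M \<Otimes>\<^sub>M ?M) (\<lambda>(s, t). if t \<le> s then u s * v t else 0) +
      integral\<^sup>L (?M \<Otimes>\<^sub>M ?M) (\<lambda>(s, t). if s < t then u s * v t else 0)"
    by (rule Bochner_Integration.integral_add[OF i1 i2])
  also have "integral\<^sup>L (?M \<Otimes>\<^sub>M ?M) (\<lambda>(s, t). if t \<le> s then u s * v t else 0) =
      (LINT s|?M. (LINT t|?M. (if t \<le> s then u s * v t else 0)))"
    using integral_fst'[OF i1] by simp
  also have "\<dots> = (LINT s|?M. u s * (LINT t|lebesgue_on {0..s}. v t))"
  proof (rule Bochner_Integration.integral_cong)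
    fix s assume s: "s \<in> space ?M"
    have "(LINT t|?M. (if t \<le> s then u s * v t else 0)) = (LINT t|?M. u s * (if t \<le> s then v t else 0))"
      by (rule Bochner_Integration.integral_cong) auto
    then show "(LINT t|?M. (if t \<le> s then u s * v t else 0)) = u s * (LINT t|lebesgue_on {0..s}. v t)"
      using s by (simp add: integral_lebesgue_on_Icc_restrict)
  qed simp
  also have "integral\<^sup>L (?M \<Otimes>\<^sub>M ?M) (\<lambda>(s, t). if s < t then u s * v t else 0) =
      (LINT t|?M. (LINT s|?M. (if s < t then u s * v t else 0)))"
    using integral_snd[OF i2] by simp
  also have "\<dots> = (LINT t|?M. (LINT s|lebesgue_on {0..t}. u s) * v t)"
  proof (rule Bochner_Integration.integral_cong)
    fix t assume t: "t \<in> space ?M"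
    have "(LINT s|?M. (if s < t then u s * v t else 0)) = (LINT s|?M. (if s < t then u s else 0) * v t)"
      by (rule Bochner_Integration.integral_cong) auto
    then show "(LINT s|?M. (if s < t then u s * v t else 0)) = (LINT s|lebesgue_on {0..t}. u s) * v t"
      using t u by (simp add: integral_lebesgue_on_Icc_restrict_less)
  qed simp
  finally show ?thesis .
qed

lemma norm_indefinite_integral_le:
  fixes f :: "real \<Rightarrow> complex"
  assumes f: "integrable (lebesgue_on {a..b}) f" and "x \<le> b"
  shows "norm (LINT t|lebesgue_on {a..x}. f t) \<le> (LINT t|lebesgue_on {a..b}. norm (f t))"
proof -
  have i: "integrable (lebesgue_on {a..x}) f"
    using integrable_lebesgue_on_Icc_subset[OF f] assms(2) by simp
  have n: "integrable (lebesgue_on {a..b}) (\<lambda>t. norm (f t))" 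
    using f by simp
  have "norm (LINT t|lebesgue_on {a..x}. f t) \<le> (LINT t|lebesgue_on {a..x}. norm (f t))"
    using i by simp
  also have "\<dots> \<le> (LINT t|lebesgue_on {a..b}. norm (f t))"
  proof -
    have n': "integrable lebesgue (\<lambda>t. indicat_real {a..x} t *\<^sub>R norm (f t))"
        "integrable lebesgue (\<lambda>t. indicat_real {a..b} t *\<^sub>R norm (f t))"
      using integrable_norm[OF i] n by (simp_all add: integrable_restrict_space)
    show ?thesis
      unfolding integral_restrict_space[where M = lebesgue and \<Omega> = "{a..x}", simplified]
        integral_restrict_space[where M = lebesgue and \<Omega> = "{a..b}", simplified]
      using n' by (intro integral_mono) (use assms(2) in \<open>auto simp: indicator_def\<close>)
  qed
  finally show ?thesis .
qed

lemma has_ac_derivative_iff: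
  "has_ac_derivative y y' \<longleftrightarrow> integrable lebesgue_0pi y' \<and>
    (\<forall>x\<in>{0..pi}. y x - y 0 = (LINT t|lebesgue_on {0..x}. y' t))"
  unfolding has_ac_derivative_def by (metis add_diff_cancel_left' diff_add_cancel add.commute)

lemma has_ac_derivative_continuous_on:
  assumes "has_ac_derivative y y'"
  shows "continuous_on {0..pi} y"
proof -
  have "continuous_on {0..pi} (\<lambda>x. y 0 + (LINT t|lebesgue_on {0..x}. y' t))"
    by (intro continuous_intros indefinite_integral_continuous_real)
      (use assms in \<open>simp add: has_ac_derivative_iff\<close>)
  then show ?thesis
    by (rule continuous_on_eq) (use assms in \<open>metis has_ac_derivative_def\<close>)
qed

lemma integrable_mult_continuous:
  fixes f g :: "real \<Rightarrow> complex"
  assumes f: "integrable (lebesgue_on {a..b}) f" and g: "continuous_on {a..b} g"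
  shows "integrable (lebesgue_on {a..b}) (\<lambda>x. g x * f x)" "integrable (lebesgue_on {a..b}) (\<lambda>x. f x * g x)"
proof -
  have [measurable]: "f \<in> borel_measurable (lebesgue_on {a..b})" "g \<in> borel_measurable (lebesgue_on {a..b})"
    using f g by (auto intro: continuous_imp_measurable_on_sets_lebesgue)
  obtain B where B: "\<And>x. x \<in> {a..b} \<Longrightarrow> norm (g x) \<le> B"
    using compact_imp_bounded[OF compact_continuous_image[OF g compact_Icc]] unfolding bounded_iff by (metis imageI)
  show "integrable (lebesgue_on {a..b}) (\<lambda>x. g x * f x)"
  proof (rule Bochner_Integration.integrable_bound)
    show "integrable (lebesgue_on {a..b}) (\<lambda>x. B * norm (f x))"
      using f by simp
    show "AE x in lebesgue_on {a..b}. norm (g x * f x) \<le> norm (B * norm (f x))"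
      by (rule AE_I2) (auto simp: norm_mult abs_mult intro!: mult_right_mono order_trans[OF B])
  qed measurable
  then show "integrable (lebesgue_on {a..b}) (\<lambda>x. f x * g x)"
    by (simp add: mult.commute)
qed

text \<open>Writing each factor as its value at 0 plus a primitive reduces the claim to the product
  of two primitives, which is \<open>integral_product_indefinite\<close>.\<close>

lemma has_ac_derivative_mult:
  assumes u: "has_ac_derivative u u'" and v: "has_ac_derivative v v'"
  shows "has_ac_derivative (\<lambda>x. u x * v x) (\<lambda>x. u' x * v x + u x * v' x)"
proof -
  have iu: "integrable lebesgue_0pi u'" and iv: "integrable lebesgue_0pi v'"
    using u v by (auto simp: has_ac_derivative_iff)
  note cu = has_ac_derivative_continuous_on[OF u] and cv = has_ac_derivative_continuous_on[OF v]
  have iuv: "integrable lebesgue_0pi (\<lambda>x. u' x * v x)" "integrable lebesgue_0pi (\<lambda>x. u x * v' x)"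
    using integrable_mult_continuous[OF iu cv] integrable_mult_continuous[OF iv cu] by auto
  have "u x * v x = u 0 * v 0 + (LINT t|lebesgue_on {0..x}. u' t * v t + u t * v' t)"
    if x: "x \<in> {0..pi}" for x
  proof -
    have sub: "integrable (lebesgue_on {0..x}) f" if "integrable lebesgue_0pi f" for f :: "real \<Rightarrow> complex"
      using integrable_lebesgue_on_Icc_subset[OF that] x by auto
    have U: "u t = u 0 + (LINT s|lebesgue_on {0..t}. u' s)" if "t \<in> {0..x}" for t
      using u x that unfolding has_ac_derivative_def by (meson atLeastAtMost_iff order_trans)
    have V: "v t = v 0 + (LINT s|lebesgue_on {0..t}. v' s)" if "t \<in> {0..x}" for t
      using v x that unfolding has_ac_derivative_def by (meson atLeastAtMost_iff order_trans)
    have cu': "continuous_on {0..x} (\<lambda>t. LINT s|lebesgue_on {0..t}. u' s)"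
      by (rule indefinite_integral_continuous_real[OF sub[OF iu]])
    have cv': "continuous_on {0..x} (\<lambda>t. LINT s|lebesgue_on {0..t}. v' s)"
      by (rule indefinite_integral_continuous_real[OF sub[OF iv]])
    note j = integrable_mult_continuous(2)[OF sub[OF iu] cv'] integrable_mult_continuous(1)[OF sub[OF iv] cu']
    have "(LINT t|lebesgue_on {0..x}. u' t * v t + u t * v' t) =
      (LINT t|lebesgue_on {0..x}. (v 0 * u' t + u 0 * v' t) + 
        (u' t * (LINT s|lebesgue_on {0..t}. v' s) + (LINT s|lebesgue_on {0..t}. u' s) * v' t))"
    proof (rule Bochner_Integration.integral_cong)
      fix t assume "t \<in> space (lebesgue_on {0..x})"
      then have t: "t \<in> {0..x}" by simp
      show "u' t * v t + u t * v' t = (v 0 * u' t + u 0 * v' t) + 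
        (u' t * (LINT s|lebesgue_on {0..t}. v' s) + (LINT s|lebesgue_on {0..t}. u' s) * v' t)"
        by (subst U[OF t], subst V[OF t]) (simp add: algebra_simps)
    qed simp
    also have "\<dots> = v 0 * (LINT t|lebesgue_on {0..x}. u' t) + u 0 * (LINT t|lebesgue_on {0..x}. v' t)
      + (LINT t|lebesgue_on {0..x}. u' t) * (LINT t|lebesgue_on {0..x}. v' t)"
      using sub[OF iu] sub[OF iv] j
      by (simp add: integral_product_indefinite)
    finally show ?thesis
      using x by (subst U[of x], simp, subst V[of x], simp) (simp add: algebra_simps)
  qed
  then show ?thesis
    unfolding has_ac_derivative_def by (intro conjI ballI Bochner_Integration.integrable_add iuv)
qed

lemma has_ac_derivative_C1:
  assumes d: "\<And>x. x \<in> {0..pi} \<Longrightarrow> (y has_vector_derivative y' x) (at x)"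
    and c: "continuous_on {0..pi} y'"
  shows "has_ac_derivative y y'"
proof -
  have i: "integrable lebesgue_0pi y'"
    using c by (simp add: continuous_imp_integrable_real)
  have "y x = y 0 + (LINT t|lebesgue_on {0..x}. y' t)" if x: "x \<in> {0..pi}" for x
  proof -
    have "(y' has_integral (y x - y 0)) {0..x}"
      by (rule fundamental_theorem_of_calculus)
        (use x d in \<open>auto intro: has_vector_derivative_at_within\<close>)
    moreover have "integrable (lebesgue_on {0..x}) y'"
      using integrable_lebesgue_on_Icc_subset[OF i] x by auto
    ultimately show ?thesis
      by (simp add: lebesgue_integral_eq_integral integral_unique)
  qed
  then show ?thesis using i unfolding has_ac_derivative_def by blast
qed

lemma has_ac_derivative_add:
  assumes u: "has_ac_derivative u u'" and v: "has_ac_derivative v v'"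
  shows "has_ac_derivative (\<lambda>x. u x + v x) (\<lambda>x. u' x + v' x)"
proof -
  have iu: "integrable lebesgue_0pi u'" and iv: "integrable lebesgue_0pi v'"
    using u v by (auto simp: has_ac_derivative_iff)
  have "(LINT t|lebesgue_on {0..x}. u' t + v' t) =
      (LINT t|lebesgue_on {0..x}. u' t) + (LINT t|lebesgue_on {0..x}. v' t)" if "x \<in> {0..pi}" for x
    using that by (intro Bochner_Integration.integral_add integrable_lebesgue_on_Icc_subset[OF iu]
        integrable_lebesgue_on_Icc_subset[OF iv]) auto
  then show ?thesis
    using u v by (simp add: has_ac_derivative_iff add_diff_add)
qed

lemma has_ac_derivative_cmult:
  assumes u: "has_ac_derivative u u'"
  shows "has_ac_derivative (\<lambda>x. c * u x) (\<lambda>x. c * u' x)"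
  using u by (simp add: has_ac_derivative_iff right_diff_distrib[symmetric])

text \<open>The Hill equation holds only almost everywhere; this exchanges the derivative found by
  the product rule for the one that the equation prescribes.\<close>

lemma has_ac_derivative_cong_AE:
  assumes u: "has_ac_derivative u u'" and e: "AE x in lebesgue_0pi. u' x = w x" 
    and w: "w \<in> borel_measurable lebesgue_0pi"
  shows "has_ac_derivative u w"
proof -
  have iu: "integrable lebesgue_0pi u'"
    using u by (auto simp: has_ac_derivative_iff)
  then have m: "u' \<in> borel_measurable lebesgue_0pi" by simp
  have iw: "integrable lebesgue_0pi w"
    using iu integrable_cong_AE[OF m w e] by simp
  have "(LINT t|lebesgue_on {0..x}. u' t) = (LINT t|lebesgue_on {0..x}. w t)" if x: "x \<in> {0..pi}" for x
  proof (rule integral_cong_AE)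
    show "AE t in lebesgue_on {0..x}. u' t = w t"
      using e x by (auto simp: AE_restrict_space_iff elim!: eventually_mono)
    show "u' \<in> borel_measurable (lebesgue_on {0..x})"
      using integrable_lebesgue_on_Icc_subset[OF iu, of 0 x] x by auto
    show "w \<in> borel_measurable (lebesgue_on {0..x})"
      using integrable_lebesgue_on_Icc_subset[OF iw, of 0 x] x by auto
  qed
  then show ?thesis
    using u iw by (auto simp: has_ac_derivative_iff)
qed

text \<open>Integration by parts replaces \<beta>, which may be large in L^1, by its primitive,
  which is at most \<epsilon>. The boundary terms cost \<epsilon> times \<bar>c\<bar> plus the L^1
  norm of \<phi>, and the remaining integral costs \<epsilon> times that norm once more, hence the
  factor 2.\<close>

lemma norm_integral_oscillatory_le:
  fixes \<beta> \<phi> :: "real \<Rightarrow> complex"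
  assumes \<beta>: "integrable lebesgue_0pi \<beta>" and \<phi>: "integrable lebesgue_0pi \<phi>"
    and small: "\<And>x. x \<in> {0..pi} \<Longrightarrow> norm (LINT t|lebesgue_on {0..x}. \<beta> t) \<le> \<epsilon>"
    and x: "x \<in> {0..pi}"
  shows "norm (LINT t|lebesgue_on {0..x}. \<beta> t * (c + (LINT s|lebesgue_on {0..t}. \<phi> s)))
    \<le> \<epsilon> * (norm c + 2 * (LINT t|lebesgue_0pi. norm (\<phi> t)))"
proof -
  let ?U = "\<lambda>t. LINT s|lebesgue_on {0..t}. \<beta> s" and ?V = "\<lambda>t. LINT s|lebesgue_on {0..t}. \<phi> s"
  let ?N = "LINT t|lebesgue_0pi. norm (\<phi> t)"
  have sub: "integrable (lebesgue_on {0..x}) f" if "integrable lebesgue_0pi f" for f :: "real \<Rightarrow> complex"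
    using integrable_lebesgue_on_Icc_subset[OF that] x by auto
  have \<epsilon>: "0 \<le> \<epsilon>"
    using small[OF x] norm_ge_zero order_trans by blast
  have N: "0 \<le> ?N" by simp
  have cU: "continuous_on {0..x} ?U" and cV: "continuous_on {0..x} ?V"
    using indefinite_integral_continuous_real[OF sub[OF \<beta>]] indefinite_integral_continuous_real[OF sub[OF \<phi>]]
    by auto
  have i1: "integrable (lebesgue_on {0..x}) (\<lambda>t. \<beta> t * ?V t)"
    by (rule integrable_mult_continuous(2)[OF sub[OF \<beta>] cV])
  have i2: "integrable (lebesgue_on {0..x}) (\<lambda>t. ?U t * \<phi> t)"
    by (rule integrable_mult_continuous(1)[OF sub[OF \<phi>] cU])
  have "(LINT t|lebesgue_on {0..x}. \<beta> t * (c + ?V t)) = (LINT t|lebesgue_on {0..x}. c * \<beta> t + \<beta> t * ?V t)"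
    by (rule Bochner_Integration.integral_cong) (simp_all add: algebra_simps)
  also have "\<dots> = c * ?U x + (LINT t|lebesgue_on {0..x}. \<beta> t * ?V t)"
    using sub[OF \<beta>] i1 by simp
  also have "(LINT t|lebesgue_on {0..x}. \<beta> t * ?V t) = ?U x * ?V x - (LINT t|lebesgue_on {0..x}. ?U t * \<phi> t)"
    using integral_product_indefinite[OF sub[OF \<beta>] sub[OF \<phi>]] by simp
  finally have eq: "(LINT t|lebesgue_on {0..x}. \<beta> t * (c + ?V t)) =
      c * ?U x + (?U x * ?V x - (LINT t|lebesgue_on {0..x}. ?U t * \<phi> t))" .
  have V: "norm (?V x) \<le> ?N"
    using norm_indefinite_integral_le[OF \<phi>] x by auto
  have "norm (LINT t|lebesgue_on {0..x}. ?U t * \<phi> t) \<le> (LINT t|lebesgue_on {0..x}. norm (?U t * \<phi> t))"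
    using i2 by simp
  also have "\<dots> \<le> (LINT t|lebesgue_on {0..x}. \<epsilon> * norm (\<phi> t))"
  proof (rule integral_mono)
    show "integrable (lebesgue_on {0..x}) (\<lambda>t. norm (?U t * \<phi> t))"
      using i2 by (rule integrable_norm)
    show "integrable (lebesgue_on {0..x}) (\<lambda>t. \<epsilon> * norm (\<phi> t))"
      using sub[OF \<phi>] by simp
    show "norm (?U t * \<phi> t) \<le> \<epsilon> * norm (\<phi> t)" if "t \<in> space (lebesgue_on {0..x})" for t
      using small[of t] that x by (auto simp: norm_mult intro!: mult_right_mono)
  qed
  also have "\<dots> \<le> \<epsilon> * ?N"
  proof -
    \<comment> \<open>\<open>norm_indefinite_integral_le\<close> speaks of complex integrands, so
      the real function is embedded to reuse it for monotonicity in the upper limit.\<close>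
    have n: "integrable lebesgue_0pi (\<lambda>t. of_real (norm (\<phi> t)) :: complex)"
      using \<phi> by simp
    have "(LINT t|lebesgue_on {0..x}. norm (\<phi> t)) \<le> ?N"
      using norm_indefinite_integral_le[OF n, of x] x by simp
    then show ?thesis
      using \<epsilon> by (simp add: mult_left_mono)
  qed
  finally have W: "norm (LINT t|lebesgue_on {0..x}. ?U t * \<phi> t) \<le> \<epsilon> * ?N" .
  have "norm (c * ?U x + (?U x * ?V x - (LINT t|lebesgue_on {0..x}. ?U t * \<phi> t)))
    \<le> norm c * norm (?U x) + (norm (?U x) * norm (?V x) + norm (LINT t|lebesgue_on {0..x}. ?U t * \<phi> t))"
    by (intro norm_triangle_le norm_triangle_le_diff add_mono) (simp_all add: norm_mult)
  also have "\<dots> \<le> norm c * \<epsilon> + (\<epsilon> * ?N + \<epsilon> * ?N)"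
    using small[OF x] V W \<epsilon> by (intro add_mono mult_mono) auto
  finally show ?thesis
    unfolding eq by (simp add: algebra_simps)
qed

section \<open>A uniform Riemann-Lebesgue lemma\<close>

text \<open>One threshold \<open>K\<close> must serve every upper limit and every frequency in a
  complex strip, because the root of z is complex and primitives are needed at all x. Integrability
  is included so that the property is closed under the steps of the inductions below.\<close>

definition riemann_lebesgue :: "real \<Rightarrow> (real \<Rightarrow> complex) \<Rightarrow> bool"
  where "riemann_lebesgue r f \<longleftrightarrow> integrable lebesgue_0pi f \<and>
    (\<forall>\<epsilon>>0. \<exists>K. \<forall>k x. K \<le> norm k \<longrightarrow> \<bar>Im k\<bar> \<le> r \<longrightarrow> x \<in> {0..pi} \<longrightarrow>
      norm (LINT t|lebesgue_on {0..x}. exp (\<i> * k * t) * f t) \<le> \<epsilon>)"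

lemma norm_exp_strip_le:
  assumes "\<bar>Im k\<bar> \<le> r" "t \<in> {0..pi}"
  shows "norm (exp (\<i> * k * complex_of_real t)) \<le> exp (r * pi)"
proof -
  have "- (Im k * t) \<le> r * pi"
    using assms mult_mono[of "\<bar>Im k\<bar>" r t pi] by (simp add: abs_if split: if_splits)
       (smt (verit) mult_nonneg_nonneg mult_minus_left)+
  then show ?thesis
    by (simp add: norm_exp_eq_Re)
qed

lemma continuous_on_exp_ik: "continuous_on A (\<lambda>t. exp (\<i> * k * complex_of_real t))"
  by (intro continuous_intros)

text \<open>The exponential is integrated explicitly, which gives O(1/\<bar>k\<bar>) uniformly on
  the strip. Half-lines suffice as a start since they form an intersection-stable generator of the
  Borel sets.\<close>

lemma riemann_lebesgue_indicator_atMost: "riemann_lebesgue r (indicator {..c})"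
proof -
  have i: "integrable lebesgue_0pi (indicator {..c} :: real \<Rightarrow> complex)"
  proof (rule Bochner_Integration.integrable_bound)
    show "integrable lebesgue_0pi (\<lambda>x. 1::real)"
      by (simp add: continuous_imp_integrable_real)
    show "indicator {..c} \<in> borel_measurable lebesgue_0pi"
      by (intro borel_measurable_indicator') (auto simp: sets_restrict_space)
  qed (auto simp: indicator_def)
  have bound: "norm (LINT t|lebesgue_on {0..x}. exp (\<i> * k * t) * indicator {..c} t) \<le> 2 * exp (r * pi) / norm k"
    if k: "k \<noteq> 0" "\<bar>Im k\<bar> \<le> r" and x: "x \<in> {0..pi}" for k x
  proof -
    \<comment> \<open>A negative \<open>c\<close> makes \<open>{0..d}\<close> empty; this is why the
      sign of \<open>d\<close> is distinguished below.\<close>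
    define d where "d = min c x"
    have r: "0 \<le> r" using k by linarith
    have "(LINT t|lebesgue_on {0..x}. exp (\<i> * k * t) * indicator {..c} t) =
      (LINT t|lebesgue_on {0..x}. (if t \<le> d then exp (\<i> * k * t) else 0))"
      by (rule Bochner_Integration.integral_cong) (auto simp: d_def)
    also have "\<dots> = (LINT t|lebesgue_on {0..d}. exp (\<i> * k * t))"
      by (rule integral_lebesgue_on_Icc_restrict) (simp add: d_def)
    finally have eq: "(LINT t|lebesgue_on {0..x}. exp (\<i> * k * t) * indicator {..c} t) =
      (LINT t|lebesgue_on {0..d}. exp (\<i> * k * t))" .
    show ?thesis
    proof (cases "0 \<le> d")
      case False
      then show ?thesis unfolding eq by simp
    next
      case True
      have "((\<lambda>t. exp (\<i> * k * complex_of_real t)) has_integral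
          (exp (\<i> * k * d) / (\<i> * k) - exp (\<i> * k * complex_of_real 0) / (\<i> * k))) {0..d}"
      proof (rule fundamental_theorem_of_calculus[OF True])
        fix t
        have "((\<lambda>z. exp (\<i> * k * z) / (\<i> * k)) has_field_derivative exp (\<i> * k * of_real t)) (at (of_real t))"
          using k by (auto intro!: derivative_eq_intros)
        then show "((\<lambda>t. exp (\<i> * k * complex_of_real t) / (\<i> * k)) has_vector_derivative
            exp (\<i> * k * complex_of_real t)) (at t within {0..d})"
          using has_vector_derivative_real_field by (auto intro: has_vector_derivative_at_within)
      qed
      moreover have "integrable (lebesgue_on {0..d}) (\<lambda>t. exp (\<i> * k * complex_of_real t))"
        by (intro continuous_imp_integrable_real continuous_on_exp_ik)
      ultimately have "(LINT t|lebesgue_on {0..d}. exp (\<i> * k * t)) = (exp (\<i> * k * d) - 1) / (\<i> * k)"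
        by (simp add: lebesgue_integral_eq_integral integral_unique diff_divide_distrib)
      moreover have "norm (exp (\<i> * k * d) - 1) \<le> exp (r * pi) + 1"
        using norm_exp_strip_le[OF k(2), of d] True x
        by (intro norm_triangle_le_diff) (auto simp: d_def)
      moreover have "1 \<le> exp (r * pi)"
        using r by simp
      moreover have "norm (exp (\<i> * k * d) - 1) \<le> 2 * exp (r * pi)"
        using calculation(2,3) by linarith
      ultimately have "norm (LINT t|lebesgue_on {0..d}. exp (\<i> * k * t)) \<le> (2 * exp (r * pi)) / norm k"
        by (simp only: norm_divide norm_mult norm_ii mult_1) (intro divide_right_mono; simp)
      then show ?thesis
        unfolding eq .
    qed
  qed
  show ?thesis
    unfolding riemann_lebesgue_def
  proof (intro conjI allI impI i)
    fix \<epsilon> :: real assume \<epsilon>: "\<epsilon> > 0"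
    have "norm (LINT t|lebesgue_on {0..x}. exp (\<i> * k * t) * indicator {..c} t) \<le> \<epsilon>"
      if k: "2 * exp (r * pi) / \<epsilon> \<le> norm k" "\<bar>Im k\<bar> \<le> r" and x: "x \<in> {0..pi}" for k x
    proof -
      have "0 < 2 * exp (r * pi) / \<epsilon>" using \<epsilon> by simp
      then have "0 < norm k" using k(1) by linarith
      then have "2 * exp (r * pi) / norm k \<le> \<epsilon>"
        using k(1) \<epsilon> by (simp add: field_simps)
      then show ?thesis
        using bound[OF _ k(2) x] \<open>0 < norm k\<close> by fastforce
    qed
    then show "\<exists>K. \<forall>k x. K \<le> norm k \<longrightarrow> \<bar>Im k\<bar> \<le> r \<longrightarrow> x \<in> {0..pi} \<longrightarrow>
        norm (LINT t|lebesgue_on {0..x}. exp (\<i> * k * t) * indicator {..c} t) \<le> \<epsilon>"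
      by blast
  qed
qed

lemma integrable_exp_mult:
  assumes "integrable lebesgue_0pi f" "x \<in> {0..pi}"
  shows "integrable (lebesgue_on {0..x}) (\<lambda>t. exp (\<i> * k * complex_of_real t) * f t)"
  by (rule integrable_mult_continuous(1)[OF _ continuous_on_exp_ik])
    (use integrable_lebesgue_on_Icc_subset[OF assms(1)] assms(2) in auto)

lemma riemann_lebesgue_add:
  assumes f: "riemann_lebesgue r f" and g: "riemann_lebesgue r g"
  shows "riemann_lebesgue r (\<lambda>x. f x + g x)"
  unfolding riemann_lebesgue_def
proof (intro conjI allI impI)
  have i: "integrable lebesgue_0pi f" "integrable lebesgue_0pi g"
    using f g by (auto simp: riemann_lebesgue_def)
  then show "integrable lebesgue_0pi (\<lambda>x. f x + g x)" by simp
  fix \<epsilon> :: real assume "\<epsilon> > 0"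
  then have "\<epsilon> / 2 > 0" by simp
  obtain K where
    K: "\<And>k x. K \<le> norm k \<Longrightarrow> \<bar>Im k\<bar> \<le> r \<Longrightarrow> x \<in> {0..pi} \<Longrightarrow>
      norm (LINT t|lebesgue_on {0..x}. exp (\<i> * k * t) * f t) \<le> \<epsilon> / 2"
    using f \<open>\<epsilon> / 2 > 0\<close> unfolding riemann_lebesgue_def by metis
  obtain K' where
    K': "\<And>k x. K' \<le> norm k \<Longrightarrow> \<bar>Im k\<bar> \<le> r \<Longrightarrow> x \<in> {0..pi} \<Longrightarrow>
      norm (LINT t|lebesgue_on {0..x}. exp (\<i> * k * t) * g t) \<le> \<epsilon> / 2"
    using g \<open>\<epsilon> / 2 > 0\<close> unfolding riemann_lebesgue_def by metis
  have "norm (LINT t|lebesgue_on {0..x}. exp (\<i> * k * t) * (f t + g t)) \<le> \<epsilon>"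
    if k: "max K K' \<le> norm k" "\<bar>Im k\<bar> \<le> r" and x: "x \<in> {0..pi}" for k x
  proof -
    have "(LINT t|lebesgue_on {0..x}. exp (\<i> * k * t) * (f t + g t)) =
      (LINT t|lebesgue_on {0..x}. exp (\<i> * k * t) * f t) + (LINT t|lebesgue_on {0..x}. exp (\<i> * k * t) * g t)"
      using i x by (simp add: distrib_left integrable_exp_mult)
    then show ?thesis
      using norm_triangle_mono[OF K K', of k x k x] k x by simp
  qed
  then show "\<exists>K. \<forall>k x. K \<le> norm k \<longrightarrow> \<bar>Im k\<bar> \<le> r \<longrightarrow> x \<in> {0..pi} \<longrightarrow>
        norm (LINT t|lebesgue_on {0..x}. exp (\<i> * k * t) * (f t + g t)) \<le> \<epsilon>"
    by blast
qed

lemma riemann_lebesgue_cmult: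
  assumes f: "riemann_lebesgue r f"
  shows "riemann_lebesgue r (\<lambda>x. c * f x)"
proof (cases "c = 0")
  case True
  then show ?thesis by (auto simp: riemann_lebesgue_def)
next
  case False
  show ?thesis
    unfolding riemann_lebesgue_def
  proof (intro conjI allI impI)
    show "integrable lebesgue_0pi (\<lambda>x. c * f x)"
      using f by (simp add: riemann_lebesgue_def)
    fix \<epsilon> :: real assume "\<epsilon> > 0"
    then have "\<epsilon> / norm c > 0" using False by simp
    then obtain K where
      K: "\<And>k x. K \<le> norm k \<Longrightarrow> \<bar>Im k\<bar> \<le> r \<Longrightarrow> x \<in> {0..pi} \<Longrightarrow>
        norm (LINT t|lebesgue_on {0..x}. exp (\<i> * k * t) * f t) \<le> \<epsilon> / norm c"
      using f unfolding riemann_lebesgue_def by metis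
    have "norm (LINT t|lebesgue_on {0..x}. exp (\<i> * k * t) * (c * f t)) \<le> \<epsilon>"
      if k: "K \<le> norm k" "\<bar>Im k\<bar> \<le> r" and x: "x \<in> {0..pi}" for k x
      using K[OF k x] False by (simp add: mult.left_commute[of _ c] norm_mult field_simps)
    then show "\<exists>K. \<forall>k x. K \<le> norm k \<longrightarrow> \<bar>Im k\<bar> \<le> r \<longrightarrow> x \<in> {0..pi} \<longrightarrow>
        norm (LINT t|lebesgue_on {0..x}. exp (\<i> * k * t) * (c * f t)) \<le> \<epsilon>"
      by blast
  qed
qed

text \<open>On the strip the exponentials are bounded by exp(r pi), so an L^1 error of the
  approximation costs at most exp(r pi) times that error, whatever k and x are.\<close>

lemma riemann_lebesgue_L1_limit:
  assumes s: "\<And>i. riemann_lebesgue r (s i)" and f: "integrable lebesgue_0pi f"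
    and lim: "(\<lambda>i::nat. LINT x|lebesgue_0pi. norm (f x - s i x)) \<longlonglongrightarrow> 0"
  shows "riemann_lebesgue r f"
  unfolding riemann_lebesgue_def
proof (intro conjI allI impI f)
  fix \<epsilon> :: real assume "\<epsilon> > 0"
  then have "\<epsilon> / (2 * exp (r * pi)) > 0" by simp
  then obtain i where i: "(LINT x|lebesgue_0pi. norm (f x - s i x)) < \<epsilon> / (2 * exp (r * pi))"
    using order_tendstoD(2)[OF lim] by (meson eventually_happens trivial_limit_sequentially)
  have si: "integrable lebesgue_0pi (s i)"
    using s by (simp add: riemann_lebesgue_def)
  have "\<epsilon> / 2 > 0" using \<open>\<epsilon> > 0\<close> by simp
  then obtain K where
      K: "\<And>k x. K \<le> norm k \<Longrightarrow> \<bar>Im k\<bar> \<le> r \<Longrightarrow> x \<in> {0..pi} \<Longrightarrow>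
        norm (LINT t|lebesgue_on {0..x}. exp (\<i> * k * t) * s i t) \<le> \<epsilon> / 2"
      using s unfolding riemann_lebesgue_def by metis
  have "norm (LINT t|lebesgue_on {0..x}. exp (\<i> * k * t) * f t) \<le> \<epsilon>"
    if k: "K \<le> norm k" "\<bar>Im k\<bar> \<le> r" and x: "x \<in> {0..pi}" for k x
  proof -
    have d: "integrable lebesgue_0pi (\<lambda>t. f t - s i t)" using f si by simp
    have j: "integrable lebesgue_0pi (\<lambda>t. exp (\<i> * k * complex_of_real t) * (f t - s i t))"
      by (rule integrable_exp_mult[OF d]) simp
    have "norm (LINT t|lebesgue_on {0..x}. exp (\<i> * k * t) * (f t - s i t))
      \<le> (LINT t|lebesgue_0pi. norm (exp (\<i> * k * t) * (f t - s i t)))"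
      using norm_indefinite_integral_le[OF j] x by simp
    also have "\<dots> \<le> (LINT t|lebesgue_0pi. exp (r * pi) * norm (f t - s i t))"
      using j d norm_exp_strip_le[OF k(2)]
      by (intro integral_mono integrable_norm) (auto simp: norm_mult intro!: mult_right_mono)
    also have "\<dots> \<le> \<epsilon> / 2"
      using i by (simp add: field_simps)
    finally have 1: "norm (LINT t|lebesgue_on {0..x}. exp (\<i> * k * t) * (f t - s i t)) \<le> \<epsilon> / 2" .
    have "(LINT t|lebesgue_on {0..x}. exp (\<i> * k * t) * f t) =
      (LINT t|lebesgue_on {0..x}. exp (\<i> * k * t) * (f t - s i t)) + 
      (LINT t|lebesgue_on {0..x}. exp (\<i> * k * t) * s i t)"
      using integrable_exp_mult[OF d x] integrable_exp_mult[OF si x]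
      by (subst Bochner_Integration.integral_add[symmetric]) (simp_all add: right_diff_distrib)
    then show ?thesis
      using norm_triangle_mono[OF 1 K[OF k x]] by simp
  qed
  then show "\<exists>K. \<forall>k x. K \<le> norm k \<longrightarrow> \<bar>Im k\<bar> \<le> r \<longrightarrow> x \<in> {0..pi} \<longrightarrow>
      norm (LINT t|lebesgue_on {0..x}. exp (\<i> * k * t) * f t) \<le> \<epsilon>"
    by blast
qed

lemma riemann_lebesgue_dominated_limit:
  assumes s: "\<And>i. riemann_lebesgue r (s i)" and f: "integrable lebesgue_0pi f"
    and w: "integrable lebesgue_0pi w"
    and lim: "\<And>x. x \<in> {0..pi} \<Longrightarrow> (\<lambda>i::nat. s i x) \<longlonglongrightarrow> f x"
    and le: "\<And>i x. x \<in> {0..pi} \<Longrightarrow> norm (s i x) \<le> w x"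
  shows "riemann_lebesgue r f"
proof (rule riemann_lebesgue_L1_limit[OF s f])
  have [measurable]: "f \<in> borel_measurable lebesgue_0pi" "s i \<in> borel_measurable lebesgue_0pi" for i
    using f s[of i] by (auto simp: riemann_lebesgue_def)
  have "(\<lambda>i. LINT x|lebesgue_0pi. norm (f x - s i x)) \<longlonglongrightarrow> (LINT x|lebesgue_0pi. 0)"
  proof (rule integral_dominated_convergence)
    show "integrable lebesgue_0pi (\<lambda>x. norm (f x) + w x)"
      using f w by simp
    show "AE x in lebesgue_0pi. (\<lambda>i. norm (f x - s i x)) \<longlonglongrightarrow> 0"
    proof (rule AE_I2)
      fix x assume "x \<in> space lebesgue_0pi"
      then have "(\<lambda>i. norm (f x - s i x)) \<longlonglongrightarrow> norm (f x - f x)"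
        by (intro tendsto_intros lim) simp
      then show "(\<lambda>i. norm (f x - s i x)) \<longlonglongrightarrow> 0" by simp
    qed
    show "AE x in lebesgue_0pi. norm (norm (f x - s i x)) \<le> norm (f x) + w x" for i
      by (rule AE_I2) (use le[of _ i] in \<open>auto intro!: norm_triangle_le_diff\<close>)
  qed auto
  then show "(\<lambda>i. LINT x|lebesgue_0pi. norm (f x - s i x)) \<longlonglongrightarrow> 0"
    by simp
qed

lemma integrable_indicator_0pi:
  assumes "A \<in> sets borel"
  shows "integrable lebesgue_0pi (indicator A :: real \<Rightarrow> complex)"
proof (rule Bochner_Integration.integrable_bound)
  show "integrable lebesgue_0pi (\<lambda>x. 1::real)"
    by (simp add: continuous_imp_integrable_real)
  show "indicator A \<in> borel_measurable lebesgue_0pi"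
    by (intro borel_measurable_indicator') (use assms in \<open>auto simp: sets_restrict_space\<close>)
qed (auto simp: indicator_def)

text \<open>A Dynkin argument: complements follow by linearity, countable disjoint unions by
  dominated convergence of the finite partial sums.\<close>

lemma riemann_lebesgue_indicator_borel:
  assumes "A \<in> sets borel"
  shows "riemann_lebesgue r (indicator A)"
proof -
  let ?G = "range (\<lambda>a::real. {..a})"
  have "Int_stable ?G"
    by (auto simp: Int_stable_def min_def)
  moreover have "?G \<subseteq> Pow UNIV" by simp
  moreover have "A \<in> sigma_sets UNIV ?G"
    using assms by (simp add: borel_eq_atMost)
  ultimately show ?thesis
  proof (induction rule: sigma_sets_induct_disjoint)
    case (basic A)
    then show ?case
      using riemann_lebesgue_indicator_atMost by auto
  next
    case empty
    then show ?case
      by (auto simp: riemann_lebesgue_def integrable_indicator_0pi)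
  next
    case (compl A)
    then have b: "UNIV - A \<in> sets borel"
      by (simp add: borel_eq_atMost sigma_sets.Compl)
    show ?case
    \<comment> \<open>The sequence is constant. Half-line {..pi} plays the role of the constant 1,
      which is correct only on the interval, and the limit lemma compares functions only
      there.\<close>
    proof (rule riemann_lebesgue_dominated_limit[OF riemann_lebesgue_add[OF riemann_lebesgue_indicator_atMost riemann_lebesgue_cmult[OF compl(2)]]])
      show "(\<lambda>i. indicator {..pi} x + (-1) * indicator A x) \<longlonglongrightarrow> (indicator (UNIV - A) x :: complex)"
        if "x \<in> {0..pi}" for x
        using that by (auto simp: indicator_def)
      show "norm (indicator {..pi} x + (-1) * indicator A x :: complex) \<le> 1" for x
        by (auto simp: indicator_def)
    qed (auto simp: integrable_indicator_0pi[OF b] continuous_imp_integrable_real)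
  next
    case (union A)
    then have b: "(\<Union>i. A i) \<in> sets borel"
      by (simp add: borel_eq_atMost) (auto intro!: sigma_sets.Union)
    have eq: "(\<Sum>i<n. indicator (A i) x) = (indicator (\<Union>i<n. A i) x :: complex)" for n x
      using union(1) by (intro indicator_UN_disjoint[symmetric]) (auto simp: disjoint_family_on_def)
    have s: "riemann_lebesgue r (\<lambda>x. \<Sum>i<n. indicator (A i) x)" for n
    proof (induction n)
      case 0
      show ?case by (auto simp: riemann_lebesgue_def)
    next
      case (Suc n)
      show ?case using riemann_lebesgue_add[OF Suc union(3)[of n]] by simp
    qed
    show ?case
    proof (rule riemann_lebesgue_dominated_limit[OF s])
      show "(\<lambda>n. \<Sum>i<n. indicator (A i) x) \<longlonglongrightarrow> (indicator (\<Union>i. A i) x :: complex)" for x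
        unfolding eq by (rule LIMSEQ_indicator_UN)
      show "norm (\<Sum>i<n. indicator (A i) x :: complex) \<le> 1" for n x
        unfolding eq by (auto simp: indicator_def)
    qed (auto simp: integrable_indicator_0pi[OF b] continuous_imp_integrable_real)
  qed
qed

lemma riemann_lebesgue_integrable:
  assumes "integrable lebesgue_0pi f"
  shows "riemann_lebesgue r f"
  using assms
proof (induction rule: integrable_induct)
  case (base A c)
  have "A \<in> sets lebesgue" using base(1)
    by (auto simp: sets_restrict_space)
  \<comment> \<open>The induction starts from Lebesgue sets whereas the Dynkin argument covers Borel
    sets; the two differ by a null set, which no integral sees.\<close>
  then obtain S N N' where S: "A = S \<union> N" "N \<subseteq> N'" "N' \<in> null_sets lborel" "S \<in> sets lborel"
    by (rule sets_completionE)
  have i: "integrable lebesgue_0pi (\<lambda>x. indicat_real A x *\<^sub>R c)"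
    using base by (auto intro!: integrable_scaleR_left simp: top.not_eq_extremum)
  have m: "(indicator S :: real \<Rightarrow> complex) \<in> borel_measurable lebesgue_0pi"
    using integrable_indicator_0pi[of S] S(4) by auto
  have ae: "AE x in lebesgue_0pi. indicat_real A x *\<^sub>R c = c * indicator S x"
  proof -
    have "AE x in lborel. x \<notin> N'" using S(3) by (rule AE_not_in)
    then have "AE x in lebesgue. x \<notin> N'" by (rule AE_completion)
    then show ?thesis
      using S(1,2) by (auto simp: AE_restrict_space_iff indicator_def elim!: eventually_mono)
  qed
  have "riemann_lebesgue r (\<lambda>x. c * indicator S x)"
    using S(4) by (intro riemann_lebesgue_cmult riemann_lebesgue_indicator_borel) auto
  then show ?case
  proof (rule riemann_lebesgue_L1_limit[OF _ i, where s = "\<lambda>_ x. c * indicator S x"])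
    have "(LINT x|lebesgue_0pi. norm (indicat_real A x *\<^sub>R c - c * indicator S x)) = (LINT x|lebesgue_0pi. 0)"
      by (rule integral_cong_AE) (use ae i m in auto)
    then show "(\<lambda>i. LINT x|lebesgue_0pi. norm (indicat_real A x *\<^sub>R c - c * indicator S x)) \<longlonglongrightarrow> 0"
      by simp
  qed
next
  case (add f g)
  then show ?case by (intro riemann_lebesgue_add)
next
  case (lim f s)
  show ?case
    \<comment> \<open>The factor 2 is the domination that \<open>integrable_induct\<close> grants to
      its simple functions.\<close>
    by (rule riemann_lebesgue_dominated_limit[where s = s and w = "\<lambda>x. 2 * norm (f x)"])
      (use lim in auto)
qed

section \<open>Linear systems with oscillating coefficients\<close>

text \<open>The solution of \<open>X' = \<phi>\<close> with \<open>X 0 = M (X pi - X 0)\<close>.\<close>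

definition volterra_sol :: "('n::finite \<Rightarrow> 'n \<Rightarrow> complex) \<Rightarrow> ('n \<Rightarrow> real \<Rightarrow> complex) \<Rightarrow> 'n \<Rightarrow> real \<Rightarrow> complex"
  where "volterra_sol M \<phi> i x =
    (\<Sum>j\<in>UNIV. M i j * (LINT t|lebesgue_0pi. \<phi> j t)) + (LINT t|lebesgue_on {0..x}. \<phi> i t)"

definition volterra_mul :: "('n::finite \<Rightarrow> 'n \<Rightarrow> real \<Rightarrow> complex) \<Rightarrow> ('n \<Rightarrow> real \<Rightarrow> complex) \<Rightarrow> 'n \<Rightarrow> real \<Rightarrow> complex"
  where "volterra_mul B X i t = (\<Sum>j\<in>UNIV. B i j t * X j t)"

text \<open>A single integral equation carries both the differential system and the boundary
  condition. Continuity of \<open>X\<close> makes the product with a merely integrable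
  \<open>B\<close> integrable.\<close>

definition volterra_solves :: "('n::finite \<Rightarrow> 'n \<Rightarrow> complex) \<Rightarrow> ('n \<Rightarrow> 'n \<Rightarrow> real \<Rightarrow> complex) \<Rightarrow>
    ('n \<Rightarrow> real \<Rightarrow> complex) \<Rightarrow> ('n \<Rightarrow> real \<Rightarrow> complex) \<Rightarrow> bool"
  where "volterra_solves M B h X \<longleftrightarrow> (\<forall>i. continuous_on {0..pi} (X i)) \<and>
    (\<forall>i. \<forall>x\<in>{0..pi}. X i x = volterra_sol M (\<lambda>j t. volterra_mul B X j t + h j t) i x)"

text \<open>Two sizes of \<open>B\<close> are kept apart: \<epsilon> for its primitives, to be made
  small, and \<beta> for its L^1 norm, merely bounded. \<open>C\<close> is the factor in
  \<open>norm_sol_mul_sol_le\<close>: N for a row of \<open>B\<close>, N m + 1 for the outer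
  solution operator, N m + 2 for the integration by parts applied to the inner one. \<open>N\<close>
  is a parameter so that it can be instantiated by a numeral.\<close>

locale volterra_system =
  fixes M :: "'n::finite \<Rightarrow> 'n \<Rightarrow> complex" and B :: "'n \<Rightarrow> 'n \<Rightarrow> real \<Rightarrow> complex"
    and m \<epsilon> \<beta> N C :: real
  assumes N_eq: "N = real CARD('n)" and C_def: "C = N * (N * m + 1) * (N * m + 2)"
    and integrable_B: "integrable lebesgue_0pi (B i j)"
    and norm_M_le: "norm (M i j) \<le> m"
    and oscillation_le: "x \<in> {0..pi} \<Longrightarrow> norm (LINT t|lebesgue_on {0..x}. B i j t) \<le> \<epsilon>"
    and L1_B_le: "(LINT t|lebesgue_0pi. norm (B i j t)) \<le> \<beta>"
begin

abbreviation "sol \<equiv> volterra_sol M"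
abbreviation "mul \<equiv> volterra_mul B"
abbreviation "solves \<equiv> volterra_solves M B"

lemma m_nonneg: "0 \<le> m" and \<epsilon>_nonneg: "0 \<le> \<epsilon>"
proof -
  show m: "0 \<le> m"
    by (rule order_trans[OF norm_ge_zero norm_M_le])
  show "0 \<le> \<epsilon>"
    by (rule order_trans[OF norm_ge_zero oscillation_le[of 0]]) simp
qed

lemma continuous_on_sol:
  assumes "\<And>j. integrable lebesgue_0pi (\<phi> j)"
  shows "continuous_on {0..pi} (sol \<phi> i)"
  unfolding volterra_sol_def by (intro continuous_intros indefinite_integral_continuous_real assms)

lemma integrable_mul:
  assumes "\<And>j. continuous_on {0..pi} (X j)"
  shows "integrable lebesgue_0pi (mul X i)"
  unfolding volterra_mul_def by (intro Bochner_Integration.integrable_sum integrable_mult_continuous integrable_B assms)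

lemma norm_const_le:
  assumes "\<And>j. norm (c j) \<le> p"
  shows "norm (\<Sum>j\<in>UNIV. M i j * c j) \<le> N * m * p"
proof -
  have "norm (\<Sum>j\<in>UNIV. M i j * c j) \<le> (\<Sum>j\<in>(UNIV::'n set). m * p)"
    using norm_M_le assms m_nonneg by (intro sum_norm_le) (auto simp: norm_mult intro!: mult_mono)
  then show ?thesis by (simp add: N_eq mult_ac)
qed

lemma norm_integral_le:
  assumes "integrable lebesgue_0pi f" "(LINT t|lebesgue_0pi. norm (f t)) \<le> p" "x \<in> {0..pi}"
  shows "norm (LINT t|lebesgue_on {0..x}. f t :: complex) \<le> p"
  using norm_indefinite_integral_le[OF assms(1), of x] assms(2,3) by auto

lemma norm_sol_le:
  assumes "\<And>j. integrable lebesgue_0pi (\<phi> j)" "\<And>j. (LINT t|lebesgue_0pi. norm (\<phi> j t)) \<le> p"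
    and "x \<in> {0..pi}"
  shows "norm (sol \<phi> i x) \<le> (N * m + 1) * p"
proof -
  have "norm (\<Sum>j\<in>UNIV. M i j * (LINT t|lebesgue_0pi. \<phi> j t)) \<le> N * m * p"
    by (intro norm_const_le norm_integral_le assms) auto
  moreover have "norm (LINT t|lebesgue_on {0..x}. \<phi> i t) \<le> p"
    by (intro norm_integral_le assms)
  ultimately show ?thesis
    unfolding volterra_sol_def by (intro norm_triangle_le) (simp add: algebra_simps)
qed

text \<open>The only place where oscillation produces smallness. Each component of the inner
  \<open>sol \<phi>\<close> is a constant plus a primitive, so its product with an entry of
  \<open>B\<close> falls under \<open>norm_integral_oscillatory_le\<close>.\<close>

lemma norm_sol_mul_sol_le:
  assumes \<phi>: "\<And>j. integrable lebesgue_0pi (\<phi> j)" "\<And>j. (LINT t|lebesgue_0pi. norm (\<phi> j t)) \<le> p"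
    and x: "x \<in> {0..pi}"
  shows "norm (sol (mul (sol \<phi>)) i x) \<le> C * \<epsilon> * p"
proof -
  have each: "norm (LINT t|lebesgue_on {0..x}. B i j t * sol \<phi> j t) \<le> \<epsilon> * ((N * m + 2) * p)" 
    if "x \<in> {0..pi}" for i j x
  proof -
    have "norm (LINT t|lebesgue_on {0..x}. B i j t * sol \<phi> j t)
      \<le> \<epsilon> * (norm (\<Sum>k\<in>UNIV. M j k * (LINT t|lebesgue_0pi. \<phi> k t)) + 2 * (LINT t|lebesgue_0pi. norm (\<phi> j t)))"
      unfolding volterra_sol_def
      by (rule norm_integral_oscillatory_le) (use integrable_B \<phi> oscillation_le that in auto)
    also have "\<dots> \<le> \<epsilon> * (N * m * p + 2 * p)"
      by (intro mult_left_mono add_mono norm_const_le norm_integral_le \<phi> \<epsilon>_nonneg) auto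
    finally show ?thesis by (simp add: algebra_simps)
  qed
  have int: "norm (LINT t|lebesgue_on {0..x}. mul (sol \<phi>) i t) \<le> N * (\<epsilon> * ((N * m + 2) * p))"
    if x: "x \<in> {0..pi}" for i x
  proof -
    have "integrable (lebesgue_on {0..x}) (\<lambda>t. B i j t * sol \<phi> j t)" for j
      by (rule integrable_lebesgue_on_Icc_subset[OF integrable_mult_continuous(2)[OF integrable_B continuous_on_sol[OF \<phi>(1)]]])
        (use x in auto)
    then have "(LINT t|lebesgue_on {0..x}. mul (sol \<phi>) i t) =
        (\<Sum>j\<in>UNIV. LINT t|lebesgue_on {0..x}. B i j t * sol \<phi> j t)"
      unfolding volterra_mul_def by simp
    also have "norm \<dots> \<le> (\<Sum>j\<in>(UNIV::'n set). \<epsilon> * ((N * m + 2) * p))"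
      by (intro sum_norm_le each x)
    finally show ?thesis by (simp add: N_eq)
  qed
  have "norm (sol (mul (sol \<phi>)) i x) \<le> N * m * (N * (\<epsilon> * ((N * m + 2) * p))) + N * (\<epsilon> * ((N * m + 2) * p))"
    unfolding volterra_sol_def[of M "mul (sol \<phi>)"]
    by (intro norm_triangle_le add_mono norm_const_le int x) auto
  then show ?thesis
    by (simp add: C_def algebra_simps)
qed

lemma L1_mul_le:
  assumes X: "\<And>j. continuous_on {0..pi} (X j)" "\<And>j t. t \<in> {0..pi} \<Longrightarrow> norm (X j t) \<le> K"
  shows "(LINT t|lebesgue_0pi. norm (mul X i t)) \<le> N * (\<beta> * K)"
proof -
  have K: "0 \<le> K"
    by (rule order_trans[OF norm_ge_zero X(2)[of 0]]) simp
  have "(LINT t|lebesgue_0pi. norm (mul X i t)) \<le> (LINT t|lebesgue_0pi. (\<Sum>j\<in>UNIV. norm (B i j t) * K))"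
  proof (rule integral_mono)
    show "integrable lebesgue_0pi (\<lambda>t. norm (mul X i t))"
      by (intro integrable_norm integrable_mul X)
    show "integrable lebesgue_0pi (\<lambda>t. \<Sum>j\<in>UNIV. norm (B i j t) * K)"
      using integrable_B by auto
    show "norm (mul X i t) \<le> (\<Sum>j\<in>UNIV. norm (B i j t) * K)" if "t \<in> space lebesgue_0pi" for t
      unfolding volterra_mul_def using that X(2) by (intro sum_norm_le) (auto simp: norm_mult intro!: mult_left_mono)
  qed
  also have "\<dots> = (\<Sum>j\<in>UNIV. (LINT t|lebesgue_0pi. norm (B i j t)) * K)"
    using integrable_B by simp
  also have "\<dots> \<le> (\<Sum>j\<in>(UNIV::'n set). \<beta> * K)"
    using L1_B_le K by (intro sum_mono mult_right_mono) auto
  finally show ?thesis by (simp add: N_eq)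
qed

lemma sol_cong:
  assumes "\<And>j t. t \<in> {0..pi} \<Longrightarrow> \<phi> j t = \<psi> j t" "x \<in> {0..pi}"
  shows "sol \<phi> i x = sol \<psi> i x"
proof -
  have "(LINT t|lebesgue_on {0..x}. \<phi> j t) = (LINT t|lebesgue_on {0..x}. \<psi> j t)" if "x \<in> {0..pi}" for j x
    using assms(1) that by (intro Bochner_Integration.integral_cong) auto
  from this[OF assms(2)] this[of pi] show ?thesis
    by (simp add: volterra_sol_def)
qed

lemma mul_cong: "(\<And>j. X j t = Y j t) \<Longrightarrow> mul X i t = mul Y i t"
  by (simp add: volterra_mul_def)

lemma sol_add:
  assumes "\<And>j. integrable lebesgue_0pi (\<phi> j)" "\<And>j. integrable lebesgue_0pi (\<psi> j)" and x: "x \<in> {0..pi}"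
  shows "sol (\<lambda>j t. \<phi> j t + \<psi> j t) i x = sol \<phi> i x + sol \<psi> i x"
proof -
  have "integrable (lebesgue_on {0..x}) (\<phi> j)" "integrable (lebesgue_on {0..x}) (\<psi> j)" for j
    using integrable_lebesgue_on_Icc_subset[OF assms(1)] integrable_lebesgue_on_Icc_subset[OF assms(2)] x by auto
  then show ?thesis
    using assms by (simp add: volterra_sol_def sum.distrib algebra_simps)
qed

lemma sol_diff:
  assumes "\<And>j. integrable lebesgue_0pi (\<phi> j)" "\<And>j. integrable lebesgue_0pi (\<psi> j)" and x: "x \<in> {0..pi}"
  shows "sol (\<lambda>j t. \<phi> j t - \<psi> j t) i x = sol \<phi> i x - sol \<psi> i x"
  using sol_add[of "\<lambda>j t. \<phi> j t - \<psi> j t" \<psi> x i] assms by simp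

lemma mul_diff: "mul (\<lambda>j t. X j t - Y j t) i t = mul X i t - mul Y i t"
  by (simp add: volterra_mul_def sum_subtractf algebra_simps)

text \<open>Inserting the equation into itself gives X - sol h = sol (B X) = sol (B sol (B X + h)),
  which is small relative to the supremum of X plus p. Half of the supremum is then absorbed on the
  left, and the resulting bound is fed back for the second claim.\<close>

lemma norm_solution_le:
  assumes X: "solves h X"
    and h: "\<And>j. integrable lebesgue_0pi (h j)" "\<And>j. (LINT t|lebesgue_0pi. norm (h j t)) \<le> p"
    and small: "2 * (C * \<epsilon> * N * \<beta>) \<le> 1"
    and x: "x \<in> {0..pi}"
  shows "norm (X i x) \<le> 2 * (N * m + 1 + C * \<epsilon>) * p"
    and "norm (X i x - sol h i x) \<le> C * \<epsilon> * (N * \<beta> * (2 * (N * m + 1 + C * \<epsilon>)) + 1) * p"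
proof -
  have c: "continuous_on {0..pi} (X j)" for j
    using X by (simp add: volterra_solves_def)
  note mi = integrable_mul[OF c]
  have p: "0 \<le> p"
    by (rule order_trans[OF _ h(2)]) simp
  have diff_le: "norm (X i x - sol h i x) \<le> C * \<epsilon> * (N * (\<beta> * K) + p)"
    if K: "\<And>j t. t \<in> {0..pi} \<Longrightarrow> norm (X j t) \<le> K" and x: "x \<in> {0..pi}" for K i x
  proof -
    let ?\<phi> = "\<lambda>j t. mul X j t + h j t"
    have "X i x - sol h i x = sol (mul X) i x"
      using X x sol_add[OF mi h(1) x] by (simp add: volterra_solves_def)
    also have "\<dots> = sol (mul (sol ?\<phi>)) i x"
      by (intro sol_cong mul_cong x) (use X in \<open>auto simp: volterra_solves_def\<close>)
    also have "norm \<dots> \<le> C * \<epsilon> * (N * (\<beta> * K) + p)"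
    proof (rule norm_sol_mul_sol_le[OF _ _ x])
      show "integrable lebesgue_0pi (?\<phi> j)" for j
        using mi h(1) by simp
      have "(LINT t|lebesgue_0pi. norm (?\<phi> j t)) \<le> (LINT t|lebesgue_0pi. norm (mul X j t) + norm (h j t))" for j
        using mi h(1) by (intro integral_mono integrable_norm) (auto simp: norm_triangle_ineq)
      also have "\<dots> j = (LINT t|lebesgue_0pi. norm (mul X j t)) + (LINT t|lebesgue_0pi. norm (h j t))" for j
        using mi h(1) by (intro Bochner_Integration.integral_add) auto
      also have "\<dots> j \<le> N * (\<beta> * K) + p" for j
        by (intro add_mono L1_mul_le h c K)
      finally show "(LINT t|lebesgue_0pi. norm (?\<phi> j t)) \<le> N * (\<beta> * K) + p" for j .
    qed
    finally show ?thesis .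
  qed
  \<comment> \<open>Absorbing the supremum requires it to be finite; continuity on the compact
    interval provides this.\<close>
  define S where "S = (\<Union>j. (\<lambda>t. norm (X j t)) ` {0..pi})"
  have "compact S"
    unfolding S_def by (intro compact_UN compact_continuous_image continuous_intros c compact_Icc) auto
  then have bdd: "bdd_above S"
    by (intro bounded_imp_bdd_above compact_imp_bounded)
  have ne: "S \<noteq> {}" by (auto simp: S_def)
  have K: "norm (X j t) \<le> Sup S" if "t \<in> {0..pi}" for j t
    using that by (intro cSup_upper bdd) (unfold S_def, blast)
  have "Sup S \<le> (N * m + 1) * p + C * \<epsilon> * (N * (\<beta> * Sup S) + p)"
  proof (rule cSup_least[OF ne])
    fix s assume "s \<in> S"
    then obtain j t where t: "t \<in> {0..pi}" and s: "s = norm (X j t)"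
      by (auto simp: S_def)
    have "s \<le> norm (sol h j t) + norm (X j t - sol h j t)"
      unfolding s by (metis norm_triangle_sub)
    also have "\<dots> \<le> (N * m + 1) * p + C * \<epsilon> * (N * (\<beta> * Sup S) + p)"
      using norm_sol_le[OF h t] diff_le[OF K t] by (intro add_mono) auto
    finally show "s \<le> (N * m + 1) * p + C * \<epsilon> * (N * (\<beta> * Sup S) + p)" .
  qed
  also have "\<dots> = (N * m + 1) * p + C * \<epsilon> * p + (C * \<epsilon> * N * \<beta>) * Sup S"
    by (simp add: algebra_simps)
  also have "\<dots> \<le> (N * m + 1) * p + C * \<epsilon> * p + (1 / 2) * Sup S"
  proof -
    have "0 \<le> Sup S"
      by (rule order_trans[OF norm_ge_zero K[of 0]]) simp
    then show ?thesis
      using small by (intro add_left_mono mult_right_mono) auto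
  qed
  finally have "Sup S \<le> 2 * (N * m + 1 + C * \<epsilon>) * p"
    by (simp add: algebra_simps)
  then have le: "norm (X j t) \<le> 2 * (N * m + 1 + C * \<epsilon>) * p" if "t \<in> {0..pi}" for j t
    using K[OF that, of j] by linarith
  then show "norm (X i x) \<le> 2 * (N * m + 1 + C * \<epsilon>) * p"
    using x .
  show "norm (X i x - sol h i x) \<le> C * \<epsilon> * (N * \<beta> * (2 * (N * m + 1 + C * \<epsilon>)) + 1) * p"
    using diff_le[OF le x] by (simp add: algebra_simps)
qed

text \<open>The map Y to sol (B Y + h) need not be a contraction, since \<beta> is not small, but
  its square is. The second factor N in the hypothesis pays for passing from components to the
  Euclidean norm of the vector.\<close>

lemma ex_solution:
  assumes h: "\<And>j. integrable lebesgue_0pi (h j)"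
    and small: "2 * (C * \<epsilon> * N * \<beta> * N) \<le> 1"
  obtains X where "solves h X"
proof -
  define S where "S Y = sol (\<lambda>j t. mul (\<lambda>k s. Y s $ k) j t + h j t)" for Y :: "real \<Rightarrow> complex ^ 'n"
  have cn: "continuous_on {0..pi} (\<lambda>t. Y t $ j)" for Y :: "real \<Rightarrow>\<^sub>C (complex ^ 'n)" and j
    by (intro continuous_intros) simp
  have i: "integrable lebesgue_0pi (\<lambda>t. mul (\<lambda>k s. Y s $ k) j t + h j t)" for Y :: "real \<Rightarrow>\<^sub>C (complex ^ 'n)" and j
    using integrable_mul[OF cn] h by simp
  \<comment> \<open>The complete space is that of bounded continuous functions on the whole line;
    \<open>clamp\<close> extends the values on the interval by constants.\<close>
  have "\<exists>F :: real \<Rightarrow>\<^sub>C (complex ^ 'n). \<forall>x. F x = (\<chi> i. S Y i (clamp 0 pi x))" for Y :: "real \<Rightarrow>\<^sub>C (complex ^ 'n)"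
  proof -
    have "continuous_on (cbox 0 pi) (\<lambda>x. \<chi> i. S Y i x)"
      unfolding S_def using continuous_on_sol[OF i] by (intro continuous_on_vec_lambda) simp
    then show ?thesis
      using continuous_on_cbox_bcontfunE by metis
  qed
  then obtain F :: "(real \<Rightarrow>\<^sub>C (complex ^ 'n)) \<Rightarrow> (real \<Rightarrow>\<^sub>C (complex ^ 'n))"
    where F: "\<And>Y x. F Y x = (\<chi> i. S Y i (clamp 0 pi x))"
    by metis
  have clamp: "clamp 0 pi x = x" if "x \<in> {0..pi}" for x :: real
    using that by (intro clamp_cancel_cbox) auto
  have clamp_in: "clamp 0 pi x \<in> {0..pi}" for x :: real
    using clamp_in_interval[of 0 pi x] by simp
  have FS: "F Y x $ i = S Y i x" if "x \<in> {0..pi}" for Y x i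
    using that by (simp add: F clamp)
  have S_diff: "S Y i x - S Z i x = sol (mul (\<lambda>k s. Y s $ k - Z s $ k)) i x" if "x \<in> {0..pi}" for Y Z :: "real \<Rightarrow>\<^sub>C (complex ^ 'n)" and i x
  proof -
    have "S Y i x - S Z i x = sol (\<lambda>j t. (mul (\<lambda>k s. Y s $ k) j t + h j t) - (mul (\<lambda>k s. Z s $ k) j t + h j t)) i x"
      unfolding S_def by (rule sol_diff[symmetric, OF i i that])
    then show ?thesis
      by (simp add: mul_diff[abs_def])
  qed
  have contr: "dist (F (F Y)) (F (F Z)) \<le> (1 / 2) * dist Y Z" for Y Z
  proof (rule dist_bound)
    fix x :: real
    define x' where "x' = clamp 0 pi x"
    have x': "x' \<in> {0..pi}" unfolding x'_def by (rule clamp_in)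
    let ?\<phi> = "mul (\<lambda>k s. Y s $ k - Z s $ k)"
    have each: "norm ((F (F Y) x - F (F Z) x) $ i) \<le> C * \<epsilon> * (N * (\<beta> * dist Y Z))" for i
    proof -
      have "(F (F Y) x - F (F Z) x) $ i = S (F Y) i x' - S (F Z) i x'"
        by (simp add: F x'_def)
      also have "\<dots> = sol (mul (\<lambda>k s. F Y s $ k - F Z s $ k)) i x'"
        by (rule S_diff[OF x'])
      also have "\<dots> = sol (mul (sol ?\<phi>)) i x'"
        by (intro sol_cong mul_cong x') (simp add: FS S_diff)
      also have "norm \<dots> \<le> C * \<epsilon> * (N * (\<beta> * dist Y Z))"
      proof (rule norm_sol_mul_sol_le[OF _ _ x'])
        have c: "continuous_on {0..pi} (\<lambda>s. Y s $ k - Z s $ k)" for k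
          by (intro continuous_intros cn)
        show "integrable lebesgue_0pi (?\<phi> j)" for j
          by (rule integrable_mul[OF c])
        show "(LINT t|lebesgue_0pi. norm (?\<phi> j t)) \<le> N * (\<beta> * dist Y Z)" for j
        proof (rule L1_mul_le[OF c])
          show "norm (Y t $ k - Z t $ k) \<le> dist Y Z" for k t
            using Finite_Cartesian_Product.norm_nth_le[of "Y t - Z t" k] dist_bounded[of Y t Z] by (simp add: dist_norm)
        qed
      qed
      finally show ?thesis .
    qed
    have "dist (F (F Y) x) (F (F Z) x) \<le> (\<Sum>i\<in>UNIV. norm ((F (F Y) x - F (F Z) x) $ i))"
      unfolding dist_norm norm_vec_def by (rule L2_set_le_sum) simp
    also have "\<dots> \<le> (\<Sum>i\<in>(UNIV::'n set). C * \<epsilon> * (N * (\<beta> * dist Y Z)))"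
      by (intro sum_mono each)
    also have "\<dots> = (C * \<epsilon> * N * \<beta> * N) * dist Y Z"
      by (simp add: N_eq)
    also have "\<dots> \<le> (1 / 2) * dist Y Z"
      using small by (intro mult_right_mono) auto
    finally show "dist (F (F Y) x) (F (F Z) x) \<le> (1 / 2) * dist Y Z" .
  qed
  have "\<exists>!Y. F (F Y) = Y"
    by (rule banach_fix_type[of "1/2"]) (use contr in auto)
  then obtain Y where Y: "F (F Y) = Y" "\<And>Z. F (F Z) = Z \<Longrightarrow> Z = Y" by auto
  \<comment> \<open>\<open>F Y\<close> is another fixed point of the square of \<open>F\<close>, so
    uniqueness identifies it with \<open>Y\<close>.\<close>
  have FY: "F Y = Y"
    using Y(2)[of "F Y"] Y(1) by simp
  have "solves h (\<lambda>i x. Y x $ i)"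
    unfolding volterra_solves_def
  proof (intro conjI allI ballI cn)
    fix i x assume "x \<in> {0..pi}"
    then show "Y x $ i = sol (\<lambda>j t. mul (\<lambda>i x. Y x $ i) j t + h j t) i x"
      using FS[of x Y i] by (simp add: FY S_def)
  qed
  then show ?thesis by (rule that)
qed

end

section \<open>Reduction of the Hill equation to a system\<close>

text \<open>The equation (z - L) y = f on the level of functions, with l eliminated as z y - f. The
  source may thus be any integrable function, as befits estimates in its L^1 norm.\<close>

definition hill_solution ::
    "boundary_condition \<Rightarrow> complex \<Rightarrow> (real \<Rightarrow> complex) \<Rightarrow> complex \<Rightarrow> (real \<Rightarrow> complex) \<Rightarrow> (real \<Rightarrow> complex) \<Rightarrow> bool"
  where "hill_solution bc v0 Q z f y \<longleftrightarrow> (\<exists>y' q q'.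
    has_ac_derivative y y' \<and> y' square_integrable_on {0..pi} \<and> has_ac_derivative q q' \<and>
    (AE x in lebesgue_0pi. q x = y' x - Q x * y x) \<and>
    (AE x in lebesgue_0pi. z * y x + q' x + Q x * y' x - v0 * y x = f x) \<and> satisfies_bc bc y q)"

lemma square_integrable_imp_integrable_mult:
  assumes "f square_integrable_on {0..pi}" "g square_integrable_on {0..pi}"
  shows "integrable lebesgue_0pi (\<lambda>x. f x * g x)"
  by (rule square_integrable_mult_integrable[OF assms, of "\<lambda>a b. a * b"])
    (use assms in \<open>auto simp: square_integrable_on_def norm_mult\<close>)

lemma square_integrable_imp_integrable:
  assumes "f square_integrable_on {0..pi}"
  shows "integrable lebesgue_0pi f"
proof -
  have "(\<lambda>x. 1) square_integrable_on {0..pi}"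
    by (simp add: square_integrable_on_def continuous_imp_integrable_real)
  then show ?thesis
    using square_integrable_imp_integrable_mult[OF assms] by fastforce
qed

lemma square_integrable_continuous_mult:
  assumes f: "f square_integrable_on {0..pi}" and g: "continuous_on {0..pi} g"
  shows "(\<lambda>x. f x * g x) square_integrable_on {0..pi}"
proof -
  have [measurable]: "f \<in> borel_measurable lebesgue_0pi" "g \<in> borel_measurable lebesgue_0pi"
    using f g by (auto simp: square_integrable_on_def intro: continuous_imp_measurable_on_sets_lebesgue)
  have i: "integrable lebesgue_0pi (\<lambda>x. complex_of_real ((norm (f x))\<^sup>2))"
    by (rule integrable_bounded_linear[OF bounded_linear_of_real, of lebesgue_0pi "\<lambda>x. (norm (f x))\<^sup>2"])
      (use f in \<open>simp add: square_integrable_on_def\<close>)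
  have c: "continuous_on {0..pi} (\<lambda>x. complex_of_real ((norm (g x))\<^sup>2))"
    by (intro continuous_intros g)
  have "integrable lebesgue_0pi (\<lambda>x. complex_of_real ((norm (f x))\<^sup>2) * complex_of_real ((norm (g x))\<^sup>2))"
    by (rule integrable_mult_continuous(2)[OF i c])
  then have "integrable lebesgue_0pi (\<lambda>x. Re (complex_of_real ((norm (f x))\<^sup>2) * complex_of_real ((norm (g x))\<^sup>2)))"
    by (rule integrable_Re)
  then have "integrable lebesgue_0pi (\<lambda>x. (norm (f x * g x))\<^sup>2)"
    by (simp add: norm_mult power_mult_distrib)
  then show ?thesis
    by (simp add: square_integrable_on_def)
qed

lemma square_integrable_continuous:
  assumes g: "continuous_on {0..pi} g"
  shows "g square_integrable_on {0..pi}"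
proof -
  have "(\<lambda>x. 1) square_integrable_on {0..pi}"
    by (simp add: square_integrable_on_def continuous_imp_integrable_real)
  then show ?thesis
    using square_integrable_continuous_mult[OF _ g, of "\<lambda>_. 1"] by simp
qed

section \<open>Exponential waves and the boundary conditions in terms of their amplitudes\<close>

definition wave_sign :: "bool \<Rightarrow> complex"
  where "wave_sign i = (if i then 1 else -1)"

lemma wave_sign_simps [simp]: "wave_sign True = 1" "wave_sign False = -1" "norm (wave_sign i) = 1"
  by (auto simp: wave_sign_def)

definition wave :: "complex \<Rightarrow> bool \<Rightarrow> real \<Rightarrow> complex"
  where "wave \<kappa> i x = exp (wave_sign i * \<kappa> * complex_of_real x)"

definition inverse_wave :: "complex \<Rightarrow> bool \<Rightarrow> real \<Rightarrow> complex"
  where "inverse_wave \<kappa> i x = exp (- wave_sign i * \<kappa> * complex_of_real x)"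

lemma wave_inverse_wave [simp]: "wave \<kappa> i x * inverse_wave \<kappa> i x = 1" "inverse_wave \<kappa> i x * wave \<kappa> i x = 1"
  by (simp_all add: wave_def inverse_wave_def exp_minus)

lemma wave_0 [simp]: "wave \<kappa> i 0 = 1" "inverse_wave \<kappa> i 0 = 1"
  by (simp_all add: wave_def inverse_wave_def)

lemma has_ac_derivative_exp:
  "has_ac_derivative (\<lambda>x. exp (c * complex_of_real x)) (\<lambda>x. c * exp (c * complex_of_real x))"
proof (rule has_ac_derivative_C1)
  fix x
  have "((\<lambda>z. exp (c * z)) has_field_derivative c * exp (c * of_real x)) (at (of_real x))"
    by (auto intro!: derivative_eq_intros)
  then show "((\<lambda>x. exp (c * complex_of_real x)) has_vector_derivative c * exp (c * complex_of_real x)) (at x)"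
    by (rule has_vector_derivative_real_field)
qed (intro continuous_intros)

lemma has_ac_derivative_wave: "has_ac_derivative (wave \<kappa> i) (\<lambda>x. wave_sign i * \<kappa> * wave \<kappa> i x)"
  unfolding wave_def by (rule has_ac_derivative_exp)

lemma has_ac_derivative_inverse_wave:
  "has_ac_derivative (inverse_wave \<kappa> i) (\<lambda>x. - wave_sign i * \<kappa> * inverse_wave \<kappa> i x)"
  unfolding inverse_wave_def by (rule has_ac_derivative_exp)

text \<open>The coefficient of the system for \<open>(a, b)\<close>, indexed by \<open>True\<close> and \<open>False\<close>; \<open>hill_h\<close> is its right-hand side.\<close>

definition hill_B :: "complex \<Rightarrow> (real \<Rightarrow> complex) \<Rightarrow> complex \<Rightarrow> bool \<Rightarrow> bool \<Rightarrow> real \<Rightarrow> complex"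
  where "hill_B v0 Q \<kappa> i j t = inverse_wave \<kappa> i t * wave \<kappa> j t *
    ((if i = j then 0 else Q t) + wave_sign i * (v0 - (Q t)\<^sup>2) / (2 * \<kappa>))"

definition hill_h :: "complex \<Rightarrow> (real \<Rightarrow> complex) \<Rightarrow> bool \<Rightarrow> real \<Rightarrow> complex"
  where "hill_h \<kappa> f i t = inverse_wave \<kappa> i t * (wave_sign i * f t / (2 * \<kappa>))"

text \<open>Expresses the amplitudes at 0 through their increments over the interval. The periodic
  conditions decouple the two waves, hence diagonal matrices; the Dirichlet condition ties them
  together.\<close>

fun boundary_matrix :: "boundary_condition \<Rightarrow> complex \<Rightarrow> bool \<Rightarrow> bool \<Rightarrow> complex"
  where
    "boundary_matrix Per_plus \<kappa> i j = (if i = j then wave \<kappa> i pi / (1 - wave \<kappa> i pi) else 0)"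
  | "boundary_matrix Per_minus \<kappa> i j = (if i = j then - wave \<kappa> i pi / (1 + wave \<kappa> i pi) else 0)"
  | "boundary_matrix Dir \<kappa> i j = - wave_sign i * wave \<kappa> j pi / (wave \<kappa> True pi - wave \<kappa> False pi)"

text \<open>The denominators of \<open>boundary_matrix\<close> do not vanish. For the periodic
  conditions one wave suffices, since the value of the other at pi is its inverse.\<close>

fun nonresonant :: "boundary_condition \<Rightarrow> complex \<Rightarrow> bool"
  where
    "nonresonant Per_plus \<kappa> \<longleftrightarrow> wave \<kappa> True pi \<noteq> 1"
  | "nonresonant Per_minus \<kappa> \<longleftrightarrow> wave \<kappa> True pi \<noteq> -1"
  | "nonresonant Dir \<kappa> \<longleftrightarrow> wave \<kappa> True pi \<noteq> wave \<kappa> False pi"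

lemma wave_True_False: "wave \<kappa> True x * wave \<kappa> False x = 1"
  by (simp add: wave_def exp_minus)

text \<open>y and q/\<kappa> are the sum and the difference of the two wave components. Equality of
  sums and of differences means equality of each component, so the periodic conditions read E (a +
  A) = a or -a for each wave. The Dirichlet conditions give b = -a and one equation for a.\<close>

lemma satisfies_bc_iff_boundary_matrix:
  assumes \<kappa>: "\<kappa> \<noteq> 0" and nr: "nonresonant bc \<kappa>"
    and y0: "y 0 = (\<Sum>j\<in>UNIV. c j)" and q0: "q 0 = \<kappa> * (\<Sum>j\<in>UNIV. wave_sign j * c j)"
    and ypi: "y pi = (\<Sum>j\<in>UNIV. wave \<kappa> j pi * (c j + I j))"
    and qpi: "q pi = \<kappa> * (\<Sum>j\<in>UNIV. wave_sign j * (wave \<kappa> j pi * (c j + I j)))"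
  shows "satisfies_bc bc y q \<longleftrightarrow> (\<forall>i. c i = (\<Sum>j\<in>UNIV. boundary_matrix bc \<kappa> i j * I j))"
proof -
  define a b A B E E' where "a = c True" and "b = c False" and "A = I True" and "B = I False"
    and "E = wave \<kappa> True pi" and "E' = wave \<kappa> False pi"
  note defs = a_def[symmetric] b_def[symmetric] A_def[symmetric] B_def[symmetric] E_def[symmetric] E'_def[symmetric]
  have EE: "E * E' = 1"
    unfolding E_def E'_def by (rule wave_True_False)
  have y: "y 0 = a + b" "q 0 = \<kappa> * (a - b)" "y pi = E * (a + A) + E' * (b + B)"
    "q pi = \<kappa> * (E * (a + A) - E' * (b + B))"
    unfolding y0 q0 ypi qpi by (simp_all add: UNIV_bool defs algebra_simps)
  have sd: "p + r = p' + r' \<and> p - r = p' - r' \<longleftrightarrow> p = p' \<and> r = r'" for p r p' r' :: complex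
  proof
    assume h: "p + r = p' + r' \<and> p - r = p' - r'"
    have "2 * p = (p + r) + (p - r)" by simp
    also have "\<dots> = (p' + r') + (p' - r')" using h by simp
    finally have "p = p'" by simp
    then show "p = p' \<and> r = r'" using h by simp
  qed simp
  have solve: "E * (a + A) = a \<longleftrightarrow> a = E / (1 - E) * A" if "E \<noteq> 1" for E a A :: complex
    using that by (auto simp: field_simps)
  have solve': "E * (a + A) = - a \<longleftrightarrow> a = - E / (1 + E) * A" if "E \<noteq> -1" for E a A :: complex
  proof -
    have "1 + E \<noteq> 0" using that by (metis add.inverse_inverse add_eq_0_iff)
    then have "a = - E / (1 + E) * A \<longleftrightarrow> a * (1 + E) = - E * A"
      by (simp add: field_simps)
    also have "\<dots> \<longleftrightarrow> E * (a + A) = - a"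
      unfolding minus_mult_left[symmetric] eq_neg_iff_add_eq_0 by (simp add: algebra_simps)
    finally show ?thesis by blast
  qed
  have solve'': "b = - a \<and> D * a = - S \<longleftrightarrow> a = - S / D \<and> b = S / D" if "D \<noteq> 0" for a b S D :: complex
  proof -
    have "D * a = - S \<longleftrightarrow> a = - (S / D)"
      using nonzero_eq_divide_eq[OF that, of a "- S"] by (simp add: mult.commute[of a])
    then show ?thesis by auto
  qed
  show ?thesis
  proof (cases bc)
    case Per_plus
    then have E: "E \<noteq> 1" "E' \<noteq> 1"
      using nr EE by (auto simp: E_def)
    have "satisfies_bc bc y q \<longleftrightarrow> E * (a + A) + E' * (b + B) = a + b \<and> E * (a + A) - E' * (b + B) = a - b"
      using \<kappa> by (simp add: Per_plus y)
    also have "\<dots> \<longleftrightarrow> E * (a + A) = a \<and> E' * (b + B) = b"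
      by (rule sd)
    also have "\<dots> \<longleftrightarrow> a = E / (1 - E) * A \<and> b = E' / (1 - E') * B"
      using solve[OF E(1)] solve[OF E(2)] by simp
    finally show ?thesis
      by (simp add: Per_plus all_bool_eq UNIV_bool defs conj_commute)
  next
    case Per_minus
    then have E: "E \<noteq> -1" "E' \<noteq> -1"
      using nr EE by (auto simp: E_def) (metis add.inverse_inverse)
    have "satisfies_bc bc y q \<longleftrightarrow> E * (a + A) + E' * (b + B) = - a + - b \<and> E * (a + A) - E' * (b + B) = - a - - b"
      using \<kappa> by (simp add: Per_minus y right_diff_distrib[symmetric] minus_mult_right del: mult_minus_right)
    also have "\<dots> \<longleftrightarrow> E * (a + A) = - a \<and> E' * (b + B) = - b"
      by (rule sd)
    also have "\<dots> \<longleftrightarrow> a = - E / (1 + E) * A \<and> b = - E' / (1 + E') * B"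
      using solve'[OF E(1)] solve'[OF E(2)] by simp
    finally show ?thesis
      by (simp add: Per_minus all_bool_eq UNIV_bool defs conj_commute)
  next
    case Dir
    then have E: "E - E' \<noteq> 0"
      using nr by (simp add: E_def E'_def)
    have "satisfies_bc bc y q \<longleftrightarrow> a + b = 0 \<and> E * (a + A) + E' * (b + B) = 0"
      by (simp add: Dir y)
    also have "\<dots> \<longleftrightarrow> b = - a \<and> (E - E') * a = - (E * A + E' * B)"
      by (auto simp: algebra_simps add_eq_0_iff)
    also have "\<dots> \<longleftrightarrow> a = - (E * A + E' * B) / (E - E') \<and> b = (E * A + E' * B) / (E - E')"
      by (rule solve''[OF E])
    finally show ?thesis
      using E by (simp add: Dir all_bool_eq UNIV_bool defs conj_commute add_divide_distrib diff_divide_distrib add.commute)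
  qed
qed

text \<open>In row i the function \<open>Q\<close> multiplies only the other component, whose wave
  part is (y - s q/\<kappa>)/2 with s the sign of i, while \<open>v0 - Q\<^sup>2\<close> multiplies
  the sum of both, which is y.\<close>

lemma hill_derivative_eq:
  assumes \<kappa>: "\<kappa> \<noteq> 0" and X: "\<And>j. wave \<kappa> j t * X j t = (y + wave_sign j * q / \<kappa>) / 2"
  shows "volterra_mul (hill_B v0 Q \<kappa>) X i t + hill_h \<kappa> f i t =
    inverse_wave \<kappa> i t * (Q t * (y - wave_sign i * q / \<kappa>) + wave_sign i * ((v0 - (Q t)\<^sup>2) * y + f t) / \<kappa>) / 2"
proof -
  have "volterra_mul (hill_B v0 Q \<kappa>) X i t = inverse_wave \<kappa> i t *
     (\<Sum>j\<in>UNIV. ((if i = j then 0 else Q t) + wave_sign i * (v0 - (Q t)\<^sup>2) / (2 * \<kappa>)) * (wave \<kappa> j t * X j t))"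
    by (simp add: volterra_mul_def hill_B_def sum_distrib_left mult_ac)
  also have "\<dots> = inverse_wave \<kappa> i t * (Q t * (y - wave_sign i * q / \<kappa>) + wave_sign i * ((v0 - (Q t)\<^sup>2) * y) / \<kappa>) / 2"
    unfolding X using \<kappa> by (cases i) (simp_all add: UNIV_bool field_simps)
  finally show ?thesis
    unfolding hill_h_def by (simp add: add_divide_distrib distrib_left)
qed

lemma integrable_hill_h:
  assumes "integrable lebesgue_0pi f"
  shows "integrable lebesgue_0pi (hill_h \<kappa> f i)"
  unfolding hill_h_def inverse_wave_def using assms
  by (intro integrable_mult_continuous(1)) (auto intro!: continuous_intros)

lemma integrable_hill_B:
  assumes Q: "Q square_integrable_on {0..pi}"
  shows "integrable lebesgue_0pi (hill_B v0 Q \<kappa> i j)"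
proof -
  have "integrable lebesgue_0pi (\<lambda>t. (Q t)\<^sup>2)"
    unfolding power2_eq_square by (rule square_integrable_imp_integrable_mult[OF Q Q])
  moreover have "integrable lebesgue_0pi Q"
    by (rule square_integrable_imp_integrable[OF Q])
  ultimately have "integrable lebesgue_0pi (\<lambda>t. (wave_sign i / (2 * \<kappa>)) * (v0 - (Q t)\<^sup>2))"
    and iQ: "integrable lebesgue_0pi Q"
    by (auto intro!: integrable_mult_right Bochner_Integration.integrable_diff continuous_imp_integrable_real)
  then have "integrable lebesgue_0pi (\<lambda>t. (if i = j then 0 else Q t) + wave_sign i * (v0 - (Q t)\<^sup>2) / (2 * \<kappa>))"
    by (cases "i = j") (simp_all add: Bochner_Integration.integrable_add)
  then show ?thesis
    unfolding hill_B_def wave_def inverse_wave_def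
    by (intro integrable_mult_continuous(1)) (auto intro!: continuous_intros)
qed

lemma lebesgue_integral_sing [simp]:
  fixes f :: "real \<Rightarrow> complex"
  shows "(LINT t|lebesgue_on {a}. f t) = 0"
proof -
  have "(LINT t|lebesgue_on {a}. f t) = (LINT t|lebesgue_on {a}. f a)"
    by (rule Bochner_Integration.integral_cong) auto
  also have "\<dots> = 0"
    by (simp add: measure_restrict_space)
  finally show ?thesis .
qed

lemma wave_sign_square: "wave_sign i * wave_sign i = 1"
  by (cases i) auto

text \<open>The left side is the derivative of an amplitude after y' and q' have been eliminated by
  the quasi-derivative and the equation. With r = s/\<kappa> the terms free of \<open>Q\<close>,
  \<open>v0\<close> and f have coefficients 1 - s \<kappa> r and r \<kappa>^2 - s \<kappa>, which
  both vanish: free waves have constant amplitudes.\<close>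

lemma hill_derivative_algebra:
  fixes \<kappa> s :: complex
  assumes "\<kappa> \<noteq> 0" "s * s = 1"
  shows "- s * \<kappa> * e * ((1/2) * (y + s / \<kappa> * q)) + e * ((1/2) * ((q + Q * y) + s / \<kappa> * (f + \<kappa>\<^sup>2 * y - Q * (q + Q * y) + v0 * y)))
    = e * (Q * (y - s * q / \<kappa>) + s * ((v0 - Q\<^sup>2) * y + f) / \<kappa>) / 2"
proof -
  define r where "r = s / \<kappa>"
  have r: "\<kappa> * r = s" using assms by (simp add: r_def)
  have "- s * \<kappa> * e * (y + r * q) + e * ((q + Q * y) + r * (f + \<kappa>\<^sup>2 * y - Q * (q + Q * y) + v0 * y))
    = e * (Q * (y - r * q) + r * ((v0 - Q\<^sup>2) * y + f))"
  proof -
    have 1: "s * \<kappa> * r = 1" using r assms(2) by (simp add: mult.assoc)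
    have 2: "r * \<kappa>\<^sup>2 = s * \<kappa>" using r by (simp add: power2_eq_square mult_ac)
    have "- s * \<kappa> * e * (y + r * q) + e * ((q + Q * y) + r * (f + \<kappa>\<^sup>2 * y - Q * (q + Q * y) + v0 * y))
      = e * (Q * (y - r * q) + r * ((v0 - Q\<^sup>2) * y + f)) + e * q * (1 - s * \<kappa> * r) + e * y * (r * \<kappa>\<^sup>2 - s * \<kappa>)"
      by (simp add: algebra_simps power2_eq_square)
    then show ?thesis by (simp add: 1 2)
  qed
  note eq = this
  have rew: "s / \<kappa> * u = r * u" "s * u / \<kappa> = r * u" for u
    by (simp_all add: r_def)
  have half: "u * ((1/2) * x) + w * ((1/2) * z) = p / 2" if "u * x + w * z = p" for u x w z p :: complex
    using that by (simp add: add_divide_distrib[symmetric])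
  show ?thesis
    unfolding rew by (rule half[OF eq])
qed

lemma hill_solution_imp_volterra:
  assumes \<kappa>: "\<kappa> \<noteq> 0" and nr: "nonresonant bc \<kappa>" and Q: "Q square_integrable_on {0..pi}"
    and f: "integrable lebesgue_0pi f" and sol: "hill_solution bc v0 Q (- \<kappa>\<^sup>2) f y"
  obtains X where "volterra_solves (boundary_matrix bc \<kappa>) (hill_B v0 Q \<kappa>) (hill_h \<kappa> f) X"
    "\<And>x. y x = (\<Sum>j\<in>UNIV. wave \<kappa> j x * X j x)"
proof -
  obtain y' q q' where y: "has_ac_derivative y y'" and q: "has_ac_derivative q q'"
    and yq: "AE x in lebesgue_0pi. q x = y' x - Q x * y x"
    and eq: "AE x in lebesgue_0pi. - \<kappa>\<^sup>2 * y x + q' x + Q x * y' x - v0 * y x = f x"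
    and bc: "satisfies_bc bc y q"
    using sol unfolding hill_solution_def by blast
  \<comment> \<open>Inversion of the two formulas for y and the quasi-derivative: the component
    along wave i, divided by that wave.\<close>
  define X where "X = (\<lambda>i x. inverse_wave \<kappa> i x * ((1/2) * (y x + wave_sign i / \<kappa> * q x)))"
  let ?\<phi> = "\<lambda>i t. volterra_mul (hill_B v0 Q \<kappa>) X i t + hill_h \<kappa> f i t"
  have wX: "wave \<kappa> j x * X j x = (y x + wave_sign j * q x / \<kappa>) / 2" for j x
    unfolding X_def mult.assoc[symmetric] by simp
  have X1: "has_ac_derivative (X i) (\<lambda>x. - wave_sign i * \<kappa> * inverse_wave \<kappa> i x * ((1/2) * (y x + wave_sign i / \<kappa> * q x))
      + inverse_wave \<kappa> i x * ((1/2) * (y' x + wave_sign i / \<kappa> * q' x)))" for i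
    unfolding X_def
    by (intro has_ac_derivative_mult has_ac_derivative_inverse_wave has_ac_derivative_cmult has_ac_derivative_add y q)
  have cX: "continuous_on {0..pi} (X i)" for i
    by (rule has_ac_derivative_continuous_on[OF X1])
  have i\<phi>: "integrable lebesgue_0pi (?\<phi> i)" for i
    unfolding volterra_mul_def
    by (intro Bochner_Integration.integrable_add Bochner_Integration.integrable_sum
        integrable_mult_continuous(2) integrable_hill_B integrable_hill_h Q f cX)
  have X2: "has_ac_derivative (X i) (?\<phi> i)" for i
  proof (rule has_ac_derivative_cong_AE[OF X1])
    show "?\<phi> i \<in> borel_measurable lebesgue_0pi"
      using i\<phi> by (rule borel_measurable_integrable)
    have key: "- wave_sign i * \<kappa> * inverse_wave \<kappa> i x * ((1/2) * (y x + wave_sign i / \<kappa> * q x))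
      + inverse_wave \<kappa> i x * ((1/2) * (y' x + wave_sign i / \<kappa> * q' x)) = ?\<phi> i x"
      if 1: "q x = y' x - Q x * y x" and 2: "- \<kappa>\<^sup>2 * y x + q' x + Q x * y' x - v0 * y x = f x" for x
    proof -
      have y': "y' x = q x + Q x * y x" using 1 by simp
      have q': "q' x = f x + \<kappa>\<^sup>2 * y x - Q x * (q x + Q x * y x) + v0 * y x"
        using 2 unfolding y' by (simp add: algebra_simps)
      show ?thesis
        unfolding hill_derivative_eq[OF \<kappa> wX] y' q'
        using hill_derivative_algebra[OF \<kappa> wave_sign_square] by simp
    qed
    show "AE x in lebesgue_0pi. - wave_sign i * \<kappa> * inverse_wave \<kappa> i x * ((1/2) * (y x + wave_sign i / \<kappa> * q x))
      + inverse_wave \<kappa> i x * ((1/2) * (y' x + wave_sign i / \<kappa> * q' x)) = ?\<phi> i x"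
      by (rule eventually_mono[OF eventually_conj[OF yq eq]]) (elim conjE, rule key)
  qed
  have Xx: "X i x = X i 0 + (LINT t|lebesgue_on {0..x}. ?\<phi> i t)" if "x \<in> {0..pi}" for i x
    using X2[of i] that unfolding has_ac_derivative_def by blast
  have yX: "y x = (\<Sum>j\<in>UNIV. wave \<kappa> j x * X j x)" for x
    unfolding wX using \<kappa> by (simp add: UNIV_bool field_simps)
  have qX: "q x = \<kappa> * (\<Sum>j\<in>UNIV. wave_sign j * (wave \<kappa> j x * X j x))" for x
    unfolding wX using \<kappa> by (simp add: UNIV_bool field_simps)
  have X0: "X i 0 = (\<Sum>j\<in>UNIV. boundary_matrix bc \<kappa> i j * (LINT t|lebesgue_0pi. ?\<phi> j t))" for i
  proof -
    have Xpi: "X j pi = X j 0 + (LINT t|lebesgue_0pi. ?\<phi> j t)" for j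
      by (rule Xx) simp
    have "\<forall>i. X i 0 = (\<Sum>j\<in>UNIV. boundary_matrix bc \<kappa> i j * (LINT t|lebesgue_0pi. ?\<phi> j t))"
    proof (rule iffD1[OF satisfies_bc_iff_boundary_matrix[OF \<kappa> nr] bc])
      show "y 0 = (\<Sum>j\<in>UNIV. X j 0)"
        by (subst yX) simp
      show "q 0 = \<kappa> * (\<Sum>j\<in>UNIV. wave_sign j * X j 0)"
        by (subst qX) simp
      show "y pi = (\<Sum>j\<in>UNIV. wave \<kappa> j pi * (X j 0 + (LINT t|lebesgue_0pi. ?\<phi> j t)))"
        unfolding Xpi[symmetric] by (rule yX)
      show "q pi = \<kappa> * (\<Sum>j\<in>UNIV. wave_sign j * (wave \<kappa> j pi * (X j 0 + (LINT t|lebesgue_0pi. ?\<phi> j t))))"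
        unfolding Xpi[symmetric] by (rule qX)
    qed
    then show ?thesis by blast
  qed
  have "volterra_solves (boundary_matrix bc \<kappa>) (hill_B v0 Q \<kappa>) (hill_h \<kappa> f) X"
    unfolding volterra_solves_def volterra_sol_def X0[symmetric]
    by (intro conjI allI ballI cX Xx)
  then show ?thesis
    using yX by (rule that)
qed

lemma volterra_imp_hill_solution:
  assumes \<kappa>: "\<kappa> \<noteq> 0" and nr: "nonresonant bc \<kappa>" and Q: "Q square_integrable_on {0..pi}"
    and f: "integrable lebesgue_0pi f"
    and X: "volterra_solves (boundary_matrix bc \<kappa>) (hill_B v0 Q \<kappa>) (hill_h \<kappa> f) X"
  shows "hill_solution bc v0 Q (- \<kappa>\<^sup>2) f (\<lambda>x. \<Sum>j\<in>UNIV. wave \<kappa> j x * X j x)"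
proof -
  let ?\<phi> = "\<lambda>i t. volterra_mul (hill_B v0 Q \<kappa>) X i t + hill_h \<kappa> f i t"
  define y where "y = (\<lambda>x. \<Sum>j\<in>UNIV. wave \<kappa> j x * X j x)"
  define q where "q = (\<lambda>x. \<kappa> * (\<Sum>j\<in>UNIV. wave_sign j * (wave \<kappa> j x * X j x)))"
  \<comment> \<open>With y' and q' defined by the quasi-derivative and the equation, the two
    almost-everywhere conditions hold at every point; what remains is that they are derivatives of y
    and q.\<close>
  define y' where "y' = (\<lambda>x. q x + Q x * y x)"
  define q' where "q' = (\<lambda>x. f x + \<kappa>\<^sup>2 * y x - Q x * y' x + v0 * y x)"
  have cX: "continuous_on {0..pi} (X i)" for i
    using X by (simp add: volterra_solves_def)
  have i\<phi>: "integrable lebesgue_0pi (?\<phi> i)" for i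
    unfolding volterra_mul_def
    by (intro Bochner_Integration.integrable_add Bochner_Integration.integrable_sum
        integrable_mult_continuous(2) integrable_hill_B integrable_hill_h Q f cX)
  have sol: "X i x = (\<Sum>j\<in>UNIV. boundary_matrix bc \<kappa> i j * (LINT t|lebesgue_0pi. ?\<phi> j t)) + (LINT t|lebesgue_on {0..x}. ?\<phi> i t)"
    if "x \<in> {0..pi}" for i x
    using X that by (simp add: volterra_solves_def volterra_sol_def)
  have X0: "X i 0 = (\<Sum>j\<in>UNIV. boundary_matrix bc \<kappa> i j * (LINT t|lebesgue_0pi. ?\<phi> j t))" for i
    using sol[of 0 i] by simp
  have Xx: "X i x = X i 0 + (LINT t|lebesgue_on {0..x}. ?\<phi> i t)" if "x \<in> {0..pi}" for i x
    using sol[OF that] X0 by simp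
  have dX: "has_ac_derivative (X i) (?\<phi> i)" for i
    unfolding has_ac_derivative_def using i\<phi> Xx by blast
  have dwX: "has_ac_derivative (\<lambda>x. wave \<kappa> j x * X j x) (\<lambda>x. wave_sign j * \<kappa> * wave \<kappa> j x * X j x + wave \<kappa> j x * ?\<phi> j x)" for j
    by (rule has_ac_derivative_mult[OF has_ac_derivative_wave dX])
  have wX: "wave \<kappa> j x * X j x = (y x + wave_sign j * q x / \<kappa>) / 2" for j x
    using \<kappa> by (cases j) (simp_all add: y_def q_def UNIV_bool field_simps)
  have w\<phi>: "wave \<kappa> j x * ?\<phi> j x = (Q x * (y x - wave_sign j * q x / \<kappa>) + wave_sign j * ((v0 - (Q x)\<^sup>2) * y x + f x) / \<kappa>) / 2" for j x
    unfolding hill_derivative_eq[OF \<kappa> wX] times_divide_eq_right mult.assoc[symmetric] by simp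
  have y1: "has_ac_derivative y y'"
  proof -
    have 1: "y = (\<lambda>x. wave \<kappa> True x * X True x + wave \<kappa> False x * X False x)"
      by (simp add: y_def UNIV_bool add.commute fun_eq_iff)
    have "y' x = (wave_sign True * \<kappa> * wave \<kappa> True x * X True x + wave \<kappa> True x * ?\<phi> True x)
      + (wave_sign False * \<kappa> * wave \<kappa> False x * X False x + wave \<kappa> False x * ?\<phi> False x)" for x
      unfolding mult.assoc w\<phi> wX y'_def using \<kappa> by (simp add: field_simps)
    then have 2: "y' = (\<lambda>x. (wave_sign True * \<kappa> * wave \<kappa> True x * X True x + wave \<kappa> True x * ?\<phi> True x)
      + (wave_sign False * \<kappa> * wave \<kappa> False x * X False x + wave \<kappa> False x * ?\<phi> False x))"
      by blast
    show ?thesis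
      unfolding 1 2 by (rule has_ac_derivative_add[OF dwX[of True] dwX[of False]])
  qed
  have q1: "has_ac_derivative q q'"
  proof -
    have 1: "q = (\<lambda>x. \<kappa> * (wave \<kappa> True x * X True x + (-1) * (wave \<kappa> False x * X False x)))"
      by (simp add: q_def UNIV_bool fun_eq_iff)
    have 2: "q' = (\<lambda>x. \<kappa> * ((wave_sign True * \<kappa> * wave \<kappa> True x * X True x + wave \<kappa> True x * ?\<phi> True x)
      + (-1) * (wave_sign False * \<kappa> * wave \<kappa> False x * X False x + wave \<kappa> False x * ?\<phi> False x)))"
      unfolding mult.assoc w\<phi> wX q'_def y'_def using \<kappa> by (simp add: field_simps power2_eq_square fun_eq_iff)
    show ?thesis
      unfolding 1 2
      by (rule has_ac_derivative_cmult[OF has_ac_derivative_add[OF dwX[of True] has_ac_derivative_cmult[OF dwX[of False]]]])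
  qed
  have y2: "y' square_integrable_on {0..pi}"
    unfolding y'_def
    by (intro square_integrable_add square_integrable_continuous square_integrable_continuous_mult Q
        has_ac_derivative_continuous_on[OF q1] has_ac_derivative_continuous_on[OF y1])
  have bc: "satisfies_bc bc y q"
  proof (rule iffD2[OF satisfies_bc_iff_boundary_matrix[OF \<kappa> nr]])
    have Xpi: "X j pi = X j 0 + (LINT t|lebesgue_0pi. ?\<phi> j t)" for j
      by (rule Xx) simp
    show "y 0 = (\<Sum>j\<in>UNIV. X j 0)" "q 0 = \<kappa> * (\<Sum>j\<in>UNIV. wave_sign j * X j 0)"
      by (simp_all add: y_def q_def)
    show "y pi = (\<Sum>j\<in>UNIV. wave \<kappa> j pi * (X j 0 + (LINT t|lebesgue_0pi. ?\<phi> j t)))"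
      "q pi = \<kappa> * (\<Sum>j\<in>UNIV. wave_sign j * (wave \<kappa> j pi * (X j 0 + (LINT t|lebesgue_0pi. ?\<phi> j t))))"
      unfolding Xpi[symmetric] y_def q_def by simp_all
    show "\<forall>i. X i 0 = (\<Sum>j\<in>UNIV. boundary_matrix bc \<kappa> i j * (LINT t|lebesgue_0pi. ?\<phi> j t))"
      using X0 by blast
  qed
  have "hill_solution bc v0 Q (- \<kappa>\<^sup>2) f y"
    unfolding hill_solution_def
    by (rule exI[of _ y'], rule exI[of _ q], rule exI[of _ q'])
      (intro conjI y1 y2 q1 bc AE_I2; simp add: y'_def q'_def)
  then show ?thesis by (simp add: y_def)
qed

section \<open>Uniform estimates on the circles\<close>

text \<open>The zeros of 1 - exp w are the multiples of 2 pi \<i>, and none has modulus in this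
  range, so compactness gives \<delta>. The range covers both \<bar>w\<bar> = pi \<bar>\<mu>\<bar>
  for the periodic conditions and \<bar>w\<bar> = 2 pi \<bar>\<mu>\<bar> for the Dirichlet
  one.\<close>

lemma exp_bounded_away_from_1:
  obtains \<delta> :: real where "\<delta> > 0"
    "\<And>w::complex. pi / 3 \<le> norm w \<Longrightarrow> norm w \<le> 4 * pi / 3 \<Longrightarrow> \<delta> \<le> norm (1 - exp w)"
proof -
  let ?S = "cball (0::complex) (4 * pi / 3) - ball 0 (pi / 3)"
  have comp: "compact ?S" by (intro compact_diff) auto
  have "complex_of_real pi \<in> ?S" by simp
  then have ne: "?S \<noteq> {}" by blast
  have cont: "continuous_on ?S (\<lambda>w. norm (1 - exp w))"
    by (intro continuous_intros)
  obtain w0 where w0: "w0 \<in> ?S" "\<And>w. w \<in> ?S \<Longrightarrow> norm (1 - exp w0) \<le> norm (1 - exp w)"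
    using continuous_attains_inf[OF comp ne cont] by blast
  have "exp w0 \<noteq> 1"
  proof
    assume "exp w0 = 1"
    then obtain m :: int where m: "Re w0 = 0" "Im w0 = of_int (2 * m) * pi"
      by (auto simp: exp_eq_1)
    then have "norm w0 = 2 * \<bar>of_int m\<bar> * pi"
      by (simp add: cmod_def abs_mult)
    then have "1 / 6 \<le> \<bar>of_int m :: real\<bar>" "\<bar>of_int m :: real\<bar> \<le> 2 / 3"
      using w0(1) by (auto simp: field_simps)
    then show False by (cases "m = 0") linarith+
  qed
  then show ?thesis
    by (intro that[of "norm (1 - exp w0)"] w0) auto
qed

text \<open>For the root k with nonnegative real part, \<bar>k + n\<bar> is at least n, so
  \<bar>\<mu>\<bar> <= 1. Then \<bar>k + n\<bar> lies between 2n - 1 and 2n + 1, and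
  \<bar>\<mu>\<bar> between n/(2n + 1) and n/(2n - 1); n >= 2 turns these into 1/3 and 2/3.\<close>

lemma circle_root:
  assumes z: "norm (z - (of_nat n)\<^sup>2) = real n" and n: "2 \<le> n"
  obtains \<mu> :: complex where "z = (of_nat n + \<mu>)\<^sup>2" "1 / 3 \<le> norm \<mu>" "norm \<mu> \<le> 2 / 3"
proof -
  define k where "k = csqrt z"
  define \<mu> where "\<mu> = k - of_nat n"
  have k: "k\<^sup>2 = z" by (simp add: k_def)
  have Re: "0 \<le> Re k" using csqrt_principal[of z] by (auto simp: k_def)
  have "(k - of_nat n) * (k + of_nat n) = z - (of_nat n)\<^sup>2"
    using k by (simp add: algebra_simps power2_eq_square)
  then have prod: "norm \<mu> * norm (k + of_nat n) = real n"
    using z by (simp add: \<mu>_def norm_mult[symmetric])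
  have "real n \<le> Re (k + of_nat n)" using Re by simp
  also have "\<dots> \<le> norm (k + of_nat n)" by (rule complex_Re_le_cmod)
  finally have "norm \<mu> * real n \<le> norm \<mu> * norm (k + of_nat n)"
    by (intro mult_left_mono) auto
  then have \<mu>1: "norm \<mu> \<le> 1"
    using prod n by simp
  have kn: "k + of_nat n = of_nat (2 * n) + \<mu>"
    by (simp add: \<mu>_def)
  have n2: "norm (of_nat (2 * n) :: complex) = 2 * real n"
    by (metis norm_of_nat of_nat_mult of_nat_numeral)
  have up: "norm (k + of_nat n) \<le> 2 * real n + 1"
    unfolding kn using norm_triangle_ineq[of "of_nat (2 * n)" \<mu>] \<mu>1 n2 by linarith
  have lo: "2 * real n - 1 \<le> norm (k + of_nat n)"
    unfolding kn using norm_diff_ineq[of "of_nat (2 * n)" \<mu>] \<mu>1 n2 by linarith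
  have "norm \<mu> * (2 * real n - 1) \<le> real n"
    using mult_left_mono[OF lo, of "norm \<mu>"] prod by simp
  also have "real n \<le> (2 / 3) * (2 * real n - 1)"
    using n by simp
  finally have \<mu>3: "norm \<mu> \<le> 2 / 3"
    by (rule mult_right_le_imp_le) (use n in simp)
  have "(1 / 3) * (2 * real n + 1) \<le> real n"
    using n by simp
  moreover have "real n \<le> norm \<mu> * (2 * real n + 1)"
    using mult_left_mono[OF up, of "norm \<mu>"] prod by simp
  ultimately have "(1 / 3) * (2 * real n + 1) \<le> norm \<mu> * (2 * real n + 1)"
    by linarith
  then have \<mu>2: "1 / 3 \<le> norm \<mu>"
    by (rule mult_right_le_imp_le) simp
  have "z = (of_nat n + \<mu>)\<^sup>2"
    using k by (simp add: \<mu>_def)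
  then show ?thesis by (rule that[OF _ \<mu>2 \<mu>3])
qed

lemma norm_wave_strip_le:
  assumes "norm \<mu> \<le> 2 / 3" "t \<in> {0..pi}"
  shows "norm (wave (\<i> * (of_nat n + \<mu>)) i t) \<le> exp (2 * pi)"
    and "norm (inverse_wave (\<i> * (of_nat n + \<mu>)) i t) \<le> exp (2 * pi)"
proof -
  have "\<bar>Im \<mu>\<bar> \<le> 2" using abs_Im_le_cmod[of \<mu>] assms(1) by linarith
  then have "\<bar>Im (wave_sign i * (of_nat n + \<mu>))\<bar> \<le> 2" "\<bar>Im (- wave_sign i * (of_nat n + \<mu>))\<bar> \<le> 2"
    by (cases i; simp)+
  from this[THEN norm_exp_strip_le, OF assms(2)]
  show "norm (wave (\<i> * (of_nat n + \<mu>)) i t) \<le> exp (2 * pi)"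
    and "norm (inverse_wave (\<i> * (of_nat n + \<mu>)) i t) \<le> exp (2 * pi)"
    by (simp_all add: wave_def inverse_wave_def mult_ac)
qed

text \<open>The large frequency contributes only a sign. For admissible n this sign matches the
  periodic or antiperiodic condition, so resonance means exp(\<i> pi \<mu>) = 1 in both
  cases.\<close>

lemma wave_at_pi:
  "wave (\<i> * (of_nat n + \<mu>)) i pi = (- 1) ^ n * exp (wave_sign i * \<i> * pi * \<mu>)"
proof -
  have e: "exp (of_nat n * (\<i> * complex_of_real pi)) = (- 1) ^ n"
    by (simp only: exp_of_nat_mult exp_pi_i')
  have "exp (- (of_nat n * (\<i> * complex_of_real pi))) = (- 1) ^ n"
    by (simp only: exp_minus e) (simp flip: power_inverse)
  then have "exp (wave_sign i * (of_nat n * (\<i> * complex_of_real pi))) = (- 1) ^ n"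
    using e by (cases i) simp_all
  moreover have "wave (\<i> * (of_nat n + \<mu>)) i pi =
      exp (wave_sign i * (of_nat n * (\<i> * complex_of_real pi))) * exp (wave_sign i * \<i> * pi * \<mu>)"
    unfolding wave_def exp_add[symmetric] by (simp add: algebra_simps)
  ultimately show ?thesis by simp
qed

text \<open>All denominators reduce to 1 - exp w with w in the range of
  \<open>exp_bounded_away_from_1\<close>, independently of n; numerators contain at most two waves,
  each bounded by exp(2 pi).\<close>

lemma boundary_matrix_bounded:
  "\<exists>m. \<forall>bc n \<mu> i j. admissible bc n \<longrightarrow> 1 / 3 \<le> norm \<mu> \<longrightarrow> norm \<mu> \<le> 2 / 3 \<longrightarrow>
    nonresonant bc (\<i> * (of_nat n + \<mu>)) \<and> norm (boundary_matrix bc (\<i> * (of_nat n + \<mu>)) i j) \<le> m"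
proof -
  obtain \<delta> :: real where \<delta>: "\<delta> > 0"
    "\<And>w::complex. pi / 3 \<le> norm w \<Longrightarrow> norm w \<le> 4 * pi / 3 \<Longrightarrow> \<delta> \<le> norm (1 - exp w)"
    using exp_bounded_away_from_1 by blast
  have "nonresonant bc (\<i> * (of_nat n + \<mu>)) \<and>
    norm (boundary_matrix bc (\<i> * (of_nat n + \<mu>)) i j) \<le> exp (2 * pi) * exp (2 * pi) / \<delta>"
    if adm: "admissible bc n" and \<mu>: "1 / 3 \<le> norm \<mu>" "norm \<mu> \<le> 2 / 3" for bc n \<mu> i j
  proof -
    let ?\<kappa> = "\<i> * (of_nat n + \<mu>)"
    have le: "norm (wave ?\<kappa> i pi) \<le> exp (2 * pi)" for i
      using norm_wave_strip_le(1)[OF \<mu>(2), of pi] by simp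
    have le1: "norm (wave ?\<kappa> i pi) \<le> exp (2 * pi) * exp (2 * pi)" for i
    proof -
      have "exp (2 * pi) * 1 \<le> exp (2 * pi) * exp (2 * pi)"
        by (intro mult_left_mono) auto
      then show ?thesis using le[of i] by linarith
    qed
    have nm: "norm (wave_sign i * \<i> * pi * \<mu>) = pi * norm \<mu>" for i
      by (simp add: norm_mult)
    have away: "\<delta> \<le> norm (1 - exp (wave_sign i * \<i> * pi * \<mu>))" for i
      by (rule \<delta>(2)) (unfold nm, use \<mu> in \<open>simp_all add: field_simps\<close>)
    have ne: "exp (wave_sign i * \<i> * pi * \<mu>) \<noteq> 1" for i
      using away[of i] \<delta>(1) by auto
    have frac: "norm (a / b) \<le> exp (2 * pi) * exp (2 * pi) / \<delta>"
      if "norm a \<le> exp (2 * pi) * exp (2 * pi)" "\<delta> \<le> norm b" for a b :: complex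
      unfolding norm_divide using that \<delta>(1) by (intro frac_le) auto
    have pos: "0 \<le> exp (2 * pi) * exp (2 * pi) / \<delta>" using \<delta>(1) by simp
    show ?thesis
    proof (cases bc)
      case Per_plus
      then have w: "wave ?\<kappa> i pi = exp (wave_sign i * \<i> * pi * \<mu>)" for i
        using adm by (simp add: wave_at_pi)
      have "norm (wave ?\<kappa> i pi / (1 - wave ?\<kappa> i pi)) \<le> exp (2 * pi) * exp (2 * pi) / \<delta>"
        by (rule frac[OF le1]) (use away[of i] w[of i] in simp)
      then show ?thesis
        using ne[of True] w[of True] pos by (auto simp: Per_plus)
    next
      case Per_minus
      then have w: "wave ?\<kappa> i pi = - exp (wave_sign i * \<i> * pi * \<mu>)" for i
        using adm by (simp add: wave_at_pi)
      have "norm (- wave ?\<kappa> i pi / (1 + wave ?\<kappa> i pi)) \<le> exp (2 * pi) * exp (2 * pi) / \<delta>"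
        by (rule frac) (use le1[of i] away[of i] w[of i] in simp_all)
      then show ?thesis
        using ne[of True] w[of True] pos by (auto simp: Per_minus)
    next
      case Dir
      \<comment> \<open>The quotient of the two waves at pi is exp w: the sign depending on n
        cancels, so both parities are covered by the Dirichlet condition.\<close>
      define w where "w = - (2 * \<i> * pi * \<mu>)"
      have nw: "norm w = 2 * pi * norm \<mu>" by (simp add: w_def norm_mult)
      have aw: "\<delta> \<le> norm (1 - exp w)"
        by (rule \<delta>(2)) (unfold nw, use \<mu> in \<open>simp_all add: field_simps\<close>)
      let ?T = "wave ?\<kappa> True pi" and ?F = "wave ?\<kappa> False pi"
      have T0: "?T \<noteq> 0" by (simp add: wave_def)
      have "?F = ?T * exp w"
        unfolding wave_at_pi w_def by (simp add: exp_add[symmetric] mult_ac)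
      then have diff: "?T - ?F = ?T * (1 - exp w)"
        by (simp add: algebra_simps)
      have inv: "?F = inverse ?T"
        using wave_True_False[of ?\<kappa> pi] by (metis inverse_unique)
      have nz: "1 - exp w \<noteq> 0" using aw \<delta>(1) by auto
      have "boundary_matrix bc ?\<kappa> i j = - wave_sign i * wave ?\<kappa> j pi / (?T * (1 - exp w))"
        by (simp only: Dir boundary_matrix.simps diff)
      also have "\<dots> = (- wave_sign i * (wave ?\<kappa> j pi * ?F)) / (1 - exp w)"
        unfolding inv by (simp add: divide_inverse mult_ac)
      finally have "boundary_matrix bc ?\<kappa> i j = (- wave_sign i * (wave ?\<kappa> j pi * ?F)) / (1 - exp w)" .
      moreover have "norm \<dots> \<le> exp (2 * pi) * exp (2 * pi) / \<delta>"
        by (rule frac[OF _ aw]) (use le[of j] le[of False] in \<open>simp add: norm_mult mult_mono\<close>)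
      moreover have "?T \<noteq> ?F" using diff T0 nz by auto
      ultimately show ?thesis by (simp add: Dir)
    qed
  qed
  then show ?thesis by blast
qed

section \<open>Size and oscillation of the coefficients on the circle\<close>

lemma hill_norm_bounds:
  assumes \<mu>: "norm \<mu> \<le> 2 / 3" and n: "2 \<le> n"
    and \<kappa>: "\<kappa> = \<i> * (of_nat n + \<mu>)"
  shows "norm \<kappa> \<ge> n / 2"
    and "t \<in> {0..pi} \<Longrightarrow> norm (inverse_wave \<kappa> i t * (wave_sign i * a / (2 * \<kappa>))) \<le> exp (2 * pi) / n * norm a"
    and "t \<in> {0..pi} \<Longrightarrow> norm (inverse_wave \<kappa> i t * wave \<kappa> j t) \<le> exp (4 * pi)"
proof -
  have "real n = norm ((of_nat n + \<mu>) - \<mu>)" by simp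
  also have "\<dots> \<le> norm (of_nat n + \<mu>) + norm \<mu>" by (rule norm_triangle_ineq4)
  finally show k: "norm \<kappa> \<ge> n / 2"
    using \<mu> n by (simp add: \<kappa> norm_mult)
  assume t: "t \<in> {0..pi}"
  have "norm (inverse_wave \<kappa> i t * (wave_sign i * a / (2 * \<kappa>))) = norm (inverse_wave \<kappa> i t) * (norm a / (2 * norm \<kappa>))"
    by (simp add: norm_mult norm_divide)
  also have "\<dots> \<le> exp (2 * pi) * (norm a / n)"
    using norm_wave_strip_le(2)[OF \<mu> t, of n i] k n
    by (intro mult_mono divide_left_mono) (auto simp: \<kappa> intro!: mult_pos_pos)
  finally show "norm (inverse_wave \<kappa> i t * (wave_sign i * a / (2 * \<kappa>))) \<le> exp (2 * pi) / n * norm a"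
    by simp
  have "norm (inverse_wave \<kappa> i t * wave \<kappa> j t) \<le> exp (2 * pi) * exp (2 * pi)"
    unfolding norm_mult \<kappa> by (intro mult_mono norm_wave_strip_le \<mu> t) auto
  then show "norm (inverse_wave \<kappa> i t * wave \<kappa> j t) \<le> exp (4 * pi)"
    by (simp add: exp_add[symmetric])
qed

lemma integrable_potential:
  assumes Q: "Q square_integrable_on {0..pi}"
  shows "integrable lebesgue_0pi (\<lambda>t. v0 - (Q t)\<^sup>2)"
proof -
  have "integrable lebesgue_0pi (\<lambda>t. (Q t)\<^sup>2)"
    unfolding power2_eq_square by (rule square_integrable_imp_integrable_mult[OF Q Q])
  then show ?thesis
    by (rule Bochner_Integration.integrable_diff[rotated]) (intro continuous_imp_integrable_real continuous_intros)
qed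

text \<open>The term with \<open>v0 - Q\<^sup>2\<close> is O(1/n) already in L^1. The term with
  \<open>Q\<close> occurs only off the diagonal, where the waves combine to frequency 2 (n + \<mu>)
  or its negative; the threshold of Riemann-Lebesgue depends on \<bar>k\<bar> alone, so the bound is
  uniform in \<mu>.\<close>

lemma hill_oscillation:
  assumes Q: "Q square_integrable_on {0..pi}" and \<epsilon>: "\<epsilon> > 0"
  shows "\<forall>\<^sub>F n in sequentially. \<forall>\<mu> i j x. norm \<mu> \<le> 2 / 3 \<longrightarrow> x \<in> {0..pi} \<longrightarrow>
    norm (LINT t|lebesgue_on {0..x}. hill_B v0 Q (\<i> * (of_nat n + \<mu>)) i j t) \<le> \<epsilon>"
proof -
  define W where "W = (\<lambda>t. v0 - (Q t)\<^sup>2)"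
  define w where "w = (LINT t|lebesgue_0pi. norm (W t))"
  have iW: "integrable lebesgue_0pi W" unfolding W_def by (rule integrable_potential[OF Q])
  have iQ: "integrable lebesgue_0pi Q" by (rule square_integrable_imp_integrable[OF Q])
  have "\<epsilon> / 2 > 0" using \<epsilon> by simp
  then obtain K where K: "\<And>k x. K \<le> norm k \<Longrightarrow> \<bar>Im k\<bar> \<le> 2 \<Longrightarrow> x \<in> {0..pi} \<Longrightarrow>
      norm (LINT t|lebesgue_on {0..x}. exp (\<i> * k * t) * Q t) \<le> \<epsilon> / 2"
    using riemann_lebesgue_integrable[OF iQ, of 2] unfolding riemann_lebesgue_def by metis
  \<comment> \<open>\<open>K\<close> makes the part with \<open>Q\<close> at most \<epsilon>/2; the
    last entry does the same for exp(4 pi) w / n.\<close>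
  have "\<forall>\<^sub>F n in sequentially. max 2 (max K (2 * exp (4 * pi) * w / \<epsilon>)) \<le> real n"
    using filterlim_real_sequentially unfolding filterlim_at_top by blast
  then show ?thesis
  proof eventually_elim
    case (elim n)
    then have n: "2 \<le> n" "K \<le> real n" "2 * exp (4 * pi) * w / \<epsilon> \<le> real n" by auto
    have "norm (LINT t|lebesgue_on {0..x}. hill_B v0 Q \<kappa> i j t) \<le> \<epsilon>"
      if \<mu>: "norm \<mu> \<le> 2 / 3" and x: "x \<in> {0..pi}" and \<kappa>: "\<kappa> = \<i> * (of_nat n + \<mu>)" for \<mu> \<kappa> i j x
    proof -
      note b = hill_norm_bounds[OF \<mu> n(1) \<kappa>]
      have \<kappa>0: "\<kappa> \<noteq> 0" using b(1) n(1) by auto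
      let ?e = "\<lambda>t. inverse_wave \<kappa> i t * wave \<kappa> j t"
      let ?w = "\<lambda>t. ?e t * (wave_sign i * W t / (2 * \<kappa>))"
      have ce: "continuous_on {0..pi} ?e"
        unfolding wave_def inverse_wave_def by (intro continuous_intros)
      have iw: "integrable lebesgue_0pi ?w"
        by (rule integrable_mult_continuous(1)[OF _ ce]) (use iW in auto)
      have ie: "integrable lebesgue_0pi (\<lambda>t. ?e t * Q t)"
        by (rule integrable_mult_continuous(1)[OF iQ ce])
      have sub: "integrable (lebesgue_on {0..x}) f" if "integrable lebesgue_0pi f" for f :: "real \<Rightarrow> complex"
        using integrable_lebesgue_on_Icc_subset[OF that] x by auto
      have "norm (LINT t|lebesgue_on {0..x}. ?w t) \<le> (LINT t|lebesgue_0pi. norm (?w t))"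
        by (rule norm_indefinite_integral_le[OF iw]) (use x in simp)
      also have "\<dots> \<le> (LINT t|lebesgue_0pi. exp (4 * pi) / n * norm (W t))"
      proof (rule integral_mono)
        fix t assume "t \<in> space lebesgue_0pi"
        then have t: "t \<in> {0..pi}" by simp
        have "norm (?w t) = norm (?e t) * (norm (W t) / (2 * norm \<kappa>))"
          by (simp add: norm_mult norm_divide)
        also have "\<dots> \<le> exp (4 * pi) * (norm (W t) / n)"
          using b(3)[OF t] b(1) n by (intro mult_mono divide_left_mono) (auto intro!: mult_pos_pos)
        finally show "norm (?w t) \<le> exp (4 * pi) / n * norm (W t)" by simp
      qed (use iw iW in auto)
      also have "\<dots> = exp (4 * pi) * w / n"
        by (simp add: w_def)
      also have "\<dots> \<le> \<epsilon> / 2"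
        using n \<epsilon> by (simp add: field_simps)
      finally have W: "norm (LINT t|lebesgue_on {0..x}. ?w t) \<le> \<epsilon> / 2" .
      show ?thesis
      proof (cases "i = j")
        case True
        then have "(LINT t|lebesgue_on {0..x}. hill_B v0 Q \<kappa> i j t) = (LINT t|lebesgue_on {0..x}. ?w t)"
          by (simp add: hill_B_def W_def)
        then show ?thesis using W \<epsilon> by simp
      next
        case False
        define k where "k = (wave_sign j - wave_sign i) * (of_nat n + \<mu>)"
        have ek: "?e t = exp (\<i> * k * complex_of_real t)" for t
          unfolding wave_def inverse_wave_def exp_add[symmetric] k_def \<kappa> by (simp add: algebra_simps)
        have s: "wave_sign j - wave_sign i = 2 \<or> wave_sign j - wave_sign i = - 2"
          using False by (cases i; cases j) auto
        have "norm k = 2 * norm \<kappa>"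
          using s by (auto simp: k_def \<kappa> norm_mult)
        then have 1: "K \<le> norm k" using b(1) n(2) by simp
        have "\<bar>Im \<mu>\<bar> \<le> 2 / 3" using abs_Im_le_cmod[of \<mu>] \<mu> by linarith
        then have 2: "\<bar>Im k\<bar> \<le> 2"
        proof -
          have "k = 2 * (of_nat n + \<mu>) \<or> k = - 2 * (of_nat n + \<mu>)"
            using s by (auto simp: k_def)
          then show ?thesis
            using \<open>\<bar>Im \<mu>\<bar> \<le> 2 / 3\<close> by (elim disjE) (simp_all add: abs_mult)
        qed
        have "(LINT t|lebesgue_on {0..x}. hill_B v0 Q \<kappa> i j t) = (LINT t|lebesgue_on {0..x}. ?e t * Q t + ?w t)"
          using False by (simp add: hill_B_def W_def distrib_left)
        also have "\<dots> = (LINT t|lebesgue_on {0..x}. ?e t * Q t) + (LINT t|lebesgue_on {0..x}. ?w t)"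
          by (rule Bochner_Integration.integral_add[OF sub[OF ie] sub[OF iw]])
        also have "norm \<dots> \<le> \<epsilon> / 2 + \<epsilon> / 2"
          by (intro norm_triangle_le add_mono W) (unfold ek, rule K[OF 1 2 x])
        finally show ?thesis by simp
      qed
    qed
    then show ?case by blast
  qed
qed

text \<open>Dropping the factor 1/(2 \<kappa>) is affordable: only a bound independent of n and
  \<mu> is wanted, to serve as \<beta>.\<close>

lemma hill_B_L1_le:
  assumes Q: "Q square_integrable_on {0..pi}" and \<mu>: "norm \<mu> \<le> 2 / 3" and n: "2 \<le> n"
  shows "(LINT t|lebesgue_0pi. norm (hill_B v0 Q (\<i> * (of_nat n + \<mu>)) i j t)) \<le>
    exp (4 * pi) * ((LINT t|lebesgue_0pi. norm (Q t)) + (LINT t|lebesgue_0pi. norm (v0 - (Q t)\<^sup>2)))"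
proof -
  let ?\<kappa> = "\<i> * (of_nat n + \<mu>)"
  note b = hill_norm_bounds[OF \<mu> n refl]
  have iW: "integrable lebesgue_0pi (\<lambda>t. norm (v0 - (Q t)\<^sup>2))" 
    by (intro integrable_norm integrable_potential[OF Q])
  have iQ: "integrable lebesgue_0pi (\<lambda>t. norm (Q t))" 
    by (intro integrable_norm square_integrable_imp_integrable[OF Q])
  have "(LINT t|lebesgue_0pi. norm (hill_B v0 Q ?\<kappa> i j t)) \<le>
    (LINT t|lebesgue_0pi. exp (4 * pi) * (norm (Q t) + norm (v0 - (Q t)\<^sup>2)))"
  proof (rule integral_mono)
    show "integrable lebesgue_0pi (\<lambda>t. norm (hill_B v0 Q ?\<kappa> i j t))"
      by (intro integrable_norm integrable_hill_B Q)
    show "integrable lebesgue_0pi (\<lambda>t. exp (4 * pi) * (norm (Q t) + norm (v0 - (Q t)\<^sup>2)))"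
      using iW iQ by (intro integrable_mult_right Bochner_Integration.integrable_add)
    fix t assume "t \<in> space lebesgue_0pi"
    then have t: "t \<in> {0..pi}" by simp
    have 1: "1 \<le> 2 * norm ?\<kappa>"
      using b(1) n by linarith
    have "norm (wave_sign i * (v0 - (Q t)\<^sup>2) / (2 * ?\<kappa>)) = norm (v0 - (Q t)\<^sup>2) / (2 * norm ?\<kappa>)"
      by (simp add: norm_mult norm_divide)
    also have "\<dots> \<le> norm (v0 - (Q t)\<^sup>2) / 1"
      using 1 by (intro divide_left_mono) auto
    finally have 2: "norm (wave_sign i * (v0 - (Q t)\<^sup>2) / (2 * ?\<kappa>)) \<le> norm (v0 - (Q t)\<^sup>2)"
      by simp
    have 3: "norm (if i = j then 0 else Q t) \<le> norm (Q t)" by simp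
    show "norm (hill_B v0 Q ?\<kappa> i j t) \<le> exp (4 * pi) * (norm (Q t) + norm (v0 - (Q t)\<^sup>2))"
      unfolding hill_B_def norm_mult[of "_ * _" "_ + _"]
      by (intro mult_mono b(3)[OF t] norm_triangle_mono[OF 3 2]) auto
  qed
  then show ?thesis
    using iW iQ by simp
qed

lemma hill_h_L1_le:
  assumes \<mu>: "norm \<mu> \<le> 2 / 3" and n: "2 \<le> n" and f: "integrable lebesgue_0pi f"
  shows "(LINT t|lebesgue_0pi. norm (hill_h (\<i> * (of_nat n + \<mu>)) f i t)) \<le>
    exp (2 * pi) / n * (LINT t|lebesgue_0pi. norm (f t))"
proof -
  have "(LINT t|lebesgue_0pi. norm (hill_h (\<i> * (of_nat n + \<mu>)) f i t)) \<le> (LINT t|lebesgue_0pi. exp (2 * pi) / n * norm (f t))"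
    unfolding hill_h_def
    by (intro integral_mono hill_norm_bounds(2)[OF \<mu> n refl])
      (use integrable_norm[OF integrable_hill_h[OF f]] f in \<open>auto simp: hill_h_def\<close>)
  then show ?thesis by simp
qed

lemma volterra_solves_free:
  assumes "volterra_solves M (hill_B 0 (\<lambda>_. 0) \<kappa>) h X" "x \<in> {0..pi}"
  shows "X i x = volterra_sol M h i x"
proof -
  have "volterra_mul (hill_B 0 (\<lambda>_. 0) \<kappa>) X j t = 0" for j t
    by (simp add: volterra_mul_def hill_B_def)
  then show ?thesis
    using assms by (simp add: volterra_solves_def)
qed

text \<open>Every 1/n stems from the right-hand side \<open>hill_h\<close>, every \<epsilon> from
  the oscillation of the coefficients. \<open>D\<close> is fixed before \<epsilon>. Existence and
  the bound put the circle into the resolvent set; the comparison is what the theorem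
  integrates.\<close>

lemma hill_circle_estimates:
  assumes Q: "Q square_integrable_on {0..pi}"
  obtains D :: real where "D \<ge> 0"
    "\<And>\<epsilon>. \<epsilon> > 0 \<Longrightarrow> \<forall>\<^sub>F n in sequentially. admissible bc n \<longrightarrow>
      (\<forall>(z::complex) f. norm (z - (of_nat n)\<^sup>2) = real n \<longrightarrow> integrable lebesgue_0pi f \<longrightarrow>
        (\<exists>y. hill_solution bc v0 Q z f y) \<and>
        (\<forall>y. hill_solution bc v0 Q z f y \<longrightarrow>
          (\<forall>x\<in>{0..pi}. norm (y x) \<le> D / n * (LINT t|lebesgue_0pi. norm (f t)))) \<and>
        (\<forall>y y0. hill_solution bc v0 Q z f y \<longrightarrow> hill_solution bc 0 (\<lambda>_. 0) z f y0 \<longrightarrow>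
          (\<forall>x\<in>{0..pi}. norm (y x - y0 x) \<le> \<epsilon> / n * (LINT t|lebesgue_0pi. norm (f t)))))"
proof -
  obtain m :: real where "\<forall>bc n \<mu> i j. admissible bc n \<longrightarrow> 1 / 3 \<le> norm \<mu> \<longrightarrow> norm \<mu> \<le> 2 / 3 \<longrightarrow>
    nonresonant bc (\<i> * (of_nat n + \<mu>)) \<and> norm (boundary_matrix bc (\<i> * (of_nat n + \<mu>)) i j) \<le> m"
    using boundary_matrix_bounded by (rule exE)
  then have nr: "\<And>n \<mu>. admissible bc n \<Longrightarrow> 1 / 3 \<le> norm \<mu> \<Longrightarrow> norm \<mu> \<le> 2 / 3 \<Longrightarrow>
        nonresonant bc (\<i> * (of_nat n + \<mu>))"
    and m': "\<And>n \<mu> i j. admissible bc n \<Longrightarrow> 1 / 3 \<le> norm \<mu> \<Longrightarrow> norm \<mu> \<le> 2 / 3 \<Longrightarrow>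
      norm (boundary_matrix bc (\<i> * (of_nat n + \<mu>)) i j) \<le> m"
    by blast+
  have m: "norm (boundary_matrix bc (\<i> * (of_nat n + \<mu>)) i j) \<le> \<bar>m\<bar>"
    if "admissible bc n" "1 / 3 \<le> norm \<mu>" "norm \<mu> \<le> 2 / 3" for n \<mu> i j
    using m'[OF that, of i j] by linarith
  define \<beta> where "\<beta> = exp (4 * pi) * ((LINT t|lebesgue_0pi. norm (Q t)) + (LINT t|lebesgue_0pi. norm (v0 - (Q t)\<^sup>2)))"
  define C where "C = 2 * (2 * \<bar>m\<bar> + 1) * (2 * \<bar>m\<bar> + 2)"
  define E where "E = exp (2 * pi)"
  \<comment> \<open>2 E for assembling y from two waves, E/n from \<open>hill_h\<close>, and 2 (2
    \<bar>m\<bar> + 2) from \<open>norm_solution_le\<close> once C e <= 1.\<close>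
  define D where "D = 4 * E * E * (2 * \<bar>m\<bar> + 2)"
  define L where "L = 2 * \<beta> * (2 * (2 * \<bar>m\<bar> + 2)) + 1"
  \<comment> \<open>Collects the demands on the oscillation bound e = min 1 \<epsilon> / T: the
    final error, C e <= 1, and the contraction condition, whose 8 is 2 N N with N = 2. The summand 1
    makes T positive. \<open>L\<close> bounds the bracket in the second claim of
    \<open>norm_solution_le\<close>.\<close>
  define T where "T = 2 * E * E * C * L + C + 8 * C * \<beta> + 1"
  have "0 \<le> \<beta>"
    unfolding \<beta>_def by (intro mult_nonneg_nonneg add_nonneg_nonneg) simp_all
  moreover have "0 \<le> C"
    unfolding C_def by (intro mult_nonneg_nonneg add_nonneg_nonneg) simp_all
  moreover have "0 \<le> E"
    by (simp add: E_def)
  moreover have "0 \<le> L"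
    unfolding L_def using \<open>0 \<le> \<beta>\<close> by (intro mult_nonneg_nonneg add_nonneg_nonneg) simp_all
  ultimately have nonneg: "0 \<le> \<beta>" "0 \<le> C" "0 \<le> E" "0 \<le> L"
    by blast+
  have "0 \<le> 2 * E * E * C * L" "0 \<le> 8 * C * \<beta>"
    using nonneg by (intro mult_nonneg_nonneg; simp)+
  then have T: "0 < T" "2 * E * E * C * L \<le> T" "C \<le> T" "8 * C * \<beta> \<le> T"
    using nonneg(2) unfolding T_def by linarith+
  have "\<forall>\<^sub>F n in sequentially. admissible bc n \<longrightarrow>
      (\<forall>(z::complex) f. norm (z - (of_nat n)\<^sup>2) = real n \<longrightarrow> integrable lebesgue_0pi f \<longrightarrow>
        (\<exists>y. hill_solution bc v0 Q z f y) \<and>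
        (\<forall>y. hill_solution bc v0 Q z f y \<longrightarrow>
          (\<forall>x\<in>{0..pi}. norm (y x) \<le> D / n * (LINT t|lebesgue_0pi. norm (f t)))) \<and>
        (\<forall>y y0. hill_solution bc v0 Q z f y \<longrightarrow> hill_solution bc 0 (\<lambda>_. 0) z f y0 \<longrightarrow>
          (\<forall>x\<in>{0..pi}. norm (y x - y0 x) \<le> \<epsilon> / n * (LINT t|lebesgue_0pi. norm (f t)))))"
    if \<epsilon>: "\<epsilon> > 0" for \<epsilon>
  proof -
    define e where "e = min 1 \<epsilon> / T"
    have e: "e > 0" using \<epsilon> T(1) by (simp add: e_def)
    have eT: "S * e \<le> min 1 \<epsilon>" if "S \<le> T" for S
      using mult_right_mono[OF that less_imp_le[OF e]] T(1) by (simp add: e_def)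
    have Ce: "C * e \<le> 1" and small: "8 * C * \<beta> * e \<le> 1" and fin: "2 * E * E * C * L * e \<le> \<epsilon>"
      using eT[OF T(3)] eT[OF T(4)] eT[OF T(2)] by auto
    show ?thesis
      using hill_oscillation[OF Q e, of v0] eventually_ge_at_top[of 2]
    proof eventually_elim
      case (elim n)
      show ?case
      proof (intro impI allI)
        fix z :: complex and f :: "real \<Rightarrow> complex"
        assume adm: "admissible bc n" and z: "norm (z - (of_nat n)\<^sup>2) = real n" and f: "integrable lebesgue_0pi f"
        obtain \<mu> where z\<mu>: "z = (of_nat n + \<mu>)\<^sup>2" and \<mu>: "1 / 3 \<le> norm \<mu>" "norm \<mu> \<le> 2 / 3"
          using circle_root[OF z elim(2)] by blast
        define \<kappa> where "\<kappa> = \<i> * (of_nat n + \<mu>)"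
        have z\<kappa>: "z = - \<kappa>\<^sup>2"
          by (simp add: z\<mu> \<kappa>_def power_mult_distrib)
        have \<kappa>0: "\<kappa> \<noteq> 0"
          using hill_norm_bounds(1)[OF \<mu>(2) elim(2) \<kappa>_def] elim(2) by auto
        note nr\<kappa> = nr[OF adm \<mu>, folded \<kappa>_def]
        interpret volterra_system "boundary_matrix bc \<kappa>" "hill_B v0 Q \<kappa>" "\<bar>m\<bar>" e \<beta> 2 C
        proof
          show "2 = real CARD(bool)" by simp
          show "C = 2 * (2 * \<bar>m\<bar> + 1) * (2 * \<bar>m\<bar> + 2)" by (rule C_def)
          show "integrable lebesgue_0pi (hill_B v0 Q \<kappa> i j)" for i j
            by (rule integrable_hill_B[OF Q])
          show "norm (boundary_matrix bc \<kappa> i j) \<le> \<bar>m\<bar>" for i j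
            unfolding \<kappa>_def by (rule m[OF adm \<mu>])
          show "norm (LINT t|lebesgue_on {0..x}. hill_B v0 Q \<kappa> i j t) \<le> e" if "x \<in> {0..pi}" for x i j
            unfolding \<kappa>_def using elim(1) \<mu>(2) that by blast
          show "(LINT t|lebesgue_0pi. norm (hill_B v0 Q \<kappa> i j t)) \<le> \<beta>" for i j
            unfolding \<kappa>_def \<beta>_def by (rule hill_B_L1_le[OF Q \<mu>(2) elim(2)])
        qed
        let ?p = "E / n * (LINT t|lebesgue_0pi. norm (f t))"
        have p0: "0 \<le> ?p" using nonneg by simp
        have ih: "integrable lebesgue_0pi (hill_h \<kappa> f j)" for j
          by (rule integrable_hill_h[OF f])
        have hp: "(LINT t|lebesgue_0pi. norm (hill_h \<kappa> f j t)) \<le> ?p" for j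
          unfolding \<kappa>_def E_def by (rule hill_h_L1_le[OF \<mu>(2) elim(2) f])
        have small1: "2 * (C * e * 2 * \<beta> * 2) \<le> 1" using small by (simp add: mult_ac)
        moreover have "0 \<le> C * e * 2 * \<beta>"
          using nonneg e by simp
        ultimately have small2: "2 * (C * e * 2 * \<beta>) \<le> 1" by simp
        have wb: "norm (wave \<kappa> j x) \<le> E" if "x \<in> {0..pi}" for j x
          unfolding \<kappa>_def E_def by (rule norm_wave_strip_le(1)[OF \<mu>(2) that])
        have wsum: "norm (\<Sum>j\<in>UNIV. wave \<kappa> j x * Y j) \<le> 2 * (E * b)"
          if "x \<in> {0..pi}" "\<And>j. norm (Y j) \<le> b" for Y :: "bool \<Rightarrow> complex" and b x
        proof -
          have "norm (\<Sum>j\<in>UNIV. wave \<kappa> j x * Y j) \<le> (\<Sum>j\<in>(UNIV :: bool set). E * b)"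
            by (intro sum_norm_le) (unfold norm_mult, intro mult_mono wb that, use nonneg in auto)
          then show ?thesis by simp
        qed
        obtain X where X: "solves (hill_h \<kappa> f) X"
          by (rule ex_solution[OF ih small1])
        have ex: "\<exists>y. hill_solution bc v0 Q z f y"
          unfolding z\<kappa> by (rule exI, rule volterra_imp_hill_solution[OF \<kappa>0 nr\<kappa> Q f X])
        have bd: "norm (y x) \<le> D / n * (LINT t|lebesgue_0pi. norm (f t))"
          if y: "hill_solution bc v0 Q z f y" and x: "x \<in> {0..pi}" for y x
        proof -
          obtain X where X: "solves (hill_h \<kappa> f) X" and yX: "\<And>x. y x = (\<Sum>j\<in>UNIV. wave \<kappa> j x * X j x)"
            by (rule hill_solution_imp_volterra[OF \<kappa>0 nr\<kappa> Q f y[unfolded z\<kappa>]]) (rule that)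
          have "norm (X j x) \<le> 2 * (2 * \<bar>m\<bar> + 2) * ?p" for j
          proof -
            have "norm (X j x) \<le> 2 * (2 * \<bar>m\<bar> + 1 + C * e) * ?p"
              by (rule norm_solution_le(1)[OF X ih hp small2 x])
            also have "\<dots> \<le> 2 * (2 * \<bar>m\<bar> + 2) * ?p"
              by (intro mult_right_mono p0) (use Ce in simp)
            finally show ?thesis .
          qed
          then have "norm (y x) \<le> 2 * (E * (2 * (2 * \<bar>m\<bar> + 2) * ?p))"
            unfolding yX by (intro wsum x)
          then show ?thesis by (simp add: D_def algebra_simps)
        qed
        have cmp: "norm (y x - y0 x) \<le> \<epsilon> / n * (LINT t|lebesgue_0pi. norm (f t))"
          if y: "hill_solution bc v0 Q z f y" and y0: "hill_solution bc 0 (\<lambda>_. 0) z f y0"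
            and x: "x \<in> {0..pi}" for y y0 x
        proof -
          obtain X where X: "solves (hill_h \<kappa> f) X" and yX: "\<And>x. y x = (\<Sum>j\<in>UNIV. wave \<kappa> j x * X j x)"
            by (rule hill_solution_imp_volterra[OF \<kappa>0 nr\<kappa> Q f y[unfolded z\<kappa>]]) (rule that)
          have Q0: "(\<lambda>_. 0) square_integrable_on {0..pi}"
            by (simp add: square_integrable_on_def)
          obtain X0 where X0: "volterra_solves (boundary_matrix bc \<kappa>) (hill_B 0 (\<lambda>_. 0) \<kappa>) (hill_h \<kappa> f) X0"
            and yX0: "\<And>x. y0 x = (\<Sum>j\<in>UNIV. wave \<kappa> j x * X0 j x)"
            by (rule hill_solution_imp_volterra[OF \<kappa>0 nr\<kappa> Q0 f y0[unfolded z\<kappa>]]) (rule that)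
          have "norm (X j x - X0 j x) \<le> C * e * L * ?p" for j
          proof -
            have "norm (X j x - X0 j x) \<le> C * e * (2 * \<beta> * (2 * (2 * \<bar>m\<bar> + 1 + C * e)) + 1) * ?p"
              unfolding volterra_solves_free[OF X0 x] by (rule norm_solution_le(2)[OF X ih hp small2 x])
            also have "\<dots> \<le> C * e * L * ?p"
              unfolding L_def
              by (intro mult_right_mono p0 mult_left_mono add_right_mono) (use Ce e nonneg in auto)
            finally show ?thesis .
          qed
          then have "norm (\<Sum>j\<in>UNIV. wave \<kappa> j x * (X j x - X0 j x)) \<le> 2 * (E * (C * e * L * ?p))"
            by (intro wsum x)
          moreover have "y x - y0 x = (\<Sum>j\<in>UNIV. wave \<kappa> j x * (X j x - X0 j x))"
            by (simp add: yX yX0 right_diff_distrib sum_subtractf)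
          moreover have "2 * (E * (C * e * L * ?p)) = (2 * E * E * C * L * e) / n * (LINT t|lebesgue_0pi. norm (f t))"
            by (simp add: mult_ac)
          moreover have "\<dots> \<le> \<epsilon> / n * (LINT t|lebesgue_0pi. norm (f t))"
            by (intro mult_right_mono divide_right_mono fin) auto
          ultimately show ?thesis by (simp only:)
        qed
        show "(\<exists>y. hill_solution bc v0 Q z f y) \<and>
          (\<forall>y. hill_solution bc v0 Q z f y \<longrightarrow>
            (\<forall>x\<in>{0..pi}. norm (y x) \<le> D / n * (LINT t|lebesgue_0pi. norm (f t)))) \<and>
          (\<forall>y y0. hill_solution bc v0 Q z f y \<longrightarrow> hill_solution bc 0 (\<lambda>_. 0) z f y0 \<longrightarrow>
            (\<forall>x\<in>{0..pi}. norm (y x - y0 x) \<le> \<epsilon> / n * (LINT t|lebesgue_0pi. norm (f t))))"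
          by (intro conjI allI ballI impI ex bd cmp)
      qed
    qed
  qed
  moreover have "0 \<le> D"
    unfolding D_def using nonneg by (intro mult_nonneg_nonneg) simp_all
  ultimately show ?thesis by (intro that)
qed

section \<open>Resolvents and Riesz projections\<close>

text \<open>Completeness passes on to the bounded operators into this space, and there a continuous
  integrand has an integral.\<close>

instance bcontfun :: (metric_space, banach) banach ..

section \<open>Representatives of classes in \<open>l2\<close> and their norms\<close>

lemma l2_rel_self_iff: "l2_rel f f \<longleftrightarrow> f square_integrable_on {0..pi}"
  by (auto simp: l2_rel_def)

lemma square_integrable_rep_l2: "rep_l2 F square_integrable_on {0..pi}"
  using Quotient3_rep_reflp[OF Quotient3_l2, of F] by (simp add: l2_rel_self_iff)

lemma abs_rep_l2 [simp]: "abs_l2 (rep_l2 F) = F"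
  by (rule Quotient3_abs_rep[OF Quotient3_l2])

lemma abs_l2_eq_iff:
  assumes "f square_integrable_on {0..pi}" "g square_integrable_on {0..pi}"
  shows "abs_l2 f = abs_l2 g \<longleftrightarrow> (AE x in lebesgue_0pi. f x = g x)"
  using Quotient3_rel[OF Quotient3_l2, of f g] assms by (auto simp: l2_rel_def)

lemma AE_rep_abs_l2:
  assumes "f square_integrable_on {0..pi}"
  shows "AE x in lebesgue_0pi. rep_l2 (abs_l2 f) x = f x"
  using abs_l2_eq_iff[OF square_integrable_rep_l2 assms, of "abs_l2 f"] by simp

lemma abs_l2_add:
  assumes "f square_integrable_on {0..pi}" "g square_integrable_on {0..pi}"
  shows "abs_l2 f + abs_l2 g = abs_l2 (\<lambda>x. f x + g x)"
  using assms by (intro plus_l2.abs_eq) (simp_all add: l2_rel_self_iff)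

lemma scaleC_abs_l2:
  assumes "f square_integrable_on {0..pi}"
  shows "c *\<^sub>C abs_l2 f = abs_l2 (\<lambda>x. c * f x)"
  using assms by (intro scaleC_l2.abs_eq) (simp_all add: l2_rel_self_iff)

lemma scaleR_abs_l2:
  assumes "f square_integrable_on {0..pi}"
  shows "r *\<^sub>R abs_l2 f = abs_l2 (\<lambda>x. of_real r * f x)"
  using assms by (intro scaleR_l2.abs_eq) (simp_all add: l2_rel_self_iff)

lemma abs_l2_diff:
  assumes "f square_integrable_on {0..pi}" "g square_integrable_on {0..pi}"
  shows "abs_l2 f - abs_l2 g = abs_l2 (\<lambda>x. f x - g x)"
proof -
  have "abs_l2 (\<lambda>x. f x - g x) + abs_l2 g = abs_l2 f"
    using abs_l2_add[OF square_integrable_add[OF assms(1) square_integrable_uminus[OF assms(2)]] assms(2)] by simp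
  then show ?thesis
    by (simp add: diff_eq_eq)
qed

lemma AE_rep_l2_add: "AE x in lebesgue_0pi. rep_l2 (F + G) x = rep_l2 F x + rep_l2 G x"
  using AE_rep_abs_l2[OF square_integrable_add[OF square_integrable_rep_l2 square_integrable_rep_l2], of F G]
    abs_l2_add[OF square_integrable_rep_l2 square_integrable_rep_l2, of F G] by simp

lemma AE_rep_l2_scaleC: "AE x in lebesgue_0pi. rep_l2 (c *\<^sub>C F) x = c * rep_l2 F x"
  using AE_rep_abs_l2[OF square_integrable_mult[OF square_integrable_rep_l2], of c F]
    scaleC_abs_l2[OF square_integrable_rep_l2, of c F] by simp

lemma scaleR_l2_eq_scaleC: "r *\<^sub>R F = complex_of_real r *\<^sub>C F"
  using scaleR_abs_l2[OF square_integrable_rep_l2, of r F] scaleC_abs_l2[OF square_integrable_rep_l2, of "of_real r" F]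
  by simp

lemma l1_norm_eq: "l1_norm F = (LINT x|lebesgue_0pi. norm (rep_l2 F x))"
  using l1_norm.abs_eq[of "rep_l2 F"] by (simp add: l2_rel_self_iff square_integrable_rep_l2)

lemma norm_l2_eq: "norm F = sqrt (LINT x|lebesgue_0pi. (norm (rep_l2 F x))\<^sup>2)"
  using norm_l2.abs_eq[of "rep_l2 F"] by (simp add: l2_rel_self_iff square_integrable_rep_l2)

lemma l1_norm_scaleC: "l1_norm (c *\<^sub>C F) = norm c * l1_norm F"
proof -
  have [measurable]: "rep_l2 G \<in> borel_measurable lebesgue_0pi" for G
    using square_integrable_rep_l2[of G] by (simp add: square_integrable_on_def)
  have "(LINT x|lebesgue_0pi. norm (rep_l2 (c *\<^sub>C F) x)) = (LINT x|lebesgue_0pi. norm c * norm (rep_l2 F x))"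
    by (rule integral_cong_AE) (use AE_rep_l2_scaleC[of c F] in \<open>auto simp: norm_mult elim!: eventually_mono\<close>)
  then show ?thesis
    by (simp add: l1_norm_eq)
qed

lemma norm_scaleC_l2: "norm (c *\<^sub>C F) = norm c * norm F"
proof -
  have [measurable]: "rep_l2 G \<in> borel_measurable lebesgue_0pi" for G
    using square_integrable_rep_l2[of G] by (simp add: square_integrable_on_def)
  have "(LINT x|lebesgue_0pi. (norm (rep_l2 (c *\<^sub>C F) x))\<^sup>2) = (LINT x|lebesgue_0pi. (norm c)\<^sup>2 * (norm (rep_l2 F x))\<^sup>2)"
    by (rule integral_cong_AE) (use AE_rep_l2_scaleC[of c F] in \<open>auto simp: norm_mult power_mult_distrib elim!: eventually_mono\<close>)
  then show ?thesis
    by (simp add: norm_l2_eq real_sqrt_mult)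
qed

lemma measure_lebesgue_0pi [simp]: "measure lebesgue_0pi {0..pi} = pi"
  by (simp add: measure_restrict_space)

text \<open>Cauchy-Schwarz in \<open>l2\<close> for the modulus of F and the constant 1, whose norm
  is sqrt pi.\<close>

lemma l1_norm_le: "l1_norm F \<le> sqrt pi * norm F"
proof -
  let ?f = "rep_l2 F"
  have f: "?f square_integrable_on {0..pi}" by (rule square_integrable_rep_l2)
  define a where "a = (\<lambda>x. complex_of_real (norm (?f x)))"
  have a: "a square_integrable_on {0..pi}" and one: "(\<lambda>x. 1) square_integrable_on {0..pi}"
    using f by (auto simp: square_integrable_on_def a_def continuous_imp_integrable_real)
  have "inner (abs_l2 (\<lambda>x. 1)) (abs_l2 a) = (LINT x|lebesgue_0pi. 1 \<bullet> a x)"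
    using a one by (intro inner_l2.abs_eq) (simp_all add: l2_rel_self_iff)
  also have "\<dots> = l1_norm F"
    by (simp add: l1_norm_eq a_def inner_complex_def)
  finally have "l1_norm F = inner (abs_l2 (\<lambda>x. 1)) (abs_l2 a)" by simp
  also have "\<dots> \<le> norm (abs_l2 (\<lambda>x. 1)) * norm (abs_l2 a)"
    by (rule norm_cauchy_schwarz)
  also have "norm (abs_l2 (\<lambda>x. 1)) = sqrt pi"
    using norm_l2.abs_eq[of "\<lambda>x. 1"] one by (simp add: l2_rel_self_iff)
  also have "norm (abs_l2 a) = norm F"
    using norm_l2.abs_eq[of a] a by (simp add: l2_rel_self_iff norm_l2_eq a_def)
  finally show ?thesis .
qed

lemma integrable_rep_l2: "integrable lebesgue_0pi (rep_l2 F)"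
  by (rule square_integrable_imp_integrable[OF square_integrable_rep_l2])

section \<open>Linearity of the Hill equation and its link with the operator graph\<close>

lemma satisfies_bc_add: "satisfies_bc bc y q \<Longrightarrow> satisfies_bc bc u p \<Longrightarrow> satisfies_bc bc (\<lambda>x. y x + u x) (\<lambda>x. q x + p x)"
  by (cases bc) auto

lemma satisfies_bc_cmult: "satisfies_bc bc y q \<Longrightarrow> satisfies_bc bc (\<lambda>x. c * y x) (\<lambda>x. c * q x)"
  by (cases bc) auto

lemma hill_solution_cong_AE:
  assumes "hill_solution bc v0 Q z f y" "AE x in lebesgue_0pi. f x = g x"
  shows "hill_solution bc v0 Q z g y"
proof -
  obtain y' q q' where h: "has_ac_derivative y y'" "y' square_integrable_on {0..pi}" "has_ac_derivative q q'"
    "AE x in lebesgue_0pi. q x = y' x - Q x * y x" "satisfies_bc bc y q"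
    and e: "AE x in lebesgue_0pi. z * y x + q' x + Q x * y' x - v0 * y x = f x"
    using assms(1) unfolding hill_solution_def by blast
  have "AE x in lebesgue_0pi. z * y x + q' x + Q x * y' x - v0 * y x = g x"
    using e assms(2) by eventually_elim simp
  then show ?thesis
    unfolding hill_solution_def using h by blast
qed

lemma hill_solution_add:
  assumes "hill_solution bc v0 Q z f y" "hill_solution bc v0 Q z g u"
  shows "hill_solution bc v0 Q z (\<lambda>x. f x + g x) (\<lambda>x. y x + u x)"
proof -
  obtain y' q q' where 1: "has_ac_derivative y y'" "y' square_integrable_on {0..pi}" "has_ac_derivative q q'"
    "AE x in lebesgue_0pi. q x = y' x - Q x * y x" "satisfies_bc bc y q"
    "AE x in lebesgue_0pi. z * y x + q' x + Q x * y' x - v0 * y x = f x"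
    using assms(1) unfolding hill_solution_def by blast
  obtain u' p p' where 2: "has_ac_derivative u u'" "u' square_integrable_on {0..pi}" "has_ac_derivative p p'"
    "AE x in lebesgue_0pi. p x = u' x - Q x * u x" "satisfies_bc bc u p"
    "AE x in lebesgue_0pi. z * u x + p' x + Q x * u' x - v0 * u x = g x"
    using assms(2) unfolding hill_solution_def by blast
  have "AE x in lebesgue_0pi. q x + p x = y' x + u' x - Q x * (y x + u x)"
    using 1(4) 2(4) by eventually_elim (simp add: distrib_left)
  moreover have "AE x in lebesgue_0pi. z * (y x + u x) + (q' x + p' x) + Q x * (y' x + u' x) - v0 * (y x + u x) = f x + g x"
  proof -
    have "z * (y x + u x) + (q' x + p' x) + Q x * (y' x + u' x) - v0 * (y x + u x) = f x + g x"
      if "z * y x + q' x + Q x * y' x - v0 * y x = f x" "z * u x + p' x + Q x * u' x - v0 * u x = g x" for x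
      unfolding that[symmetric] by (simp add: algebra_simps)
    then show ?thesis
      using eventually_mono[OF eventually_conj[OF 1(6) 2(6)]] by simp
  qed
  ultimately show ?thesis
    unfolding hill_solution_def
    using has_ac_derivative_add[OF 1(1) 2(1)] square_integrable_add[OF 1(2) 2(2)]
      has_ac_derivative_add[OF 1(3) 2(3)] satisfies_bc_add[OF 1(5) 2(5)] by blast
qed

lemma hill_solution_cmult:
  assumes "hill_solution bc v0 Q z f y"
  shows "hill_solution bc v0 Q z (\<lambda>x. c * f x) (\<lambda>x. c * y x)"
proof -
  obtain y' q q' where 1: "has_ac_derivative y y'" "y' square_integrable_on {0..pi}" "has_ac_derivative q q'"
    "AE x in lebesgue_0pi. q x = y' x - Q x * y x" "satisfies_bc bc y q"
    "AE x in lebesgue_0pi. z * y x + q' x + Q x * y' x - v0 * y x = f x"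
    using assms(1) unfolding hill_solution_def by blast
  have "AE x in lebesgue_0pi. c * q x = c * y' x - Q x * (c * y x)"
    using 1(4) by eventually_elim (simp add: right_diff_distrib mult_ac)
  moreover have "AE x in lebesgue_0pi. z * (c * y x) + c * q' x + Q x * (c * y' x) - v0 * (c * y x) = c * f x"
  proof -
    have "z * (c * y x) + c * q' x + Q x * (c * y' x) - v0 * (c * y x) = c * f x"
      if "z * y x + q' x + Q x * y' x - v0 * y x = f x" for x
      unfolding that[symmetric] by (simp add: algebra_simps)
    then show ?thesis
      by (rule eventually_mono[OF 1(6)])
  qed
  ultimately show ?thesis
    unfolding hill_solution_def
    using has_ac_derivative_cmult[OF 1(1)] square_integrable_mult[OF 1(2)]
      has_ac_derivative_cmult[OF 1(3)] satisfies_bc_cmult[OF 1(5)] by blast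
qed

lemma hill_solution_diff:
  assumes "hill_solution bc v0 Q z f y" "hill_solution bc v0 Q z g u"
  shows "hill_solution bc v0 Q z (\<lambda>x. f x - g x) (\<lambda>x. y x - u x)"
  using hill_solution_add[OF assms(1) hill_solution_cmult[OF assms(2), of "-1"]] by simp

text \<open>The resolvent identity on the level of solutions: a change of the spectral parameter is
  moved into the source.\<close>

lemma hill_solution_shift:
  assumes "hill_solution bc v0 Q z f y"
  shows "hill_solution bc v0 Q w (\<lambda>x. f x + (w - z) * y x) y"
proof -
  obtain y' q q' where 1: "has_ac_derivative y y'" "y' square_integrable_on {0..pi}" "has_ac_derivative q q'"
    "AE x in lebesgue_0pi. q x = y' x - Q x * y x" "satisfies_bc bc y q"
    "AE x in lebesgue_0pi. z * y x + q' x + Q x * y' x - v0 * y x = f x"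
    using assms(1) unfolding hill_solution_def by blast
  have "AE x in lebesgue_0pi. w * y x + q' x + Q x * y' x - v0 * y x = f x + (w - z) * y x"
    using 1(6) by eventually_elim (auto simp: algebra_simps)
  then show ?thesis
    unfolding hill_solution_def using 1 by blast
qed

lemma hill_solution_continuous_on: "hill_solution bc v0 Q z f y \<Longrightarrow> continuous_on {0..pi} y"
  unfolding hill_solution_def using has_ac_derivative_continuous_on by blast

text \<open>Allows a solution to be replaced by its constant extension beyond the interval.\<close>

lemma hill_solution_cong:
  assumes "hill_solution bc v0 Q z f y" and e: "\<And>x. x \<in> {0..pi} \<Longrightarrow> y x = u x"
  shows "hill_solution bc v0 Q z f u"
proof -
  obtain y' q q' where 1: "has_ac_derivative y y'" "y' square_integrable_on {0..pi}" "has_ac_derivative q q'"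
    "AE x in lebesgue_0pi. q x = y' x - Q x * y x" "satisfies_bc bc y q"
    "AE x in lebesgue_0pi. z * y x + q' x + Q x * y' x - v0 * y x = f x"
    using assms(1) unfolding hill_solution_def by blast
  have ae: "AE x in lebesgue_0pi. y x = u x"
    by (rule AE_I2) (simp add: e)
  have "y 0 = u 0" "y pi = u pi" using e by auto
  then have "satisfies_bc bc u q"
    using 1(5) by (cases bc) auto
  moreover have "has_ac_derivative u y'"
    using 1(1) e unfolding has_ac_derivative_iff by simp
  moreover have "AE x in lebesgue_0pi. q x = y' x - Q x * u x"
    using 1(4) ae by eventually_elim simp
  moreover have "AE x in lebesgue_0pi. z * u x + q' x + Q x * y' x - v0 * u x = f x"
    using 1(6) ae by eventually_elim simp
  ultimately show ?thesis
    unfolding hill_solution_def using 1(2,3) by blast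
qed

text \<open>The graph element is l = z y - F almost everywhere. In the converse direction this makes
  l square integrable, since y is continuous and F lies in \<open>l2\<close>.\<close>

lemma hill_operator_iff_hill_solution:
  assumes Q: "Q square_integrable_on {0..pi}"
  shows "(\<exists>w. (u, w) \<in> hill_operator bc v0 Q \<and> z *\<^sub>C u - w = F) \<longleftrightarrow>
    (\<exists>y. u = abs_l2 y \<and> hill_solution bc v0 Q z (rep_l2 F) y)"
proof
  assume "\<exists>w. (u, w) \<in> hill_operator bc v0 Q \<and> z *\<^sub>C u - w = F"
  then obtain y l y' q q' where u: "u = abs_l2 y" and F: "z *\<^sub>C abs_l2 y - abs_l2 l = F"
    and 1: "has_ac_derivative y y'" "y' square_integrable_on {0..pi}" "has_ac_derivative q q'"
    "AE x in lebesgue_0pi. q x = y' x - Q x * y x" "satisfies_bc bc y q"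
    and l: "l = (\<lambda>x. - q' x - Q x * y' x + v0 * y x)" "l square_integrable_on {0..pi}"
    unfolding hill_operator_def by blast
  have y: "y square_integrable_on {0..pi}"
    by (rule square_integrable_continuous[OF has_ac_derivative_continuous_on[OF 1(1)]])
  have "F = abs_l2 (\<lambda>x. z * y x - l x)"
    using F y l(2) by (simp add: scaleC_abs_l2 abs_l2_diff square_integrable_mult)
  moreover have "(\<lambda>x. z * y x - l x) square_integrable_on {0..pi}"
    using square_integrable_add[OF square_integrable_mult[OF y] square_integrable_uminus[OF l(2)]] by simp
  ultimately have "AE x in lebesgue_0pi. rep_l2 F x = z * y x - l x"
    using AE_rep_abs_l2 by simp
  then have "AE x in lebesgue_0pi. z * y x + q' x + Q x * y' x - v0 * y x = rep_l2 F x"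
    by eventually_elim (simp add: l)
  then show "\<exists>y. u = abs_l2 y \<and> hill_solution bc v0 Q z (rep_l2 F) y"
    unfolding hill_solution_def using u 1 by blast
next
  assume "\<exists>y. u = abs_l2 y \<and> hill_solution bc v0 Q z (rep_l2 F) y"
  then obtain y y' q q' where u: "u = abs_l2 y"
    and 1: "has_ac_derivative y y'" "y' square_integrable_on {0..pi}" "has_ac_derivative q q'"
    "AE x in lebesgue_0pi. q x = y' x - Q x * y x" "satisfies_bc bc y q"
    and e: "AE x in lebesgue_0pi. z * y x + q' x + Q x * y' x - v0 * y x = rep_l2 F x"
    unfolding hill_solution_def by blast
  define l where "l = (\<lambda>x. - q' x - Q x * y' x + v0 * y x)"
  have y: "y square_integrable_on {0..pi}"
    by (rule square_integrable_continuous[OF has_ac_derivative_continuous_on[OF 1(1)]])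
  have d: "(\<lambda>x. z * y x - rep_l2 F x) square_integrable_on {0..pi}"
    using square_integrable_add[OF square_integrable_mult[OF y] square_integrable_uminus[OF square_integrable_rep_l2]] by simp
  have ae: "AE x in lebesgue_0pi. l x = z * y x - rep_l2 F x"
    using e by eventually_elim (simp add: l_def algebra_simps)
  have [measurable]: "q' \<in> borel_measurable lebesgue_0pi" "y' \<in> borel_measurable lebesgue_0pi"
    "y \<in> borel_measurable lebesgue_0pi" "Q \<in> borel_measurable lebesgue_0pi"
    using 1(2,3) y Q by (auto simp: square_integrable_on_def has_ac_derivative_iff)
  have lm [measurable]: "l \<in> borel_measurable lebesgue_0pi"
    unfolding l_def by measurable
  have dm [measurable]: "(\<lambda>x. z * y x - rep_l2 F x) \<in> borel_measurable lebesgue_0pi"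
    using d by (simp add: square_integrable_on_def)
  have "integrable lebesgue_0pi (\<lambda>x. (norm (l x))\<^sup>2) \<longleftrightarrow> integrable lebesgue_0pi (\<lambda>x. (norm (z * y x - rep_l2 F x))\<^sup>2)"
    by (rule integrable_cong_AE) (measurable, use ae in \<open>auto elim!: eventually_mono\<close>)
  then have l: "l square_integrable_on {0..pi}"
    using d by (simp add: square_integrable_on_def)
  have "abs_l2 l = abs_l2 (\<lambda>x. z * y x - rep_l2 F x)"
    using abs_l2_eq_iff[OF l d] ae by simp
  also have "\<dots> = z *\<^sub>C u - F"
    using abs_l2_diff[OF square_integrable_mult[OF y] square_integrable_rep_l2, of z F]
    by (simp add: u scaleC_abs_l2[OF y])
  finally have "z *\<^sub>C u - abs_l2 l = F" by simp
  moreover have "(u, abs_l2 l) \<in> hill_operator bc v0 Q"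
    unfolding hill_operator_def u using 1 l l_def by blast
  ultimately show "\<exists>w. (u, w) \<in> hill_operator bc v0 Q \<and> z *\<^sub>C u - w = F" by blast
qed

section \<open>The resolvent with values in bounded continuous functions\<close>

lemma clamp_0pi: "clamp 0 pi x \<in> {0..pi}" for x :: real
  using clamp_in_interval[of 0 pi x] by simp

definition bcontfun_l2 :: "(real \<Rightarrow>\<^sub>C complex) \<Rightarrow>\<^sub>L l2"
  where "bcontfun_l2 = Blinfun (\<lambda>g. abs_l2 (apply_bcontfun g))"

lemma square_integrable_bcontfun: "apply_bcontfun g square_integrable_on {0..pi}"
  by (rule square_integrable_continuous) simp

lemma bcontfun_l2_apply: "blinfun_apply bcontfun_l2 g = abs_l2 (apply_bcontfun g)"
proof -
  have "bounded_linear (\<lambda>g :: real \<Rightarrow>\<^sub>C complex. abs_l2 (apply_bcontfun g))"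
  proof (rule bounded_linear_intro[where K = "sqrt pi"])
    fix f g :: "real \<Rightarrow>\<^sub>C complex" and r :: real
    show "abs_l2 (apply_bcontfun (f + g)) = abs_l2 (apply_bcontfun f) + abs_l2 (apply_bcontfun g)"
      by (simp add: abs_l2_add square_integrable_bcontfun plus_bcontfun.rep_eq)
    show "abs_l2 (apply_bcontfun (r *\<^sub>R f)) = r *\<^sub>R abs_l2 (apply_bcontfun f)"
      by (simp add: scaleR_abs_l2 square_integrable_bcontfun scaleR_bcontfun.rep_eq scaleR_conv_of_real)
    have "(LINT x|lebesgue_0pi. (norm (f x))\<^sup>2) \<le> (LINT x|lebesgue_0pi. (norm f)\<^sup>2)"
      by (rule integral_mono)
        (use square_integrable_bcontfun[of f] in \<open>auto simp: square_integrable_on_def continuous_imp_integrable_real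
          intro!: power_mono norm_bounded\<close>)
    also have "\<dots> = pi * (norm f)\<^sup>2"
      by simp
    finally have "sqrt (LINT x|lebesgue_0pi. (norm (f x))\<^sup>2) \<le> sqrt (pi * (norm f)\<^sup>2)"
      by (rule real_sqrt_le_mono)
    then show "norm (abs_l2 (apply_bcontfun f)) \<le> norm f * sqrt pi"
      using norm_l2.abs_eq[of "apply_bcontfun f"] square_integrable_bcontfun[of f]
      by (simp add: l2_rel_self_iff real_sqrt_mult mult.commute)
  qed
  then show ?thesis
    by (simp add: bcontfun_l2_def bounded_linear_Blinfun_apply)
qed

text \<open>The supremum dominates the essential supremum; through this a pointwise estimate becomes
  one in L^\<infinity>.\<close>

lemma linf_norm_scaleC_bcontfun_l2_le:
  "linf_norm (c *\<^sub>C blinfun_apply bcontfun_l2 g) \<le> ennreal (norm c * norm g)"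
proof -
  have s: "(\<lambda>x. c * g x) square_integrable_on {0..pi}"
    by (rule square_integrable_mult[OF square_integrable_bcontfun])
  have [measurable]: "(\<lambda>x. c * g x) \<in> borel_measurable lebesgue_0pi"
    using s by (simp add: square_integrable_on_def)
  have "linf_norm (c *\<^sub>C blinfun_apply bcontfun_l2 g) = esssup lebesgue_0pi (\<lambda>x. ennreal (norm (c * g x)))"
    unfolding bcontfun_l2_apply scaleC_abs_l2[OF square_integrable_bcontfun]
    using s by (intro linf_norm.abs_eq) (simp add: l2_rel_self_iff)
  also have "\<dots> \<le> ennreal (norm c * norm g)"
    by (intro esssup_I AE_I2 ennreal_leI) (measurable, simp add: norm_mult mult_left_mono norm_bounded)
  finally show ?thesis .
qed

text \<open>The resolvent is factored through bounded continuous functions: these form a Banach space, so the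
  contour integral exists there, and pointwise bounds pass to it directly. Freezing the solution outside
  \<open>{0..pi}\<close> makes it unique.\<close>

definition hill_green ::
    "boundary_condition \<Rightarrow> complex \<Rightarrow> (real \<Rightarrow> complex) \<Rightarrow> complex \<Rightarrow> l2 \<Rightarrow> (real \<Rightarrow>\<^sub>C complex) \<Rightarrow> bool"
  where "hill_green bc v0 Q z F g \<longleftrightarrow>
    hill_solution bc v0 Q z (rep_l2 F) (apply_bcontfun g) \<and> (\<forall>x. g x = g (clamp 0 pi x))"

lemma hill_greenD:
  assumes "hill_green bc v0 Q z F g"
  shows "hill_solution bc v0 Q z (rep_l2 F) (apply_bcontfun g)" "g x = g (clamp 0 pi x)"
  using assms unfolding hill_green_def by blast+

text \<open>The solution operator; on the circle \<open>G_iff\<close> shows that the description is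
  unique and the map bounded and linear.\<close>

definition hill_G ::
    "boundary_condition \<Rightarrow> complex \<Rightarrow> (real \<Rightarrow> complex) \<Rightarrow> complex \<Rightarrow> l2 \<Rightarrow>\<^sub>L (real \<Rightarrow>\<^sub>C complex)"
  where "hill_G bc v0 Q z = Blinfun (\<lambda>F. THE g. hill_green bc v0 Q z F g)"

text \<open>\<open>*\<^sub>B\<close> acts on operators from \<open>l2\<close> to \<open>l2\<close>
  only, so the complex factor \<gamma>'(t) is applied to the argument.
  \<open>bcontfun_l2_G_scaleC\<close> later moves it to the outside.\<close>

definition hill_integrand ::
    "boundary_condition \<Rightarrow> complex \<Rightarrow> (real \<Rightarrow> complex) \<Rightarrow> nat \<Rightarrow> real \<Rightarrow> l2 \<Rightarrow>\<^sub>L (real \<Rightarrow>\<^sub>C complex)"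
  where "hill_integrand bc v0 Q n t = hill_G bc v0 Q (circlepath ((of_nat n)\<^sup>2) (real n) t) o\<^sub>L
    (vector_derivative (circlepath ((of_nat n)\<^sup>2) (real n)) (at t within {0..1}) *\<^sub>B id_blinfun)"

lemma scaleC_l2_add_left: "(c + d) *\<^sub>C F = c *\<^sub>C F + d *\<^sub>C F"
  using abs_l2_add[OF square_integrable_mult square_integrable_mult, OF square_integrable_rep_l2 square_integrable_rep_l2, of c F d F]
    scaleC_abs_l2[OF square_integrable_rep_l2, of _ F] by (simp add: distrib_right)

lemma bounded_linear_scaleC_id: "bounded_linear (\<lambda>c. c *\<^sub>B id_blinfun)"
proof (rule bounded_linear_intro[where K = 1])
  fix c d :: complex and r :: real
  show "(c + d) *\<^sub>B id_blinfun = c *\<^sub>B id_blinfun + d *\<^sub>B id_blinfun"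
    by (rule blinfun_eqI) (simp add: blinfun.add_left scaleC_l2_add_left)
  show "(r *\<^sub>R c) *\<^sub>B id_blinfun = r *\<^sub>R (c *\<^sub>B id_blinfun)"
  proof (rule blinfun_eqI)
    fix F
    show "blinfun_apply ((r *\<^sub>R c) *\<^sub>B id_blinfun) F = blinfun_apply (r *\<^sub>R (c *\<^sub>B id_blinfun)) F"
      using scaleC_abs_l2[OF square_integrable_rep_l2, of _ F]
        scaleR_abs_l2[OF square_integrable_mult[OF square_integrable_rep_l2], of r c F]
      by (simp add: blinfun.scaleR_left scaleR_conv_of_real mult.assoc)
  qed
  show "norm (c *\<^sub>B id_blinfun) \<le> norm c * 1"
    by (rule norm_blinfun_bound) (simp_all add: norm_scaleC_l2)
qed

text \<open>These two properties carry all spectral information: applied to the difference of two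
  solutions, the bound gives uniqueness, and in general it gives boundedness of the inverse.\<close>

locale hill_circle =
  fixes bc :: boundary_condition and v0 :: complex and Q :: "real \<Rightarrow> complex" and n :: nat and c :: real
  assumes Q: "Q square_integrable_on {0..pi}" and c: "0 \<le> c"
    and ex: "norm (z - (of_nat n)\<^sup>2) = real n \<Longrightarrow> integrable lebesgue_0pi f \<Longrightarrow> \<exists>y. hill_solution bc v0 Q z f y"
    and bound: "norm (z - (of_nat n)\<^sup>2) = real n \<Longrightarrow> integrable lebesgue_0pi f \<Longrightarrow> hill_solution bc v0 Q z f y \<Longrightarrow>
      x \<in> {0..pi} \<Longrightarrow> norm (y x) \<le> c * (LINT t|lebesgue_0pi. norm (f t))"
begin

abbreviation circle :: "complex set" where "circle \<equiv> {z. norm (z - (of_nat n)\<^sup>2) = real n}"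

lemma solution_unique:
  assumes "z \<in> circle" "integrable lebesgue_0pi f" "hill_solution bc v0 Q z f y" "hill_solution bc v0 Q z f u" "x \<in> {0..pi}"
  shows "y x = u x"
  using bound[OF _ _ hill_solution_diff[OF assms(3,4)] assms(5)] assms(1,2) by simp

lemma green_ex1:
  assumes z: "z \<in> circle"
  shows "\<exists>!g. hill_green bc v0 Q z F g"
proof (rule ex_ex1I)
  obtain y where y: "hill_solution bc v0 Q z (rep_l2 F) y"
    using ex[OF z[THEN CollectD] integrable_rep_l2[of F]] by (rule exE)
  have "continuous_on (cbox 0 pi) y"
    using hill_solution_continuous_on[OF y] by simp
  then obtain g :: "real \<Rightarrow>\<^sub>C complex" where g: "\<And>x. x \<in> cbox 0 pi \<Longrightarrow> g x = y x" "\<And>x. g x = y (clamp 0 pi x)"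
    by (rule continuous_on_cbox_bcontfunE) (rule that)
  have "hill_solution bc v0 Q z (rep_l2 F) (apply_bcontfun g)"
    by (rule hill_solution_cong[OF y]) (use g(1) in simp)
  moreover have "g x = g (clamp 0 pi x)" for x
    using trans[OF g(2)[of x] g(1)[of "clamp 0 pi x", symmetric]] clamp_0pi[of x] by simp
  ultimately show "\<exists>g. hill_green bc v0 Q z F g"
    unfolding hill_green_def by blast
next
  fix g h assume g: "hill_green bc v0 Q z F g" and h: "hill_green bc v0 Q z F h"
  show "g = h"
  proof (rule bcontfun_eqI)
    fix x
    have "g (clamp 0 pi x) = h (clamp 0 pi x)"
      by (rule solution_unique[OF z integrable_rep_l2 hill_greenD(1)[OF g] hill_greenD(1)[OF h] clamp_0pi])
    then show "g x = h x"
      by (subst hill_greenD(2)[OF g], subst hill_greenD(2)[OF h])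
  qed
qed

lemma green_norm_le:
  assumes z: "z \<in> circle" and g: "hill_green bc v0 Q z F g"
  shows "norm g \<le> c * l1_norm F"
proof (rule norm_bound)
  fix x
  have "norm (g (clamp 0 pi x)) \<le> c * l1_norm F"
    unfolding l1_norm_eq
    by (rule bound[OF z[THEN CollectD] integrable_rep_l2 hill_greenD(1)[OF g] clamp_0pi])
  then show "norm (g x) \<le> c * l1_norm F"
    by (subst hill_greenD(2)[OF g])
qed

lemma green_add:
  assumes "hill_green bc v0 Q z F g" "hill_green bc v0 Q z F' g'"
  shows "hill_green bc v0 Q z (F + F') (g + g')"
  unfolding hill_green_def
proof (intro conjI allI)
  have "AE x in lebesgue_0pi. rep_l2 F x + rep_l2 F' x = rep_l2 (F + F') x"
    using AE_rep_l2_add[of F F'] by eventually_elim simp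
  then show "hill_solution bc v0 Q z (rep_l2 (F + F')) (apply_bcontfun (g + g'))"
    unfolding plus_bcontfun.rep_eq
    by (rule hill_solution_cong_AE[OF hill_solution_add[OF hill_greenD(1)[OF assms(1)] hill_greenD(1)[OF assms(2)]]])
  show "(g + g') x = (g + g') (clamp 0 pi x)" for x
    unfolding plus_bcontfun.rep_eq
    by (rule arg_cong2[where f = "(+)", OF hill_greenD(2)[OF assms(1)] hill_greenD(2)[OF assms(2)]])
qed

lemma green_scaleC:
  assumes "hill_green bc v0 Q z F g"
  shows "hill_solution bc v0 Q z (rep_l2 (a *\<^sub>C F)) (\<lambda>x. a * g x)"
proof -
  have "AE x in lebesgue_0pi. a * rep_l2 F x = rep_l2 (a *\<^sub>C F) x"
    using AE_rep_l2_scaleC[of a F] by eventually_elim simp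
  moreover have "hill_solution bc v0 Q z (\<lambda>x. a * rep_l2 F x) (\<lambda>x. a * g x)"
    by (rule hill_solution_cmult[OF hill_greenD(1)[OF assms]])
  ultimately show ?thesis
    by (rule hill_solution_cong_AE[rotated])
qed

lemma green_scaleR:
  assumes "hill_green bc v0 Q z F g"
  shows "hill_green bc v0 Q z (r *\<^sub>R F) (r *\<^sub>R g)"
  unfolding hill_green_def
proof (intro conjI allI)
  show "hill_solution bc v0 Q z (rep_l2 (r *\<^sub>R F)) (apply_bcontfun (r *\<^sub>R g))"
    using green_scaleC[OF assms, of "of_real r"]
    by (simp add: scaleR_l2_eq_scaleC scaleR_bcontfun.rep_eq scaleR_conv_of_real)
  show "(r *\<^sub>R g) x = (r *\<^sub>R g) (clamp 0 pi x)" for x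
    unfolding scaleR_bcontfun.rep_eq
    by (rule arg_cong[where f = "(*\<^sub>R) r", OF hill_greenD(2)[OF assms]])
qed

text \<open>By uniqueness the chosen solution is additive and homogeneous, and the L^1 bound
  together with \<open>l1_norm_le\<close> bounds it in terms of the norm of
  \<open>l2\<close>.\<close>

lemma G_iff:
  assumes z: "z \<in> circle"
  shows "blinfun_apply (hill_G bc v0 Q z) F = g \<longleftrightarrow> hill_green bc v0 Q z F g"
proof -
  let ?g = "\<lambda>F. THE g. hill_green bc v0 Q z F g"
  have g: "hill_green bc v0 Q z F (?g F)" for F
    by (rule theI'[OF green_ex1[OF z]])
  have uniq: "h = ?g F" if "hill_green bc v0 Q z F h" for h F
    using the1_equality[OF green_ex1[OF z] that] by simp
  have "bounded_linear ?g"
  proof (rule bounded_linear_intro[where K = "c * sqrt pi"])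
    show "?g (F + F') = ?g F + ?g F'" for F F'
      by (rule uniq[symmetric, OF green_add[OF g g]])
    show "?g (r *\<^sub>R F) = r *\<^sub>R ?g F" for r F
      by (rule uniq[symmetric, OF green_scaleR[OF g]])
    have "norm (?g F) \<le> c * (sqrt pi * norm F)" for F
      using green_norm_le[OF z g] mult_left_mono[OF l1_norm_le c] by (rule order_trans)
    then show "norm (?g F) \<le> norm F * (c * sqrt pi)" for F
      by (simp add: mult_ac)
  qed
  then have "blinfun_apply (hill_G bc v0 Q z) = ?g"
    unfolding hill_G_def by (rule bounded_linear_Blinfun_apply)
  then show ?thesis
    using g[of F] uniq[of F g] by auto
qed

lemma G_green: "z \<in> circle \<Longrightarrow> hill_green bc v0 Q z F (blinfun_apply (hill_G bc v0 Q z) F)"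
  using G_iff by blast

lemma bcontfun_l2_G_eq:
  assumes z: "z \<in> circle" and y: "hill_solution bc v0 Q z (rep_l2 F) y"
  shows "blinfun_apply bcontfun_l2 (blinfun_apply (hill_G bc v0 Q z) F) = abs_l2 y"
proof -
  have "AE x in lebesgue_0pi. blinfun_apply (hill_G bc v0 Q z) F x = y x"
    by (rule AE_I2, rule solution_unique[OF z integrable_rep_l2 hill_greenD(1)[OF G_green[OF z]] y]) simp
  then show ?thesis
    using abs_l2_eq_iff[OF square_integrable_bcontfun square_integrable_continuous[OF hill_solution_continuous_on[OF y]]]
    by (simp add: bcontfun_l2_apply)
qed

lemma bcontfun_l2_G_scaleC:
  assumes z: "z \<in> circle"
  shows "blinfun_apply bcontfun_l2 (blinfun_apply (hill_G bc v0 Q z) (a *\<^sub>C F)) =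
    a *\<^sub>C blinfun_apply bcontfun_l2 (blinfun_apply (hill_G bc v0 Q z) F)"
  using bcontfun_l2_G_eq[OF z green_scaleC[OF G_green[OF z]], of a F]
  by (simp add: bcontfun_l2_apply scaleC_abs_l2[OF square_integrable_bcontfun])

text \<open>The property that defines \<open>resolvent\<close> prescribes every value of the
  operator, so at most one operator has it; that the composition has it is unique solvability on the
  circle.\<close>

lemma resolvent_eq:
  assumes z: "z \<in> circle"
  shows "resolvent (hill_operator bc v0 Q) z = bcontfun_l2 o\<^sub>L hill_G bc v0 Q z"
  unfolding resolvent_def hill_operator_iff_hill_solution[OF Q]
proof (rule the_equality)
  show *: "\<forall>F u. (blinfun_apply (bcontfun_l2 o\<^sub>L hill_G bc v0 Q z) F = u) \<longleftrightarrow>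
      (\<exists>y. u = abs_l2 y \<and> hill_solution bc v0 Q z (rep_l2 F) y)"
  proof (intro allI iffI)
    fix F u assume "blinfun_apply (bcontfun_l2 o\<^sub>L hill_G bc v0 Q z) F = u"
    then show "\<exists>y. u = abs_l2 y \<and> hill_solution bc v0 Q z (rep_l2 F) y"
      using hill_greenD(1)[OF G_green[OF z, of F]] by (auto simp: bcontfun_l2_apply)
  next
    fix F u assume "\<exists>y. u = abs_l2 y \<and> hill_solution bc v0 Q z (rep_l2 F) y"
    then show "blinfun_apply (bcontfun_l2 o\<^sub>L hill_G bc v0 Q z) F = u"
      using bcontfun_l2_G_eq[OF z] by auto
  qed
  fix R :: "l2 \<Rightarrow>\<^sub>L l2"
  assume R: "\<forall>F u. (blinfun_apply R F = u) \<longleftrightarrow> (\<exists>y. u = abs_l2 y \<and> hill_solution bc v0 Q z (rep_l2 F) y)"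
  show "R = bcontfun_l2 o\<^sub>L hill_G bc v0 Q z"
    by (rule blinfun_eqI) (use R * in blast)
qed

text \<open>By \<open>hill_solution_shift\<close>, g - h solves the equation at z with source -(z -
  w) h. The a priori bound is used twice, for h and for the difference; pi is the length of the
  interval and sqrt pi compares the norms of F.\<close>

lemma G_lipschitz:
  assumes z: "z \<in> circle" and w: "w \<in> circle"
  shows "norm (hill_G bc v0 Q z - hill_G bc v0 Q w) \<le> (c * pi * c * sqrt pi) * norm (z - w)"
proof (rule norm_blinfun_bound)
  show "0 \<le> (c * pi * c * sqrt pi) * norm (z - w)"
    using c by simp
  fix F
  define g h where "g = blinfun_apply (hill_G bc v0 Q z) F" and "h = blinfun_apply (hill_G bc v0 Q w) F"
  have g: "hill_green bc v0 Q z F g" and h: "hill_green bc v0 Q w F h"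
    unfolding g_def h_def using G_green z w by blast+
  let ?f = "\<lambda>x. rep_l2 F x - (rep_l2 F x + (z - w) * h x)"
  have sol: "hill_solution bc v0 Q z ?f (\<lambda>x. g x - h x)"
    by (rule hill_solution_diff[OF hill_greenD(1)[OF g] hill_solution_shift[OF hill_greenD(1)[OF h]]])
  have i: "integrable lebesgue_0pi (\<lambda>x. h x)"
    by (rule continuous_imp_integrable_real) simp
  then have f: "integrable lebesgue_0pi ?f"
    by simp
  have "(LINT x|lebesgue_0pi. norm (?f x)) = (LINT x|lebesgue_0pi. norm (z - w) * norm (h x))"
    by (simp add: norm_mult)
  also have "\<dots> \<le> (LINT x|lebesgue_0pi. norm (z - w) * (c * l1_norm F))"
  proof (rule integral_mono)
    show "integrable lebesgue_0pi (\<lambda>x. norm (z - w) * norm (h x))"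
      using i by (intro integrable_mult_right integrable_norm)
    show "integrable lebesgue_0pi (\<lambda>x. norm (z - w) * (c * l1_norm F))"
      by (intro continuous_imp_integrable_real continuous_intros)
    show "norm (z - w) * norm (h x) \<le> norm (z - w) * (c * l1_norm F)" for x
      by (intro mult_left_mono order_trans[OF norm_bounded green_norm_le[OF w h]]) simp
  qed
  also have "\<dots> = pi * (norm (z - w) * (c * l1_norm F))"
    by simp
  finally have L1: "(LINT x|lebesgue_0pi. norm (?f x)) \<le> pi * (norm (z - w) * (c * l1_norm F))" .
  have le: "norm (g x - h x) \<le> c * (pi * (norm (z - w) * (c * l1_norm F)))" if "x \<in> {0..pi}" for x
    by (rule order_trans[OF bound[OF z[THEN CollectD] f sol that] mult_left_mono[OF L1 c]])
  have "norm (g - h) \<le> c * (pi * (norm (z - w) * (c * l1_norm F)))"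
  proof (rule norm_bound)
    fix x
    have "(g - h) x = g (clamp 0 pi x) - h (clamp 0 pi x)"
      unfolding minus_bcontfun.rep_eq
      by (rule arg_cong2[where f = "(-)", OF hill_greenD(2)[OF g] hill_greenD(2)[OF h]])
    then show "norm ((g - h) x) \<le> c * (pi * (norm (z - w) * (c * l1_norm F)))"
      using le[OF clamp_0pi] by simp
  qed
  also have "\<dots> \<le> c * (pi * (norm (z - w) * (c * (sqrt pi * norm F))))"
    by (intro mult_left_mono l1_norm_le c) auto
  finally show "norm (blinfun_apply (hill_G bc v0 Q z - hill_G bc v0 Q w) F) \<le> (c * pi * c * sqrt pi) * norm (z - w) * norm F"
    by (simp add: blinfun.diff_left g_def h_def mult_ac)
qed

lemma circlepath_in_circle: "circlepath ((of_nat n)\<^sup>2) (real n) t \<in> circle"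
  by (simp add: circlepath norm_mult)

lemma continuous_on_integrand: "continuous_on {0..1} (hill_integrand bc v0 Q n)"
proof -
  have "(c * pi * c * sqrt pi)-lipschitz_on circle (hill_G bc v0 Q)"
    by (rule lipschitz_onI) (use G_lipschitz c in \<open>auto simp: dist_norm\<close>)
  then have G: "continuous_on circle (hill_G bc v0 Q)"
    by (rule lipschitz_on_continuous_on)
  have G': "continuous_on {0..1} (\<lambda>t. hill_G bc v0 Q (circlepath ((of_nat n)\<^sup>2) (real n) t))"
    by (rule continuous_on_compose2[OF G])
      (use circlepath_in_circle in \<open>auto simp: circlepath intro!: continuous_intros\<close>)
  have "continuous_on {0..1} (\<lambda>t. 2 * pi * \<i> * real n * exp (2 * of_real pi * \<i> * complex_of_real t))"
    by (intro continuous_intros)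
  then have d: "continuous_on {0..1} (\<lambda>t. vector_derivative (circlepath ((of_nat n)\<^sup>2) (real n)) (at t within {0..1}))"
    by (rule continuous_on_eq) (simp add: vector_derivative_circlepath01)
  have "continuous_on {0..1} (\<lambda>t. vector_derivative (circlepath ((of_nat n)\<^sup>2) (real n)) (at t within {0..1}) *\<^sub>B id_blinfun)"
    by (rule bounded_linear.continuous_on[OF bounded_linear_scaleC_id d])
  then show ?thesis
    unfolding hill_integrand_def
    by (rule bounded_bilinear.continuous_on[OF bounded_bilinear_blinfun_compose G'])
qed

text \<open>Composition with the embedding is bounded and linear, hence commutes with the integral.
  The integral over operators on \<open>l2\<close> is thereby obtained from one over a Banach
  space.\<close>

lemma riesz_projection_eq:
  "riesz_projection (hill_operator bc v0 Q) n =
    (1 / (2 * of_real pi * \<i>)) *\<^sub>B (bcontfun_l2 o\<^sub>L integral {0..1} (hill_integrand bc v0 Q n))"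
proof -
  have "operator_contour_integral (circlepath ((of_nat n)\<^sup>2) (real n)) (resolvent (hill_operator bc v0 Q)) =
    integral {0..1} ((\<lambda>T. bcontfun_l2 o\<^sub>L T) \<circ> hill_integrand bc v0 Q n)"
    unfolding operator_contour_integral_def
  proof (rule integral_cong)
    fix t
    show "vector_derivative (circlepath ((of_nat n)\<^sup>2) (real n)) (at t within {0..1}) *\<^sub>B
        resolvent (hill_operator bc v0 Q) (circlepath ((of_nat n)\<^sup>2) (real n) t) =
      ((\<lambda>T. bcontfun_l2 o\<^sub>L T) \<circ> hill_integrand bc v0 Q n) t"
      by (rule blinfun_eqI)
        (simp add: resolvent_eq[OF circlepath_in_circle] hill_integrand_def bcontfun_l2_G_scaleC[OF circlepath_in_circle])
  qed
  also have "\<dots> = bcontfun_l2 o\<^sub>L integral {0..1} (hill_integrand bc v0 Q n)"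
    by (rule integral_linear[OF integrable_continuous_interval[OF continuous_on_integrand]])
      (rule bounded_bilinear.bounded_linear_right[OF bounded_bilinear_blinfun_compose])
  finally show ?thesis
    by (simp add: riesz_projection_def)
qed

end

text \<open>The factor \<gamma>'(t) gives the source an L^1 norm of at most 2 pi n, so the
  integrands applied to F differ by at most 2 pi n d in the supremum norm; the prefactor of the
  Riesz integral removes 2 pi.\<close>

lemma norm_L1_Linf_riesz_projection_diff_le:
  assumes "hill_circle bc v0 Q n c" "hill_circle bc 0 (\<lambda>_. 0) n c0" and d: "0 \<le> d"
    and cmp: "\<And>z f y y0 x. norm (z - (of_nat n)\<^sup>2) = real n \<Longrightarrow> integrable lebesgue_0pi f \<Longrightarrow>
      hill_solution bc v0 Q z f y \<Longrightarrow> hill_solution bc 0 (\<lambda>_. 0) z f y0 \<Longrightarrow> x \<in> {0..pi} \<Longrightarrow>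
      norm (y x - y0 x) \<le> d * (LINT t|lebesgue_0pi. norm (f t))"
  shows "norm_L1_Linf (riesz_projection (hill_operator bc v0 Q) n - riesz_projection (hill_operator bc 0 (\<lambda>_. 0)) n)
    \<le> ennreal (d * n)"
proof -
  interpret A: hill_circle bc v0 Q n c by fact
  interpret B: hill_circle bc 0 "\<lambda>_. 0" n c0 by fact
  let ?H = "hill_integrand bc v0 Q n" and ?K = "hill_integrand bc 0 (\<lambda>_. 0) n"
  let ?\<gamma> = "circlepath ((of_nat n)\<^sup>2) (real n)"
  have le: "linf_norm (blinfun_apply (riesz_projection (hill_operator bc v0 Q) n - riesz_projection (hill_operator bc 0 (\<lambda>_. 0)) n) F)
    \<le> ennreal (d * n)" if F: "l1_norm F \<le> 1" for F
  proof -
    have each: "norm (blinfun_apply (?H t - ?K t) F) \<le> d * (2 * pi * n)" if t: "t \<in> {0..1}" for t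
    proof -
      define a where "a = vector_derivative ?\<gamma> (at t within {0..1})"
      have "norm a = 2 * pi * n"
        using t by (simp add: a_def vector_derivative_circlepath01 norm_mult)
      then have l1: "l1_norm (a *\<^sub>C F) \<le> 2 * pi * n"
        using mult_left_mono[OF F, of "norm a"] by (simp add: l1_norm_scaleC)
      define g h where "g = blinfun_apply (?H t) F" and "h = blinfun_apply (?K t) F"
      have g: "hill_green bc v0 Q (?\<gamma> t) (a *\<^sub>C F) g"
        using A.G_green[OF A.circlepath_in_circle] by (simp add: g_def hill_integrand_def a_def)
      have h: "hill_green bc 0 (\<lambda>_. 0) (?\<gamma> t) (a *\<^sub>C F) h"
        using B.G_green[OF B.circlepath_in_circle] by (simp add: h_def hill_integrand_def a_def)
      have "norm (g - h) \<le> d * l1_norm (a *\<^sub>C F)"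
      proof (rule norm_bound)
        fix x
        have "norm (g (clamp 0 pi x) - h (clamp 0 pi x)) \<le> d * l1_norm (a *\<^sub>C F)"
          unfolding l1_norm_eq
          by (rule cmp[OF A.circlepath_in_circle[THEN CollectD] integrable_rep_l2
                hill_greenD(1)[OF g] hill_greenD(1)[OF h] clamp_0pi])
        moreover have "(g - h) x = g (clamp 0 pi x) - h (clamp 0 pi x)"
          unfolding minus_bcontfun.rep_eq
          by (rule arg_cong2[where f = "(-)", OF hill_greenD(2)[OF g] hill_greenD(2)[OF h]])
        ultimately show "norm ((g - h) x) \<le> d * l1_norm (a *\<^sub>C F)" by simp
      qed
      also have "\<dots> \<le> d * (2 * pi * n)"
        by (rule mult_left_mono[OF l1 d])
      finally show ?thesis
        by (simp add: blinfun.diff_left g_def h_def)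
    qed
    have cont: "continuous_on {0..1} (\<lambda>t. ?H t - ?K t)"
      by (intro continuous_on_diff A.continuous_on_integrand B.continuous_on_integrand)
    have int: "?H integrable_on {0..1}" "?K integrable_on {0..1}" "(\<lambda>t. ?H t - ?K t) integrable_on {0..1}"
      by (intro integrable_continuous_interval A.continuous_on_integrand B.continuous_on_integrand cont)+
    define g where "g = blinfun_apply (integral {0..1} ?H - integral {0..1} ?K) F"
    \<comment> \<open>Evaluation at F is bounded and linear, so the estimate may be made for each F
      under the integral, where the L^1 norm of F is at hand.\<close>
    have "g = blinfun_apply (integral {0..1} (\<lambda>t. ?H t - ?K t)) F"
      unfolding g_def using integral_diff[OF int(1,2)] by simp
    also have "\<dots> = integral {0..1} ((\<lambda>T. blinfun_apply T F) \<circ> (\<lambda>t. ?H t - ?K t))"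
      by (rule integral_linear[symmetric, OF int(3) blinfun.bounded_linear_left])
    finally have "g = integral {0..1} (\<lambda>t. blinfun_apply (?H t - ?K t) F)"
      by (simp add: o_def)
    moreover have "norm (integral {0..1} (\<lambda>t. blinfun_apply (?H t - ?K t) F)) \<le> d * (2 * pi * n) * (1 - 0)"
      by (rule integral_bound[OF _ _ each])
        (auto intro!: bounded_linear.continuous_on[OF blinfun.bounded_linear_left cont])
    ultimately have g: "norm g \<le> d * (2 * pi * n)" by simp
    let ?a = "1 / (2 * of_real pi * \<i>)"
    have "blinfun_apply (riesz_projection (hill_operator bc v0 Q) n - riesz_projection (hill_operator bc 0 (\<lambda>_. 0)) n) F =
      ?a *\<^sub>C blinfun_apply bcontfun_l2 g"
      unfolding A.riesz_projection_eq B.riesz_projection_eq g_def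
      by (simp add: blinfun.diff_left blinfun.diff_right linear_diff[OF bounded_linear.linear[OF bounded_linear_scaleC_l2]])
    then have "linf_norm (blinfun_apply (riesz_projection (hill_operator bc v0 Q) n - riesz_projection (hill_operator bc 0 (\<lambda>_. 0)) n) F)
      \<le> ennreal (norm ?a * norm g)"
      using linf_norm_scaleC_bcontfun_l2_le by simp
    also have "\<dots> \<le> ennreal (norm ?a * (d * (2 * pi * n)))"
      by (intro ennreal_leI mult_left_mono g) simp
    also have "norm ?a * (d * (2 * pi * n)) = d * n"
      by (simp add: norm_divide norm_mult)
    finally show ?thesis .
  qed
  then show ?thesis
    unfolding norm_L1_Linf_def by (auto intro!: SUP_least)
qed

theorem theorem45:
  fixes v :: "(real \<Rightarrow> complex) \<Rightarrow> complex"
    and v0 :: complex and Q :: "real \<Rightarrow> complex"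
    and bc :: boundary_condition
  assumes "in_Hminus1_loc v"
    and "periodic_distribution pi v"
    and "potential_decomposition v v0 Q"
  shows "((\<lambda>n. norm_L1_Linf (riesz_projection (hill_operator bc v0 Q) n
             - riesz_projection (hill_operator bc 0 (\<lambda>_. 0)) n)) \<longlongrightarrow> 0)
         (inf sequentially (principal {n. admissible bc n}))"
proof (rule order_tendstoI)
  have Q: "Q square_integrable_on {0..pi}"
    using assms(3) unfolding potential_decomposition_def by blast
  have Q0: "(\<lambda>_. 0) square_integrable_on {0..pi}"
    by (simp add: square_integrable_on_def)
  fix a :: ennreal assume "0 < a"
  \<comment> \<open>An intermediate value is finite even if a is infinite, and it leaves room for
    the strict inequality.\<close>
  then obtain b where b: "0 < b" "b < a" using dense by blast
  then obtain r where r: "b = ennreal r" "0 < r"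
    by (cases b) auto
  obtain D where D: "0 \<le> D" "\<forall>\<^sub>F n in sequentially. admissible bc n \<longrightarrow>
      (\<forall>(z::complex) f. norm (z - (of_nat n)\<^sup>2) = real n \<longrightarrow> integrable lebesgue_0pi f \<longrightarrow>
        (\<exists>y. hill_solution bc v0 Q z f y) \<and>
        (\<forall>y. hill_solution bc v0 Q z f y \<longrightarrow>
          (\<forall>x\<in>{0..pi}. norm (y x) \<le> D / n * (LINT t|lebesgue_0pi. norm (f t)))) \<and>
        (\<forall>y y0. hill_solution bc v0 Q z f y \<longrightarrow> hill_solution bc 0 (\<lambda>_. 0) z f y0 \<longrightarrow>
          (\<forall>x\<in>{0..pi}. norm (y x - y0 x) \<le> r / n * (LINT t|lebesgue_0pi. norm (f t)))))"
    by (rule hill_circle_estimates[OF Q, of bc v0]) (use r in blast)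
  obtain D0 where D0: "0 \<le> D0" "\<forall>\<^sub>F n in sequentially. admissible bc n \<longrightarrow>
      (\<forall>(z::complex) f. norm (z - (of_nat n)\<^sup>2) = real n \<longrightarrow> integrable lebesgue_0pi f \<longrightarrow>
        (\<exists>y. hill_solution bc 0 (\<lambda>_. 0) z f y) \<and>
        (\<forall>y. hill_solution bc 0 (\<lambda>_. 0) z f y \<longrightarrow>
          (\<forall>x\<in>{0..pi}. norm (y x) \<le> D0 / n * (LINT t|lebesgue_0pi. norm (f t)))) \<and>
        (\<forall>y y0. hill_solution bc 0 (\<lambda>_. 0) z f y \<longrightarrow> hill_solution bc 0 (\<lambda>_. 0) z f y0 \<longrightarrow>
          (\<forall>x\<in>{0..pi}. norm (y x - y0 x) \<le> r / n * (LINT t|lebesgue_0pi. norm (f t)))))"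
    \<comment> \<open>The same estimates with zero potential place the circle in the resolvent set
      of the free operator.\<close>
    by (rule hill_circle_estimates[OF Q0, of bc 0]) (use r in blast)
  show "\<forall>\<^sub>F n in inf sequentially (principal {n. admissible bc n}).
      norm_L1_Linf (riesz_projection (hill_operator bc v0 Q) n - riesz_projection (hill_operator bc 0 (\<lambda>_. 0)) n) < a"
    unfolding eventually_inf_principal
    using D(2) D0(2) eventually_gt_at_top[of 0]
  proof eventually_elim
    case (elim n)
    show ?case
    proof
      assume "n \<in> {n. admissible bc n}"
      then have adm: "admissible bc n" by simp
      note e = elim(1)[rule_format, OF adm] and e0 = elim(2)[rule_format, OF adm]
      have 1: "hill_circle bc v0 Q n (D / n)"
        by (unfold_locales) (use Q D(1) e in auto)
      have 2: "hill_circle bc 0 (\<lambda>_. 0) n (D0 / n)"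
        by (unfold_locales) (use Q0 D0(1) e0 in auto)
      have "norm_L1_Linf (riesz_projection (hill_operator bc v0 Q) n - riesz_projection (hill_operator bc 0 (\<lambda>_. 0)) n)
        \<le> ennreal (r / n * n)"
        \<comment> \<open>Taken with d = r/n: the factor n from the circle cancels the 1/n of the
          resolvent difference.\<close>
        by (rule norm_L1_Linf_riesz_projection_diff_le[OF 1 2]) (use r e in auto)
      also have "\<dots> = b"
        using r elim(3) by simp
      finally show "norm_L1_Linf (riesz_projection (hill_operator bc v0 Q) n - riesz_projection (hill_operator bc 0 (\<lambda>_. 0)) n) < a"
        using b(2) by simp
    qed
  qed
qed simp

end
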